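(* Let $n\ge 13$ and let $D$ be an integer with $\frac{n}{2}\le D\le \frac{2n-7}{3}$. Let $H_{n,D}$ be the graph obtained from the cycle $C_{2(n-D)}$ by choosing two antipodal vertices $a,b$ of the cycle (at distance $n-D$) and attaching a pendant path of length $D-\lfloor n/2\rfloor$ at $a$ and a pendant path of length $D-\lceil n/2\rceil$ at $b$ (a path of length $0$ means nothing is attached); in the paper's notation, $H_{n,D}=C_{(n-D-1,n-D-1)}^{(D-\lfloor n/2\rfloor,\,D-\lceil n/2\rceil)}$. Then $H_{n,D}$ is the unique graph (up to isomorphism) having minimum spectral radius among all connected graphs on $n$ vertices with diameter $D$.
   Context: Graphs are finite and simple; the spectral radius of a graph is the largest eigenvalue of its adjacency matrix. A pendant path of length $\ell\ge1$ attached at a vertex $v$ means $\ell$ new vertices $u_1,\dots,u_\ell$ and the path $vu_1\cdots u_\ell$. The graph $H_{n,D}$ has $2(n-D)+(2D-n)=n$ vertices. *)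

theory Defs
  imports
    "Graph_Theory.Graph_Theory"
    "Jordan_Normal_Form.Spectral_Radius"
begin

text \<open>
  A finite simple graph is a \<^locale>\<open>pair_graph\<close>: a finite vertex set with a symmetric,
  irreflexive arc relation.  An undirected edge is the pair of arcs in both directions.
\<close>

definition graph_dist :: "'a pair_pre_digraph \<Rightarrow> 'a \<Rightarrow> 'a \<Rightarrow> ereal" where
  "graph_dist G u v = wf_digraph.\<mu> (with_proj G) (\<lambda>_. 1) u v"

definition graph_diameter :: "'a pair_pre_digraph \<Rightarrow> ereal" where
  "graph_diameter G = (SUP u\<in>pverts G. SUP v\<in>pverts G. graph_dist G u v)"

definition adjacency_matrix :: "'a list \<Rightarrow> 'a pair_pre_digraph \<Rightarrow> real mat" where
  "adjacency_matrix vs G =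
     mat (length vs) (length vs) (\<lambda>(i, j). if (vs ! i, vs ! j) \<in> parcs G then 1 else 0)"

text \<open>
  The order in which the vertices are listed is irrelevant for the eigenvalues, see
  \<open>spectrum_adjacency_matrix_unique\<close> below.
\<close>

definition vertex_list :: "'a pair_pre_digraph \<Rightarrow> 'a list" where
  "vertex_list G = (SOME vs. distinct vs \<and> set vs = pverts G)"

text \<open>
  The matrix is real symmetric, so all its eigenvalues are real and \<^const>\<open>spectrum\<close> over
  the reals is the full spectrum.
\<close>

definition graph_spectral_radius :: "'a pair_pre_digraph \<Rightarrow> real" where
  "graph_spectral_radius G = Max (spectrum (adjacency_matrix (vertex_list G) G))"

lemma vertex_list:
  assumes "finite (pverts G)"
  shows "distinct (vertex_list G)" "set (vertex_list G) = pverts G"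
  using someI_ex[of "\<lambda>vs. distinct vs \<and> set vs = pverts G"] finite_distinct_list[OF assms]
  unfolding vertex_list_def by blast+

lemma adjacency_matrix_mult_vec_nth:
  assumes "distinct vs" "i < length vs"
  shows "(adjacency_matrix vs G *\<^sub>v vec (length vs) (\<lambda>j. f (vs ! j))) $ i =
    (\<Sum>w \<in> {w \<in> set vs. (vs ! i, w) \<in> parcs G}. f w)"
proof -
  have bij: "bij_betw ((!) vs) {0..<length vs} (set vs)"
    using assms(1) by (simp add: bij_betw_nth atLeast0LessThan)
  have "(adjacency_matrix vs G *\<^sub>v vec (length vs) (\<lambda>j. f (vs ! j))) $ i =
      (\<Sum>j = 0..<length vs. if (vs ! i, vs ! j) \<in> parcs G then f (vs ! j) else 0)"
    using assms(2) by (auto simp: adjacency_matrix_def scalar_prod_def intro!: sum.cong)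
  also have "\<dots> = (\<Sum>w \<in> set vs. if (vs ! i, w) \<in> parcs G then f w else 0)"
    by (rule sum.reindex_bij_betw[OF bij])
  also have "\<dots> = (\<Sum>w \<in> {w \<in> set vs. (vs ! i, w) \<in> parcs G}. f w)"
    by (rule sum.inter_filter[symmetric]) simp
  finally show ?thesis .
qed

lemma eigenvalue_adjacency_matrix_iff:
  assumes "distinct vs"
  shows "eigenvalue (adjacency_matrix vs G) k \<longleftrightarrow>
    (\<exists>f. (\<exists>u \<in> set vs. f u \<noteq> 0) \<and>
      (\<forall>u \<in> set vs. (\<Sum>w \<in> {w \<in> set vs. (u, w) \<in> parcs G}. f w) = k * f u))"
    (is "?L \<longleftrightarrow> (\<exists>f. ?P f)")
proof
  assume ?L
  then obtain x where x: "x \<in> carrier_vec (length vs)" "x \<noteq> 0\<^sub>v (length vs)"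
      "adjacency_matrix vs G *\<^sub>v x = k \<cdot>\<^sub>v x"
    by (auto simp: eigenvalue_def eigenvector_def adjacency_matrix_def)
  have bij: "bij_betw ((!) vs) {..<length vs} (set vs)"
    using assms by (simp add: bij_betw_nth)
  define f where "f w = x $ (the_inv_into {..<length vs} ((!) vs) w)" for w
  have f: "f (vs ! j) = x $ j" if "j < length vs" for j
    using that bij by (simp add: f_def the_inv_into_f_f bij_betw_def)
  have xf: "x = vec (length vs) (\<lambda>j. f (vs ! j))"
    using x(1) f by (intro eq_vecI) auto
  have "?P f"
  proof
    from x(1,2) obtain j where "j < length vs" "x $ j \<noteq> 0"
      by (metis carrier_vecD eq_vecI index_zero_vec(1,2))
    then show "\<exists>u \<in> set vs. f u \<noteq> 0" using f nth_mem by metis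
    show "\<forall>u \<in> set vs. (\<Sum>w \<in> {w \<in> set vs. (u, w) \<in> parcs G}. f w) = k * f u"
    proof
      fix u assume "u \<in> set vs"
      then obtain i where i: "i < length vs" "u = vs ! i" by (auto simp: in_set_conv_nth)
      have "(\<Sum>w \<in> {w \<in> set vs. (u, w) \<in> parcs G}. f w) = (adjacency_matrix vs G *\<^sub>v x) $ i"
        using adjacency_matrix_mult_vec_nth[OF assms i(1), of G f] i(2) xf by simp
      also have "\<dots> = k * f u" using x(1,3) i f by simp
      finally show "(\<Sum>w \<in> {w \<in> set vs. (u, w) \<in> parcs G}. f w) = k * f u" .
    qed
  qed
  then show "\<exists>f. ?P f" by (rule exI[of _ f])
next
  assume "\<exists>f. ?P f"
  then obtain f where f: "?P f" ..
  define x where "x = vec (length vs) (\<lambda>j. f (vs ! j))"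
  have "x \<noteq> 0\<^sub>v (length vs)"
  proof
    assume x0: "x = 0\<^sub>v (length vs)"
    have "f (vs ! j) = 0" if "j < length vs" for j
      using arg_cong[OF x0, of "\<lambda>y. y $ j"] that by (simp add: x_def)
    with f show False by (metis in_set_conv_nth)
  qed
  moreover have "adjacency_matrix vs G *\<^sub>v x = k \<cdot>\<^sub>v x"
  proof (rule eq_vecI)
    fix i assume "i < dim_vec (k \<cdot>\<^sub>v x)"
    then have i: "i < length vs" by (simp add: x_def)
    show "(adjacency_matrix vs G *\<^sub>v x) $ i = (k \<cdot>\<^sub>v x) $ i"
      using adjacency_matrix_mult_vec_nth[OF assms i, of G f] f i by (simp add: x_def)
  qed (simp add: x_def adjacency_matrix_def)
  ultimately show ?L
    unfolding eigenvalue_def eigenvector_def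
    by (intro exI[of _ x]) (simp add: adjacency_matrix_def x_def)
qed

lemma spectrum_adjacency_matrix_unique:
  assumes "distinct vs" "distinct ws" "set vs = set ws"
  shows "spectrum (adjacency_matrix vs G) = spectrum (adjacency_matrix ws G)"
  using assms unfolding spectrum_def
  by (intro Collect_cong) (simp add: eigenvalue_adjacency_matrix_iff)

datatype cp_vertex = Cyc nat | PathA nat | PathB nat

text \<open>
  \<open>cycle_paths p q k l\<close> is the graph $C_{(p,q)}^{(k,l)}$: a cycle on the \<open>p + q + 2\<close> vertices
  \<open>Cyc 0, Cyc 1, \<dots>\<close>, in which the vertices \<open>a = Cyc 0\<close> and \<open>b = Cyc (p + 1)\<close> are separated by
  \<open>p\<close> inner vertices on one side and \<open>q\<close> on the other, with pendant paths
  \<open>a, PathA 1, \<dots>, PathA k\<close> and \<open>b, PathB 1, \<dots>, PathB l\<close>.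
\<close>

definition cp_edges :: "nat \<Rightarrow> nat \<Rightarrow> nat \<Rightarrow> nat \<Rightarrow> cp_vertex rel" where
  "cp_edges p q k l =
     {(Cyc i, Cyc (Suc i mod (p + q + 2))) | i. i < p + q + 2} \<union>
     {(Cyc 0, PathA 1) | _ :: unit. 1 \<le> k} \<union>
     {(PathA i, PathA (Suc i)) | i. 1 \<le> i \<and> i < k} \<union>
     {(Cyc (p + 1), PathB 1) | _ :: unit. 1 \<le> l} \<union>
     {(PathB i, PathB (Suc i)) | i. 1 \<le> i \<and> i < l}"

definition cycle_paths :: "nat \<Rightarrow> nat \<Rightarrow> nat \<Rightarrow> nat \<Rightarrow> cp_vertex pair_pre_digraph" where
  "cycle_paths p q k l =
     \<lparr> pverts = Cyc ` {..<p + q + 2} \<union> PathA ` {1..k} \<union> PathB ` {1..l},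
       parcs = cp_edges p q k l \<union> (cp_edges p q k l)\<inverse> \<rparr>"

text \<open>
  The subtractions do not truncate when \<open>n / 2 \<le> D < n\<close>; \<open>(n + 1) div 2\<close> is the ceiling of
  \<open>n / 2\<close>.
\<close>

definition H_graph :: "nat \<Rightarrow> nat \<Rightarrow> cp_vertex pair_pre_digraph" where
  "H_graph n D = cycle_paths (n - D - 1) (n - D - 1) (D - n div 2) (D - (n + 1) div 2)"

definition connected_graph_with :: "nat \<Rightarrow> nat \<Rightarrow> 'a pair_pre_digraph \<Rightarrow> bool" where
  "connected_graph_with n D G \<longleftrightarrow>
     pair_graph G \<and> Digraph_Component.connected (with_proj G) \<and>
     card (pverts G) = n \<and> graph_diameter G = ereal (real D)"

lemma card_pverts_H_graph:
  assumes "n \<le> 2 * D" "D < n"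
  shows "card (pverts (H_graph n D)) = n"
proof -
  have "card (Cyc ` {..<c} \<union> PathA ` {1..k} \<union> PathB ` {1..l}) = c + k + l" for c k l
    by (subst card_Un_disjoint; (subst card_Un_disjoint)?) (auto simp: card_image inj_on_def)
  then show ?thesis using assms by (simp add: H_graph_def cycle_paths_def)
qed

lemma pair_graph_cycle_paths:
  assumes "1 \<le> p + q"
  shows "pair_graph (cycle_paths p q k l)"
proof -
  have fin: "finite (pverts (cycle_paths p q k l))" by (simp add: cycle_paths_def)
  have sub: "parcs (cycle_paths p q k l) \<subseteq> pverts (cycle_paths p q k l) \<times> pverts (cycle_paths p q k l)"
    by (auto simp: cycle_paths_def cp_edges_def)
  have ne: "Suc i mod (p + q + 2) \<noteq> i" if "i < p + q + 2" for i
    using that by (cases "Suc i = p + q + 2") auto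
  show ?thesis
  proof
    show "finite (parcs (cycle_paths p q k l))"
      using finite_subset[OF sub] fin by blast
    show "symmetric (with_proj (cycle_paths p q k l))"
      by (auto simp: symmetric_def cycle_paths_def sym_def)
    show "fst e \<noteq> snd e" if "e \<in> parcs (cycle_paths p q k l)" for e
      using that ne by (auto simp: cycle_paths_def cp_edges_def) (metis ne)+
  qed (use fin sub in auto)
qed

end

theory Submission
  imports Defs "HOL-Analysis.Function_Topology"
begin

text \<open>
  Let \<open>x\<close> be a positive vector with \<open>A x \<le> \<lambda> x\<close>, where \<open>\<lambda> = t + 1 / t\<close> and \<open>1 < t \<le> sqrt 2\<close>, so that
  \<open>\<lambda> \<le> 3 / sqrt 2\<close>. Call an edge \<open>v w\<close> light from \<open>v\<close> if \<open>t x(w) \<le> x(v)\<close>. Beyond a light edge the graph is a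
  pendant path, and among any three neighbours of a vertex one is reached by a light edge. Hence a
  connected graph with spectral radius at most \<open>\<lambda>\<close> is a path or a cycle with pendant paths attached, up
  to one exceptional family with a vertex of degree four.

  A spine vertex \<open>v\<close> with spine neighbours \<open>a\<close>, \<open>b\<close> and a pendant path of length \<open>p\<close> satisfies
  \<open>g(p)\<^sup>2 \<le> U(v, a) U(v, b)\<close>, where \<open>U(v, a) = t (t x(v) - x(a)) / (t x(a) - x(v))\<close> and \<open>g(p)\<close> depends only on
  \<open>q = t\<^sup>2\<close> and \<open>p\<close>. Since \<open>U(v, a) U(a, v) = q\<close>, these inequalities telescope along the spine. On a path,
  with \<open>q = 2\<close>, they make the branch vertices so far apart that the diameter \<open>D\<close> satisfies
  \<open>3 D \<ge> 2 n - 6\<close>, which is excluded. On a cycle of length \<open>L\<close> they give \<open>g(p\<^sub>1) g(p\<^sub>2) \<dots> \<le> q ^ (L / 2)\<close>. For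
  \<open>H\<close>, with pendant paths of lengths \<open>k\<close> and \<open>l\<close> on a cycle of length \<open>2 m\<close>, equality \<open>g(k) g(l) = q ^ m\<close>
  determines \<open>q\<close>, and for this \<open>q\<close> the product \<open>g(a) g(b)\<close> with \<open>a + b \<ge> k + l\<close> is smallest exactly in the
  balanced case, which forces \<open>L = 2 m\<close> and then the shape of \<open>H\<close>.
\<close>

section \<open>Gains of branch vertices\<close>

text \<open>With \<open>\<lambda> = t + 1 / t\<close> the recurrence
  \<open>y (j - 1) + y (j + 1) = \<lambda> * y j\<close> has the solutions \<open>t ^ j\<close> and
  \<open>1 / t ^ j\<close>. Writing \<open>x(v) = \<alpha> + \<beta>\<close> and
  \<open>x(a) = \<alpha> * t + \<beta> / t\<close> across an edge gives
  \<open>U(v, a) = \<beta> / \<alpha>\<close>; reading the edge backwards exchanges the two modes,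
  whence the factor \<open>q\<close>, and the edge is light from \<open>v\<close> exactly when
  \<open>\<alpha> \<le> 0\<close>. The inequality at \<open>v\<close> becomes
  \<open>1 / (1 + U) + 1 / (1 + B) + \<delta> \<le> 1\<close>, where \<open>U\<close> and
  \<open>B\<close> belong to the two spine edges and \<open>\<delta>\<close> is the least share of
  the pendant path; \<open>g\<close> solves \<open>2 / (1 + g) = 1 - \<delta>\<close>, the symmetric
  equality case. Inequalities \<open>A x \<le> \<lambda> x\<close> survive an increase of
  \<open>\<lambda>\<close>, so one Perron vector can be tested at \<open>q = 2\<close> on acyclic
  graphs and at the parameter of \<open>H\<close> on cycles. For \<open>n = 2 * m + k + l\<close>
  and \<open>D = m + k + l\<close> the upper bound on \<open>D\<close> reads
  \<open>k + l + 7 \<le> m\<close>, that is \<open>3 * D + 7 \<le> 2 * n\<close>: it just excludes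
  the acyclic case, and it leaves the room needed to compare \<open>H\<close> with unbalanced
  branches.\<close>

lemma tail_ratio:
  fixes t :: real and y :: "nat \<Rightarrow> real"
  assumes "t > 1" and "\<And>h. h < p \<Longrightarrow> y h + y (Suc (Suc h)) \<le> (t + 1 / t) * y (Suc h)"
    and "y (Suc p) = 0"
  shows "t * ((t\<^sup>2) ^ p - 1) * y 0 \<le> ((t\<^sup>2) ^ Suc p - 1) * y 1"
  using assms(2,3)
proof (induction p arbitrary: y)
  case 0
  then show ?case by simp
next
  case (Suc p)
  define P where "P = (t\<^sup>2) ^ p"
  have P: "P \<ge> 1" using \<open>t > 1\<close> by (simp add: P_def one_le_power)
  have tP: "t\<^sup>2 * P > 1" using \<open>t > 1\<close> P by (smt (verit) mult_le_cancel_left1 one_less_power zero_less_numeral)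
  \<comment> \<open>The bound is sharp for multiples of
    \<open>t ^ (Suc p - h) - 1 / t ^ (Suc p - h)\<close>, the solutions vanishing just past the end.
    The induction removes the root.\<close>
  have IH: "t * (P - 1) * y 1 \<le> (t\<^sup>2 * P - 1) * y 2"
    using Suc.IH[of "\<lambda>h. y (Suc h)"] Suc.prems by (simp add: P_def numeral_2_eq_2)
  have "y 0 + y 2 \<le> (t + 1 / t) * y 1"
    using Suc.prems(1)[of 0] by (simp add: numeral_2_eq_2)
  then have "t * (t\<^sup>2 * P - 1) * (y 0 + y 2) \<le> t * (t\<^sup>2 * P - 1) * ((t + 1 / t) * y 1)"
    using \<open>t > 1\<close> tP by (intro mult_left_mono) auto
  moreover have "t * (t * (P - 1) * y 1) \<le> t * ((t\<^sup>2 * P - 1) * y 2)"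
    using IH \<open>t > 1\<close> by (intro mult_left_mono) auto
  moreover have "t * (t\<^sup>2 * P - 1) * ((t + 1 / t) * y 1) = (t\<^sup>2 + 1) * (t\<^sup>2 * P - 1) * y 1"
    using \<open>t > 1\<close> by (simp add: field_simps power2_eq_square)
  ultimately have "t * (t\<^sup>2 * P - 1) * y 0 \<le> (t\<^sup>2 * (t\<^sup>2 * P) - 1) * y 1"
    by (simp add: algebra_simps power2_eq_square)
  then show ?case by (simp add: P_def)
qed

text \<open>The function \<open>g\<close> of the introduction is \<open>branch_gain q\<close>, and \<open>U(v, a)\<close> is \<open>edge_gain t x(v) x(a)\<close>.\<close>

definition branch_defect :: "real \<Rightarrow> nat \<Rightarrow> real" where
  "branch_defect q p = 1 / (q - 1) - 1 / (q ^ Suc p - 1)"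

definition branch_gain :: "real \<Rightarrow> nat \<Rightarrow> real" where
  "branch_gain q p = (1 + branch_defect q p) / (1 - branch_defect q p)"

lemma branch_defect_0 [simp]: "branch_defect q 0 = 0"
  by (simp add: branch_defect_def)

lemma inverse_diff_one_antimono:
  fixes a b :: real
  assumes "1 < a" "a \<le> b"
  shows "1 / (b - 1) \<le> 1 / (a - 1)"
  using assms by (intro divide_left_mono mult_pos_pos) auto

lemma branch_defect_mono:
  assumes "q > 1" "a \<le> b"
  shows "branch_defect q a \<le> branch_defect q b"
proof -
  have "q ^ Suc a \<le> q ^ Suc b" using assms by (intro power_increasing) auto
  moreover have "q ^ Suc a > 1" using assms by (intro one_less_power) auto
  ultimately show ?thesis
    unfolding branch_defect_def by (intro diff_left_mono inverse_diff_one_antimono)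
qed

lemma branch_defect_nonneg: "q > 1 \<Longrightarrow> branch_defect q p \<ge> 0"
  using branch_defect_mono[of q 0 p] by simp

lemma branch_gain_ge_1: "q > 1 \<Longrightarrow> branch_defect q p < 1 \<Longrightarrow> branch_gain q p \<ge> 1"
  using branch_defect_nonneg[of q p] by (simp add: branch_gain_def)

lemma branch_gain_mono:
  assumes "q > 1" "a \<le> b" "branch_defect q b < 1"
  shows "branch_gain q a \<le> branch_gain q b"
  using branch_defect_mono[OF assms(1,2)] branch_defect_nonneg[OF assms(1), of a] assms(3)
  unfolding branch_gain_def by (intro frac_le) auto

lemma one_minus_branch_defect:
  assumes "q > 1"
  shows "1 - branch_defect q p = (q * q ^ Suc p - 2 * q ^ Suc p + 1) / ((q - 1) * (q ^ Suc p - 1))"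
proof -
  have "q ^ Suc p > 1" using assms by (intro one_less_power) auto
  then have nz: "q - 1 \<noteq> 0" "q ^ Suc p - 1 \<noteq> 0" "(q - 1) * (q ^ Suc p - 1) \<noteq> 0"
    using assms by auto
  have "branch_defect q p = (q ^ Suc p - q) / ((q - 1) * (q ^ Suc p - 1))"
    unfolding branch_defect_def diff_frac_eq[OF nz(1,2)] by simp
  then have "1 - branch_defect q p =
      ((q - 1) * (q ^ Suc p - 1) - (q ^ Suc p - q)) / ((q - 1) * (q ^ Suc p - 1))"
    using nz(3) by (simp add: diff_divide_distrib del: power_Suc)
  then show ?thesis by (simp add: algebra_simps)
qed

text \<open>For \<open>q < 2\<close> this caps the length of a pendant path; for
  \<open>q \<ge> 2\<close> every length passes.\<close>

lemma branch_defect_less_1_iff: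
  assumes "q > 1"
  shows "branch_defect q p < 1 \<longleftrightarrow> (2 - q) * q ^ Suc p < 1"
proof -
  have "q ^ Suc p > 1" using assms by (intro one_less_power) auto
  then have "(q - 1) * (q ^ Suc p - 1) > 0" using assms by simp
  then have "0 < 1 - branch_defect q p \<longleftrightarrow> 0 < q * q ^ Suc p - 2 * q ^ Suc p + 1"
    using one_minus_branch_defect[OF assms, of p] zero_less_divide_iff[of _ "(q - 1) * (q ^ Suc p - 1)"]
    by (smt (verit))
  then show ?thesis by (simp add: algebra_simps)
qed

text \<open>Numerator and denominator are affine in \<open>q ^ Suc p\<close>. Hence, for two
  branches of fixed total length, both products depend only on the sum of the two powers.\<close>

lemma branch_gain_eq:
  assumes "q > 1" "branch_defect q p < 1"
  shows "branch_gain q p = (q * q ^ Suc p - (2 * q - 1)) / (1 - (2 - q) * q ^ Suc p)"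
proof -
  define Q where "Q = q ^ Suc p"
  have Q: "Q > 1" unfolding Q_def using assms by (intro one_less_power) auto
  have w: "1 - (2 - q) * Q > 0" using branch_defect_less_1_iff[OF assms(1)] assms(2) Q_def by auto
  define den where "den = (q - 1) * (Q - 1)"
  have den: "den > 0" using Q assms by (simp add: den_def)
  have m: "1 - branch_defect q p = (1 - (2 - q) * Q) / den"
    using one_minus_branch_defect[OF assms(1), of p] by (simp add: Q_def den_def algebra_simps)
  have "1 + branch_defect q p = 2 - (1 - (2 - q) * Q) / den" using m by simp
  also have "\<dots> = (2 * den - (1 - (2 - q) * Q)) / den" using den by (simp add: field_simps)
  also have "2 * den - (1 - (2 - q) * Q) = q * Q - (2 * q - 1)"
    by (simp add: den_def algebra_simps)
  finally show ?thesis using m den w by (simp add: branch_gain_def Q_def)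
qed

section \<open>The inequality at a branch vertex\<close>

lemma sum_inverse_le_imp_prod_ge:
  fixes U B e :: real
  assumes "U > 0" "B > 0" "e \<ge> 0" "1 / (1 + U) + 1 / (1 + B) \<le> 1 - e"
  shows "e < 1" "((1 + e) / (1 - e))\<^sup>2 \<le> U * B"
proof -
  have "1 / (1 + U) + 1 / (1 + B) > 0" using assms by (simp add: add_pos_pos)
  then show e: "e < 1" using assms by linarith
  \<comment> \<open>By the arithmetic-geometric mean inequality \<open>U + B\<close> may be replaced
    by \<open>2 * r\<close>. What remains factors as
    \<open>(r + 1) * ((1 - e) * r - (1 + e)) \<ge> 0\<close>.\<close>
  define r where "r = sqrt (U * B)"
  have r: "r > 0" "r\<^sup>2 = U * B" using assms by (auto simp: r_def)
  have s: "U + B \<ge> 2 * r"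
    using arith_geo_mean_sqrt[of U B] assms by (simp add: r_def)
  have "1 / (1 + U) + 1 / (1 + B) = (2 + (U + B)) / (1 + (U + B) + U * B)"
    using assms by (simp add: field_simps)
  moreover have "1 + (U + B) + U * B > 0" using assms by (simp add: add_pos_pos)
  ultimately have "2 + (U + B) \<le> (1 - e) * (1 + (U + B) + r\<^sup>2)"
    using assms r by (simp add: pos_divide_le_eq)
  then have "2 + e * (U + B) \<le> (1 - e) * (1 + r\<^sup>2)" by (simp add: algebra_simps)
  moreover have "e * (2 * r) \<le> e * (U + B)" using s assms by (intro mult_left_mono) auto
  ultimately have "0 \<le> (r + 1) * ((1 - e) * r - (1 + e))"
    by (simp add: algebra_simps power2_eq_square)
  then have "1 + e \<le> (1 - e) * r" using r by (simp add: zero_le_mult_iff)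
  then have "(1 + e) / (1 - e) \<le> r" using e by (simp add: pos_divide_le_eq mult.commute)
  then have "((1 + e) / (1 - e))\<^sup>2 \<le> r\<^sup>2" using assms e by (intro power_mono) auto
  then show "((1 + e) / (1 - e))\<^sup>2 \<le> U * B" using r by simp
qed

definition edge_gain :: "real \<Rightarrow> real \<Rightarrow> real \<Rightarrow> real" where
  "edge_gain t v a = t * (t * v - a) / (t * a - v)"

lemma edge_gain_pos: "t > 1 \<Longrightarrow> v < t * a \<Longrightarrow> a < t * v \<Longrightarrow> edge_gain t v a > 0"
  by (simp add: edge_gain_def)

lemma edge_gain_swap:
  assumes "t > 1" "v < t * a" "a < t * v"
  shows "edge_gain t v a * edge_gain t a v = t\<^sup>2"
proof -
  have "t * a - v \<noteq> 0" "t * v - a \<noteq> 0" using assms by auto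
  then show ?thesis by (simp add: edge_gain_def power2_eq_square)
qed

lemma inverse_one_plus_edge_gain:
  assumes "t > 1" "v > 0" "v < t * a" "a < t * v"
  shows "1 / (1 + edge_gain t v a) = (t * a - v) / ((t\<^sup>2 - 1) * v)"
proof -
  have "1 + edge_gain t v a = ((t\<^sup>2 - 1) * v) / (t * a - v)"
    using assms by (simp add: edge_gain_def field_simps power2_eq_square)
  then show ?thesis by simp
qed

text \<open>This is the meaning of \<open>branch_defect\<close>: the least amount, in units of
  \<open>(t\<^sup>2 - 1) * v\<close>, that a pendant path of length \<open>p\<close> uses up in the
  inequality at its root.\<close>

lemma tail_ratio_defect:
  assumes "t > 1" "v > 0" "t * ((t\<^sup>2) ^ p - 1) * v \<le> ((t\<^sup>2) ^ Suc p - 1) * y"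
  shows "branch_defect (t\<^sup>2) p * ((t\<^sup>2 - 1) * v) \<le> t * y"
proof -
  define q where "q = t\<^sup>2"
  have q: "q > 1" using assms by (simp add: q_def one_less_power)
  define Q where "Q = q ^ Suc p"
  have Q: "Q > 1" unfolding Q_def using q by (intro one_less_power) auto
  have "t * (t * (q ^ p - 1) * v) \<le> t * ((Q - 1) * y)"
    using assms by (intro mult_left_mono) (auto simp: q_def Q_def)
  then have "(Q - q) * v \<le> (Q - 1) * (t * y)"
    by (simp add: Q_def q_def algebra_simps power2_eq_square)
  then have "(Q - q) / (Q - 1) * v \<le> t * y" using Q by (simp add: field_simps)
  moreover have "branch_defect q p * (q - 1) = (Q - q) / (Q - 1)"
  proof -
    have nz: "q - 1 \<noteq> 0" "Q - 1 \<noteq> 0" using q Q by auto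
    show ?thesis unfolding branch_defect_def Q_def[symmetric] diff_frac_eq[OF nz] using nz by simp
  qed
  ultimately show ?thesis by (simp add: q_def algebra_simps)
qed

lemma branch_gain_le_edge_gains:
  assumes "t > 1" "v > 0" "v < t * a" "a < t * v" "v < t * b" "b < t * v"
    and "a + b + y \<le> (t + 1 / t) * v"
    and "t * ((t\<^sup>2) ^ p - 1) * v \<le> ((t\<^sup>2) ^ Suc p - 1) * y"
  shows "branch_defect (t\<^sup>2) p < 1"
    and "(branch_gain (t\<^sup>2) p)\<^sup>2 \<le> edge_gain t v a * edge_gain t v b"
proof -
  have q: "t\<^sup>2 > 1" using assms by (simp add: one_less_power)
  have "t * (a + b + y) \<le> t * ((t + 1 / t) * v)" using assms by (intro mult_left_mono) auto
  also have "\<dots> = (t\<^sup>2 + 1) * v" using assms by (simp add: field_simps power2_eq_square)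
  \<comment> \<open>Grouping as \<open>t * a - v\<close> is what makes each neighbour a reciprocal
    \<open>1 / (1 + U)\<close> after division by \<open>(t\<^sup>2 - 1) * v\<close>.\<close>
  finally have "(t * a - v) + (t * b - v) \<le> (1 - branch_defect (t\<^sup>2) p) * ((t\<^sup>2 - 1) * v)"
    using tail_ratio_defect[OF assms(1,2,8)] by (simp add: algebra_simps)
  then have "((t * a - v) + (t * b - v)) / ((t\<^sup>2 - 1) * v) \<le> 1 - branch_defect (t\<^sup>2) p"
    using q assms(2) by (simp add: pos_divide_le_eq)
  then have "1 / (1 + edge_gain t v a) + 1 / (1 + edge_gain t v b) \<le> 1 - branch_defect (t\<^sup>2) p"
    using inverse_one_plus_edge_gain[of t v a] inverse_one_plus_edge_gain[of t v b] assms
    by (simp only: add_divide_distrib)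
  note * = sum_inverse_le_imp_prod_ge[OF _ _ branch_defect_nonneg[OF q] this]
  show "branch_defect (t\<^sup>2) p < 1" by (rule *(1)) (use assms in \<open>auto intro: edge_gain_pos\<close>)
  show "(branch_gain (t\<^sup>2) p)\<^sup>2 \<le> edge_gain t v a * edge_gain t v b"
    unfolding branch_gain_def by (rule *(2)) (use assms in \<open>auto intro: edge_gain_pos\<close>)
qed

section \<open>The balanced parameter\<close>

text \<open>Cross-multiplication turns the gain equation into \<open>F q = 0\<close>. To the right
  of the largest zero \<open>q0\<close> of \<open>W k\<close> the denominators are positive;
  \<open>F q0 < 0 < F 2\<close> then gives a root between \<open>q0\<close> and 2.\<close>

lemma ex_balanced_parameter:
  assumes "1 \<le> k" "l \<le> k" "k + l + 7 \<le> m"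
  shows "\<exists>q::real. 3 / 2 < q \<and> q < 2 \<and> branch_defect q k < 1 \<and> branch_gain q k * branch_gain q l = q ^ m"
proof -
  define W where "W a q = 1 - (2 - q) * q ^ Suc a" for a and q :: real
  define N where "N a q = q * q ^ Suc a - (2 * q - 1)" for a and q :: real
  define F where "F q = q ^ m * (W k q * W l q) - N k q * N l q" for q
  have contW: "continuous_on A (W a)" for a A unfolding W_def by (intro continuous_intros)
  have contF: "continuous_on A F" for A unfolding F_def W_def N_def by (intro continuous_intros)
  have W2: "W a 2 = 1" for a by (simp add: W_def)
  \<comment> \<open>Here \<open>1 \<le> k\<close> enters:
    \<open>(1 / 2) * (3 / 2) ^ 2 = 9 / 8\<close>.\<close>
  have "W k (3 / 2) \<le> 0"
  proof -
    have "(3 / 2 :: real) ^ 2 \<le> (3 / 2) ^ Suc k" using assms by (intro power_increasing) auto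
    then show ?thesis by (simp add: W_def power2_eq_square)
  qed
  have root: "\<exists>r. q \<le> r \<and> r \<le> 2 \<and> W k r = 0" if "q \<le> 2" "W k q \<le> 0" for q
    using IVT'[of "W k" q 0 2] that contW[of _ k] W2[of k] by simp
  define Z where "Z = {3 / 2..2} \<inter> {q. W k q = 0}"
  have "compact Z" unfolding Z_def
    using contW[of UNIV k] by (intro compact_Int_closed compact_Icc closed_Collect_eq continuous_on_const)
  moreover have "Z \<noteq> {}" using root[of "3 / 2"] \<open>W k (3 / 2) \<le> 0\<close> by (auto simp: Z_def)
  ultimately obtain q0 where q0: "q0 \<in> Z" and max: "\<And>q. q \<in> Z \<Longrightarrow> q \<le> q0"
    using compact_attains_sup[of Z] by auto
  have q0': "3 / 2 \<le> q0" "q0 < 2" "W k q0 = 0"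
  proof -
    have "q0 \<noteq> 2" using q0 W2[of k] by (auto simp: Z_def)
    then show "3 / 2 \<le> q0" "q0 < 2" "W k q0 = 0" using q0 by (auto simp: Z_def)
  qed
  have Wk: "W k q > 0" if r: "q0 < q" "q \<le> 2" for q
  proof (rule ccontr)
    assume "\<not> W k q > 0"
    then obtain r where "q \<le> r" "r \<le> 2" "W k r = 0" using root[of q] r by auto
    then show False using max[of r] r q0' by (auto simp: Z_def)
  qed
  have Npos: "N a q > 0" if "q > 1" for a q
  proof -
    have "q ^ 1 \<le> q ^ Suc a" using that by (intro power_increasing) auto
    then have "q * q \<le> q * q ^ Suc a" using that by (intro mult_left_mono) auto
    moreover have "(q - 1) * (q - 1) > 0" using that by simp
    ultimately show ?thesis unfolding N_def by (simp add: algebra_simps)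
  qed
  have "F q0 < 0" using Npos[of q0 k] Npos[of q0 l] q0' by (simp add: F_def)
  \<comment> \<open>At 2 both factors \<open>W\<close> are 1 and \<open>N a 2 < 2 ^ (a + 2)\<close>,
    so the claim follows from \<open>k + l + 4 \<le> m\<close>.\<close>
  moreover have "F 2 > 0"
  proof -
    have "N k 2 * N l 2 < 2 ^ (k + 2) * 2 ^ (l + 2)"
      using Npos[of 2 k] Npos[of 2 l] by (intro mult_strict_mono) (auto simp: N_def)
    also have "\<dots> \<le> (2::real) ^ m"
      unfolding power_add[symmetric] using assms by (intro power_increasing) auto
    finally show ?thesis by (simp add: F_def W2)
  qed
  ultimately obtain q where q: "q0 \<le> q" "q \<le> 2" "F q = 0"
    using IVT'[of F q0 0 2] contF q0' by auto
  have "q \<noteq> q0" "q \<noteq> 2" using q(3) \<open>F q0 < 0\<close> \<open>F 2 > 0\<close> by auto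
  then have qq: "q0 < q" "q < 2" using q(1,2) by linarith+
  then have q1: "q > 1" "q > 3 / 2" using q0' by auto
  have Wkq: "W k q > 0" using Wk q qq by simp
  have dk: "branch_defect q k < 1" using Wkq branch_defect_less_1_iff[OF q1(1)] by (simp add: W_def)
  have dl: "branch_defect q l < 1" using dk branch_defect_mono[OF q1(1) assms(2)] by simp
  have Wlq: "W l q > 0" using dl branch_defect_less_1_iff[OF q1(1)] by (simp add: W_def)
  have "branch_gain q k * branch_gain q l = (N k q * N l q) / (W k q * W l q)"
    using branch_gain_eq[OF q1(1) dk] branch_gain_eq[OF q1(1) dl] by (simp add: N_def W_def)
  also have "\<dots> = q ^ m" using q(3) Wkq Wlq by (simp add: F_def field_simps)
  finally show ?thesis using q1 qq dk by blast
qed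

locale balanced_parameter =
  fixes q :: real and k l m :: nat
  assumes q: "3 / 2 < q" "q < 2"
    and kl: "l \<le> k" "k \<le> Suc l" "k + l + 7 \<le> m"
    and defect_k: "branch_defect q k < 1"
    and gain_eq: "branch_gain q k * branch_gain q l = q ^ m"
begin

lemma q1: "q > 1" using q by simp

definition "W a = 1 - (2 - q) * q ^ Suc a"
definition "N a = q * q ^ Suc a - (2 * q - 1)"

lemma defect_iff: "branch_defect q a < 1 \<longleftrightarrow> W a > 0"
  using branch_defect_less_1_iff[OF q1] by (simp add: W_def)

lemma defect_l: "branch_defect q l < 1"
  using defect_k branch_defect_mono[OF q1 kl(1)] by simp

lemma gain_W: "branch_defect q a < 1 \<Longrightarrow> branch_gain q a * W a = N a"
  using branch_gain_eq[OF q1, of a] defect_iff[of a] by (simp add: W_def N_def)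

lemma gain_prod_W:
  "branch_defect q a < 1 \<Longrightarrow> branch_defect q b < 1 \<Longrightarrow>
    branch_gain q a * branch_gain q b * (W a * W b) = N a * N b"
  using gain_W[of a] gain_W[of b] by (metis mult.commute mult.left_commute)

text \<open>If it failed, \<open>(2 - q) * q ^ m \<le> 3 * q\<close> would keep \<open>W k\<close>
  and \<open>W l\<close> above \<open>3 / 5\<close>, and the gain equation would give
  \<open>q ^ m * (9 / 25) \<le> q ^ (k + l + 4)\<close>. This contradicts
  \<open>k + l + 7 \<le> m\<close>, because \<open>(3 / 2) ^ 3 * (9 / 25) > 1\<close>.\<close>

lemma power_gap: "q * (2 * q - 1) < q ^ m * (2 - q)"
proof (rule ccontr)
  assume asm: "\<not> ?thesis"
  have q5: "q ^ 5 \<ge> (3 / 2) ^ 5" and q3: "q ^ 3 \<ge> (3 / 2) ^ 3" using q by (auto intro: power_mono)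
  \<comment> \<open>The constant comes from
    \<open>3 / (3 / 2) ^ 5 = 96 / 243 < 2 / 5\<close>.\<close>
  have small: "(2 - q) * q ^ Suc a \<le> 2 / 5" if "a \<le> k" for a
  proof -
    have "q ^ (Suc a + 6) \<le> q ^ m" using q1 kl that by (intro power_increasing) auto
    then have "(2 - q) * q ^ (Suc a + 6) \<le> (2 - q) * q ^ m" using q by (intro mult_left_mono) auto
    also have "\<dots> \<le> q * 3"
    proof -
      have "q * (2 * q - 1) \<le> q * 3" using q by (intro mult_left_mono) auto
      then show ?thesis using asm by (simp add: mult.commute)
    qed
    finally have "((2 - q) * q ^ Suc a) * q ^ 5 \<le> 3"
      using q1 by (simp add: power_add eval_nat_numeral ac_simps)
    moreover have "((2 - q) * q ^ Suc a) * (3 / 2) ^ 5 \<le> ((2 - q) * q ^ Suc a) * q ^ 5"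
      using q5 q by (intro mult_left_mono) auto
    ultimately show ?thesis by (simp add: power_divide)
  qed
  have Wge: "W k \<ge> 3 / 5" "W l \<ge> 3 / 5" using small[of k] small[of l] kl by (auto simp: W_def)
  have "q ^ m * (9 / 25) \<le> q ^ m * (W k * W l)"
    using Wge q1 mult_mono[OF Wge] by (intro mult_left_mono) auto
  also have "\<dots> = N k * N l"
    using gain_prod_W[OF defect_k defect_l] gain_eq by simp
  also have "\<dots> \<le> (q * q ^ Suc k) * (q * q ^ Suc l)"
  proof (rule mult_mono)
    have "0 \<le> branch_gain q l * W l"
      using branch_gain_ge_1[OF q1 defect_l] Wge by (intro mult_nonneg_nonneg) auto
    then show "0 \<le> N l" using gain_W[OF defect_l] by simp
  qed (use q1 in \<open>auto simp: N_def\<close>)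
  also have "\<dots> = q ^ (k + l + 4)" by (simp add: power_add eval_nat_numeral)
  finally have 1: "q ^ m * (9 / 25) \<le> q ^ (k + l + 4)" .
  have "q ^ (k + l + 4) * (3 / 2) ^ 3 \<le> q ^ (k + l + 4) * q ^ 3"
    using q3 q1 by (intro mult_left_mono) auto
  also have "\<dots> = q ^ (k + l + 4 + 3)" by (simp only: power_add)
  also have "\<dots> \<le> q ^ m" using kl q1 by (intro power_increasing) auto
  finally have "q ^ (k + l + 4) * (3 / 2) ^ 3 \<le> q ^ m" .
  moreover have "q ^ (k + l + 4) > 0" using q1 by simp
  ultimately show False using 1 by (simp add: power_divide)
qed

text \<open>Convexity of powers: the difference of the two sides is
  \<open>(q ^ Suc k - q ^ Suc b) * (q ^ (a - k) - 1)\<close>, and near-balance of \<open>k\<close>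
  and \<open>l\<close> forces \<open>a > k\<close>.\<close>

lemma spread:
  assumes "a + b = k + l" "b \<le> a" "a \<noteq> k"
  shows "q ^ Suc k + q ^ Suc l < q ^ Suc a + q ^ Suc b"
proof -
  define i where "i = a - k"
  have i: "a = k + i" "l = b + i" "i > 0" using assms kl by (auto simp: i_def)
  have "q ^ i > 1" using i q1 by (simp add: one_less_power)
  moreover have "q ^ Suc k > q ^ Suc b" using i kl q1 by (intro power_strict_increasing) auto
  ultimately have "0 < (q ^ Suc k - q ^ Suc b) * (q ^ i - 1)" by simp
  also have "\<dots> = q ^ Suc a + q ^ Suc b - (q ^ Suc k + q ^ Suc l)"
    by (simp add: i power_add algebra_simps)
  finally show ?thesis by simp
qed

text \<open>
  With \<open>q ^ Suc a * q ^ Suc b\<close> fixed, \<open>N a * N b - q ^ m * (W a * W b)\<close> is an affine function of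
  \<open>q ^ Suc a + q ^ Suc b\<close>; it vanishes at \<open>(k, l)\<close> and its slope is positive by \<open>power_gap\<close>.
\<close>

lemma gain_less_unbalanced:
  assumes "a + b = k + l" "b \<le> a" "a \<noteq> k" "branch_defect q a < 1" "branch_defect q b < 1"
  shows "q ^ m < branch_gain q a * branch_gain q b"
proof -
  define S S' where "S = q ^ Suc k + q ^ Suc l" and "S' = q ^ Suc a + q ^ Suc b"
  define P where "P = q ^ (k + l + 2)"
  have P: "q ^ Suc k * q ^ Suc l = P" "q ^ Suc a * q ^ Suc b = P"
    using assms(1) by (auto simp: P_def power_add[symmetric] simp del: power_Suc)
  have W: "W i * W j = 1 - (2 - q) * (q ^ Suc i + q ^ Suc j) + (2 - q)\<^sup>2 * (q ^ Suc i * q ^ Suc j)" for i j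
    by (simp add: W_def algebra_simps power2_eq_square)
  have N: "N i * N j = q\<^sup>2 * (q ^ Suc i * q ^ Suc j) - q * (2 * q - 1) * (q ^ Suc i + q ^ Suc j) + (2 * q - 1)\<^sup>2" for i j
    by (simp add: N_def algebra_simps power2_eq_square)
  have "N k * N l = q ^ m * (W k * W l)" using gain_prod_W[OF defect_k defect_l] gain_eq by simp
  then have "N a * N b - q ^ m * (W a * W b) = (q ^ m * (2 - q) - q * (2 * q - 1)) * (S' - S)"
    unfolding W N P S_def[symmetric] S'_def[symmetric] by (simp add: algebra_simps)
  moreover have "S' > S" unfolding S_def S'_def by (rule spread) fact+
  ultimately have "N a * N b - q ^ m * (W a * W b) > 0" using power_gap by simp
  then have "q ^ m * (W a * W b) < branch_gain q a * branch_gain q b * (W a * W b)"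
    using gain_prod_W[OF assms(4,5)] by simp
  moreover have "W a * W b > 0" using assms defect_iff by simp
  ultimately show ?thesis using mult_less_cancel_right_pos by blast
qed

lemma gain_le_imp_balanced:
  assumes "a + b = k + l" "branch_defect q a < 1" "branch_defect q b < 1"
    and "branch_gain q a * branch_gain q b \<le> q ^ m"
  shows "a = k \<and> b = l \<or> a = l \<and> b = k"
proof (cases "b \<le> a")
  case True
  then show ?thesis using gain_less_unbalanced[of a b] assms by fastforce
next
  case False
  then have "b = k" using gain_less_unbalanced[of b a] assms by (fastforce simp: mult.commute add.commute)
  then show ?thesis using assms by simp
qed

lemma gain_ge:
  assumes "k + l \<le> a + b" "branch_defect q a < 1" "branch_defect q b < 1"
  shows "q ^ m \<le> branch_gain q a * branch_gain q b"
proof -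
  \<comment> \<open>The lengths are shortened until their total is exactly \<open>k + l\<close>; the
    gains can only decrease.\<close>
  obtain a' b' where ab: "a' \<le> a" "b' \<le> b" "a' + b' = k + l"
  proof (cases "a \<le> k + l")
    case True
    then show ?thesis using that[of a "k + l - a"] assms by simp
  next
    case False
    then show ?thesis using that[of "k + l" 0] by simp
  qed
  have d: "branch_defect q a' < 1" "branch_defect q b' < 1"
    using branch_defect_mono[OF q1 ab(1)] branch_defect_mono[OF q1 ab(2)] assms by auto
  have "branch_gain q a' * branch_gain q b' \<le> branch_gain q a * branch_gain q b"
    using branch_gain_mono[OF q1 ab(1)] branch_gain_mono[OF q1 ab(2)] assms d
      branch_gain_ge_1[OF q1 d(1)] branch_gain_ge_1[OF q1 d(2)] by (intro mult_mono) auto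
  moreover have "q ^ m \<le> branch_gain q a' * branch_gain q b'"
  proof (rule ccontr)
    assume neg: "\<not> ?thesis"
    then have "a' = k \<and> b' = l \<or> a' = l \<and> b' = k" using gain_le_imp_balanced[OF ab(3) d] by simp
    then show False using neg gain_eq by (auto simp: mult.commute)
  qed
  ultimately show ?thesis by simp
qed

end

text \<open>
  The premises collect what is known about a cycle of length \<open>L\<close> with pendant paths of lengths \<open>a\<close> and
  \<open>b\<close> that realise the diameter \<open>m + k + l\<close> among \<open>2 * m + k + l\<close> vertices.
\<close>

definition forces_balance :: "real \<Rightarrow> nat \<Rightarrow> nat \<Rightarrow> nat \<Rightarrow> bool" where
  "forces_balance q k l m \<longleftrightarrow> (\<forall>a b L. branch_defect q a < 1 \<longrightarrow> branch_defect q b < 1 \<longrightarrow>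
     (branch_gain q a * branch_gain q b)\<^sup>2 \<le> q ^ L \<longrightarrow>
     m + k + l \<le> a + b + L div 2 \<longrightarrow> L + a + b \<le> 2 * m + k + l \<longrightarrow>
     L = 2 * m \<and> (a = k \<and> b = l \<or> a = l \<and> b = k))"

text \<open>The two counting premises give \<open>L \<le> 2 * m\<close> and then
  \<open>a + b \<ge> k + l\<close>. Now \<open>gain_ge\<close> yields
  \<open>q ^ (2 * m) \<le> q ^ L\<close>, so every estimate is an equality and
  \<open>gain_le_imp_balanced\<close> applies.\<close>

lemma (in balanced_parameter) forces_balance: "forces_balance q k l m"
  unfolding forces_balance_def
proof (intro allI impI)
  fix a b L
  assume d: "branch_defect q a < 1" "branch_defect q b < 1"
    and le: "(branch_gain q a * branch_gain q b)\<^sup>2 \<le> q ^ L"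
    and D: "m + k + l \<le> a + b + L div 2" "L + a + b \<le> 2 * m + k + l"
  have "L \<le> 2 * m" using D by linarith
  then have "k + l \<le> a + b" using D by linarith
  then have "(q ^ m)\<^sup>2 \<le> (branch_gain q a * branch_gain q b)\<^sup>2"
    using gain_ge[OF _ d] q1 by (intro power_mono) auto
  then have "q ^ (2 * m) \<le> q ^ L" using le by (simp add: power_even_eq)
  then have L: "L = 2 * m" using \<open>L \<le> 2 * m\<close> q1 by (simp add: power_increasing_iff)
  then have ab: "a + b = k + l" using D by linarith
  have "(branch_gain q a * branch_gain q b)\<^sup>2 \<le> (q ^ m)\<^sup>2"
    using le L by (simp add: power_even_eq)
  then have "branch_gain q a * branch_gain q b \<le> q ^ m" using q1 by (auto intro: power2_le_imp_le)
  then show "L = 2 * m \<and> (a = k \<and> b = l \<or> a = l \<and> b = k)"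
    using gain_le_imp_balanced[OF ab d] L by simp
qed

text \<open>At \<open>q = 3 / 2\<close> already a pendant path of length 1 has defect above 1, so
  \<open>a = b = 0\<close>, and counting fixes \<open>L\<close>.\<close>

lemma forces_balance_0: "forces_balance (3 / 2) 0 0 m"
  unfolding forces_balance_def
proof (intro allI impI)
  fix a b L
  assume d: "branch_defect (3 / 2) a < 1" "branch_defect (3 / 2) b < 1"
    and D: "m + 0 + 0 \<le> a + b + L div 2" "L + a + b \<le> 2 * m + 0 + 0"
  have z: "c = 0" if "branch_defect (3 / 2) c < 1" for c
  proof (rule ccontr)
    assume "c \<noteq> 0"
    then have "(3 / 2 :: real) ^ 2 \<le> (3 / 2) ^ Suc c" by (intro power_increasing) auto
    then show False using that branch_defect_less_1_iff[of "3 / 2" c] by (simp add: power2_eq_square)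
  qed
  show "L = 2 * m \<and> (a = 0 \<and> b = 0 \<or> a = 0 \<and> b = 0)" using z[OF d(1)] z[OF d(2)] D by auto
qed

text \<open>At \<open>q = 2\<close> a leg of length \<open>j\<close> has defect
  \<open>1 - 1 / (2 ^ Suc j - 1)\<close>. Two legs of length at least \<open>c\<close> therefore
  leave so little for the third neighbour \<open>b\<close> that
  \<open>2 ^ Suc c \<le> 3 + 2 * U\<close>; the factor 4 absorbs the constant because
  \<open>2 ^ c \<ge> 2\<close>.\<close>

lemma end_gain_ge:
  fixes v a b y :: real
  assumes "v > 0" "v < sqrt 2 * b" "b < sqrt 2 * v"
    and le: "a + b + y \<le> (sqrt 2 + 1 / sqrt 2) * v"
    and a: "sqrt 2 * (2 ^ i - 1) * v \<le> (2 ^ Suc i - 1) * a"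
    and y: "sqrt 2 * (2 ^ p - 1) * v \<le> (2 ^ Suc p - 1) * y"
    and c: "1 \<le> c" "c \<le> i" "c \<le> p"
  shows "2 ^ c \<le> 4 * edge_gain (sqrt 2) v b"
proof -
  define U where "U = edge_gain (sqrt 2) v b"
  have U: "U > 0" unfolding U_def by (rule edge_gain_pos) (use assms in auto)
  have da: "(1 - 1 / (2 ^ Suc j - 1)) * v \<le> sqrt 2 * w" if "sqrt 2 * (2 ^ j - 1) * v \<le> (2 ^ Suc j - 1) * w" for j w
    using tail_ratio_defect[of "sqrt 2" v j w] that assms(1) by (simp add: branch_defect_def)
  have mono: "1 / (2 ^ Suc j - 1) \<le> (1::real) / (2 ^ Suc c - 1)" if "c \<le> j" for j
  proof -
    have "(2::real) ^ Suc c \<le> 2 ^ Suc j" using that by (intro power_increasing) auto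
    moreover have "(2::real) ^ Suc c > 1" by (intro one_less_power) auto
    ultimately show ?thesis by (intro inverse_diff_one_antimono)
  qed
  have "sqrt 2 * (a + b + y) \<le> sqrt 2 * ((sqrt 2 + 1 / sqrt 2) * v)" using le by simp
  also have "\<dots> = 3 * v" by (simp add: field_simps)
  finally have "sqrt 2 * b - v \<le> (1 / (2 ^ Suc i - 1) + 1 / (2 ^ Suc p - 1)) * v"
    using da[OF a] da[OF y] by (simp add: algebra_simps)
  also have "\<dots> \<le> (2 / (2 ^ Suc c - 1)) * v"
    using mono[OF c(2)] mono[OF c(3)] assms(1) by (intro mult_right_mono) auto
  finally have "(sqrt 2 * b - v) / v \<le> 2 / (2 ^ Suc c - 1)" using assms(1) by (simp add: field_simps)
  then have "1 / (1 + U) \<le> 2 / (2 ^ Suc c - 1)"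
    using inverse_one_plus_edge_gain[of "sqrt 2" v b] assms by (simp add: U_def)
  moreover have c1: "(2::real) ^ Suc c > 1" by (intro one_less_power) auto
  ultimately have "2 ^ Suc c - 1 \<le> 2 * (1 + U)" using U by (simp add: field_simps)
  moreover have "(2::real) ^ 1 \<le> 2 ^ c" using c by (intro power_increasing) auto
  ultimately show ?thesis by (simp add: U_def)
qed

lemma light_step:
  fixes a b v y t :: real
  assumes "t > 1" "t * v \<le> a" "a + b + y \<le> (t + 1 / t) * v"
  shows "t * b + t * y \<le> v"
proof -
  have "b + y \<le> v / t" using assms by (simp add: algebra_simps)
  then have "t * (b + y) \<le> t * (v / t)" using assms(1) by (intro mult_left_mono) auto
  then show ?thesis using assms(1) by (simp add: algebra_simps)
qed

section \<open>Distances between branch vertices of a caterpillar\<close>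

text \<open>Everything is at \<open>q = 2\<close>. The spine has weights \<open>z\<close>, and
  \<open>y j\<close> is the weight off the spine at \<open>j\<close>; of the pendant path of length
  \<open>p j\<close> only the conclusion of \<open>tail_ratio\<close> is kept.\<close>

locale caterpillar =
  fixes M :: nat and z y :: "nat \<Rightarrow> real" and p :: "nat \<Rightarrow> nat"
  assumes pos: "j \<le> M \<Longrightarrow> 0 < z j"
    and inner: "0 < j \<Longrightarrow> j < M \<Longrightarrow> z (j - 1) + z (Suc j) + y j \<le> (sqrt 2 + 1 / sqrt 2) * z j"
    and first: "z 1 \<le> (sqrt 2 + 1 / sqrt 2) * z 0"
    and final: "z (M - 1) \<le> (sqrt 2 + 1 / sqrt 2) * z M"
    and tail: "0 < j \<Longrightarrow> j < M \<Longrightarrow> sqrt 2 * (2 ^ p j - 1) * z j \<le> (2 ^ Suc (p j) - 1) * y j"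
begin

lemma rev: "caterpillar M (\<lambda>j. z (M - j)) (\<lambda>j. y (M - j)) (\<lambda>j. p (M - j))"
proof
  fix j assume j: "0 < j" "j < M"
  then have "Suc (M - j) = M - (j - 1)" "M - j - 1 = M - Suc j" by auto
  then show "z (M - (j - 1)) + z (M - Suc j) + y (M - j) \<le> (sqrt 2 + 1 / sqrt 2) * z (M - j)"
    using inner[of "M - j"] j by (simp add: add.commute)
  show "sqrt 2 * (2 ^ p (M - j) - 1) * z (M - j) \<le> (2 ^ Suc (p (M - j)) - 1) * y (M - j)"
    using tail[of "M - j"] j by simp
next
  show "z (M - (M - 1)) \<le> (sqrt 2 + 1 / sqrt 2) * z (M - M)"
    using first final pos[of 0] pos[of M] by (cases M) auto
qed (use pos final in auto)

lemma y_nonneg: "0 < j \<Longrightarrow> j < M \<Longrightarrow> 0 \<le> y j"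
proof -
  assume j: "0 < j" "j < M"
  have "0 \<le> sqrt 2 * (2 ^ p j - 1) * z j" using pos[of j] j by simp
  then have "0 \<le> (2 ^ Suc (p j) - 1) * y j" using tail[OF j] by linarith
  moreover have "(2::real) ^ Suc (p j) > 1" by (intro one_less_power) auto
  ultimately show ?thesis by (simp add: zero_le_mult_iff)
qed

lemma le_next: "j < M \<Longrightarrow> z j \<le> (sqrt 2 + 1 / sqrt 2) * z (Suc j)"
proof (cases "Suc j = M")
  case True
  then show ?thesis using final by auto
next
  case False
  assume "j < M"
  then show ?thesis using inner[of "Suc j"] pos[of "Suc (Suc j)"] y_nonneg[of "Suc j"] False by simp
qed

text \<open>A light step towards the branch vertex \<open>i\<close> would propagate up to
  \<open>i\<close> and leave at most \<open>z i\<close> for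
  \<open>sqrt 2 * z (Suc i) + sqrt 2 * y i\<close>. But each summand is at least
  \<open>2 / 3 * z i\<close>: the first by the inequality at \<open>Suc i\<close>, the second by the
  pendant path.\<close>

lemma less_next:
  assumes "0 < i" "i < M" "1 \<le> p i" "j < i"
  shows "z j < sqrt 2 * z (Suc j)"
proof (rule ccontr)
  assume neg: "\<not> ?thesis"
  have "j + d < i \<Longrightarrow> sqrt 2 * z (Suc (j + d)) \<le> z (j + d)" for d
  proof (induction d)
    case 0
    then show ?case using neg by simp
  next
    case (Suc d)
    then show ?case
      using light_step[of "sqrt 2" "z (Suc (j + d))" "z (j + d)" "z (Suc (Suc (j + d)))" "y (Suc (j + d))"]
        inner[of "Suc (j + d)"] y_nonneg[of "Suc (j + d)"] assms
      by (smt (verit, best) Suc_lessD add_Suc_right diff_Suc_1 less_trans_Suc mult_nonneg_nonneg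
          real_sqrt_gt_1_iff real_sqrt_ge_zero zero_less_Suc)
  qed
  from this[of "i - 1 - j"] have "sqrt 2 * z i \<le> z (i - 1)" using assms by simp
  then have 1: "sqrt 2 * z (Suc i) + sqrt 2 * y i \<le> z i"
    using light_step[of "sqrt 2" "z i" "z (i - 1)" "z (Suc i)" "y i"] inner[of i] assms by simp
  have "sqrt 2 * z i \<le> sqrt 2 * ((sqrt 2 + 1 / sqrt 2) * z (Suc i))" using le_next[of i] assms by simp
  also have "\<dots> = 3 * z (Suc i)" by (simp add: field_simps)
  finally have "sqrt 2 * (sqrt 2 * z i) \<le> sqrt 2 * (3 * z (Suc i))" by simp
  then have 2: "2 * z i \<le> 3 * (sqrt 2 * z (Suc i))" by (simp add: mult.assoc[symmetric])
  define P where "P = (2::real) ^ p i"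
  have P: "P \<ge> 2" using assms(3) power_increasing[of 1 "p i" "2::real"] by (simp add: P_def)
  have "sqrt 2 * (sqrt 2 * (P - 1) * z i) \<le> sqrt 2 * ((2 * P - 1) * y i)" using tail[of i] assms by (simp add: P_def)
  then have 3: "2 * (P - 1) * z i \<le> (2 * P - 1) * (sqrt 2 * y i)" by (simp add: algebra_simps)
  have "2 / 3 * z i \<le> sqrt 2 * y i"
  proof -
    have "(2 * P - 1) * (2 / 3 * z i) \<le> 2 * (P - 1) * z i"
      using P pos[of i] assms by (simp add: field_simps)
    then have "(2 * P - 1) * (2 / 3 * z i) \<le> (2 * P - 1) * (sqrt 2 * y i)" using 3 by linarith
    then show ?thesis using P by simp
  qed
  then show False using 1 2 pos[of i] assms by linarith
qed

text \<open>Seen from \<open>i\<close>, the spine back to position 0 behaves like a pendant path of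
  length \<open>i\<close>, since dropping the nonnegative \<open>y\<close> preserves the
  inequalities.\<close>

lemma leg: 
  assumes "0 < i" "i < M"
  shows "sqrt 2 * (2 ^ i - 1) * z i \<le> (2 ^ Suc i - 1) * z (i - 1)"
proof -
  define w where "w h = (if h \<le> i then z (i - h) else 0)" for h
  have "w h + w (Suc (Suc h)) \<le> (sqrt 2 + 1 / sqrt 2) * w (Suc h)" if "h < i" for h
  proof (cases "Suc h = i")
    case True
    then show ?thesis using first by (auto simp: w_def)
  next
    case False
    then have "z (i - h - 1 - 1) + z (Suc (i - h - 1)) \<le> (sqrt 2 + 1 / sqrt 2) * z (i - h - 1)"
    proof -
      have "0 < i - h - 1" "i - h - 1 < M" using False that assms by auto
      then show ?thesis using inner[of "i - h - 1"] y_nonneg[of "i - h - 1"] by linarith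
    qed
    then show ?thesis using False that by (simp add: w_def add.commute Suc_diff_Suc)
  qed
  from tail_ratio[of "sqrt 2" i w, OF _ this] show ?thesis using assms by (simp add: w_def)
qed

text \<open>The exact value is \<open>4 * 2 ^ n - 3\<close>; the weaker power of two multiplies well
  along the spine.\<close>

lemma branch_gain_2: "(2::real) ^ n \<le> branch_gain 2 n"
proof -
  have "branch_gain 2 n = 2 * 2 ^ Suc n - 3"
    using branch_gain_eq[of 2 n] branch_defect_less_1_iff[of 2 n] by simp
  moreover have "(1::real) \<le> 2 ^ n" by simp
  ultimately show ?thesis by simp
qed

text \<open>The edge gain is at least \<open>2 ^ c / 4\<close> just after \<open>i0\<close> and at
  most \<open>8 / 2 ^ c'\<close> just before \<open>i1\<close>, while each vertex \<open>j\<close>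
  between them multiplies it by at least \<open>4 ^ p j / 2\<close>. Comparing exponents of 2 gives
  the claim.\<close>

lemma branch_distance:
  assumes i: "0 < i0" "i0 < i1" "i1 < M" "1 \<le> p i0" "1 \<le> p i1"
    and c: "1 \<le> c" "c \<le> i0" "c \<le> p i0" and c': "1 \<le> c'" "c' \<le> M - i1" "c' \<le> p i1"
  shows "c + c' + 2 * (\<Sum>j\<in>{i0<..<i1}. p j) \<le> i1 - i0 + 4"
proof -
  interpret R: caterpillar M "\<lambda>j. z (M - j)" "\<lambda>j. y (M - j)" "\<lambda>j. p (M - j)" by (rule rev)
  define t where "t = sqrt 2"
  have t: "t > 1" "t\<^sup>2 = 2" by (auto simp: t_def)
  \<comment> \<open>Between the branch vertices no edge is light in either direction:
    \<open>up\<close> relies on the branch vertex \<open>i1\<close>, \<open>down\<close> on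
    \<open>i0\<close> in the reversed caterpillar.\<close>
  have up: "z j < t * z (Suc j)" if "j < i1" for j
    using less_next[of i1 j] that i by (simp add: t_def)
  have down: "z (Suc j) < t * z j" if "i0 \<le> j" "j < M" for j
  proof -
    have "Suc (M - Suc j) = M - j" using that by simp
    then show ?thesis using R.less_next[of "M - i0" "M - Suc j"] that i by (simp add: t_def)
  qed
  define G where "G j = edge_gain t (z j) (z (Suc j))" for j
  have Gpos: "G j > 0" if "i0 \<le> j" "j < i1" for j
    unfolding G_def using t up down that i by (intro edge_gain_pos) auto
  have swap: "G j * edge_gain t (z (Suc j)) (z j) = 2" if "i0 \<le> j" "j < i1" for j
    unfolding G_def using t up down that i by (subst edge_gain_swap) auto
  have step: "4 ^ p (Suc j) * G j \<le> 2 * G (Suc j)" if j: "i0 \<le> j" "Suc j < i1" for j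
  proof -
    have "(branch_gain (t\<^sup>2) (p (Suc j)))\<^sup>2 \<le> edge_gain t (z (Suc j)) (z j) * edge_gain t (z (Suc j)) (z (Suc (Suc j)))"
      by (rule branch_gain_le_edge_gains(2)[of t _ _ _ "y (Suc j)"])
        (use t up[of j] up[of "Suc j"] down[of j] down[of "Suc j"] j i pos[of "Suc j"] inner[of "Suc j"] tail[of "Suc j"]
         in \<open>auto simp: t_def\<close>)
    moreover have "((2::real) ^ p (Suc j))\<^sup>2 \<le> (branch_gain (t\<^sup>2) (p (Suc j)))\<^sup>2"
      using branch_gain_2[of "p (Suc j)"] t by (intro power_mono) auto
    ultimately have "4 ^ p (Suc j) \<le> edge_gain t (z (Suc j)) (z j) * G (Suc j)"
      by (simp add: G_def power_mult[symmetric] mult.commute[of _ 2] power_mult)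
    then have "G j * 4 ^ p (Suc j) \<le> G j * (edge_gain t (z (Suc j)) (z j) * G (Suc j))"
      using Gpos[of j] j by (intro mult_left_mono) auto
    also have "\<dots> = 2 * G (Suc j)" using swap[of j] j by (simp add: mult.assoc[symmetric])
    finally show ?thesis by (simp add: mult.commute)
  qed
  have chain: "i0 + d < i1 \<Longrightarrow> 4 ^ (\<Sum>j\<in>{i0<..i0 + d}. p j) * G i0 \<le> 2 ^ d * G (i0 + d)" for d
  proof (induction d)
    case 0
    then show ?case by simp
  next
    case (Suc d)
    have "{i0<..i0 + Suc d} = insert (Suc (i0 + d)) {i0<..i0 + d}" by auto
    then have "4 ^ (\<Sum>j\<in>{i0<..i0 + Suc d}. p j) * G i0 =
        4 ^ p (Suc (i0 + d)) * (4 ^ (\<Sum>j\<in>{i0<..i0 + d}. p j) * G i0)"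
      by (simp add: power_add)
    also have "\<dots> \<le> 4 ^ p (Suc (i0 + d)) * (2 ^ d * G (i0 + d))"
      using Suc by (intro mult_left_mono) auto
    also have "\<dots> = 2 ^ d * (4 ^ p (Suc (i0 + d)) * G (i0 + d))" by simp
    also have "\<dots> \<le> 2 ^ d * (2 * G (Suc (i0 + d)))"
      using step[of "i0 + d"] Suc.prems by (intro mult_left_mono) auto
    finally show ?case by simp
  qed
  define d where "d = i1 - 1 - i0"
  have d: "i0 + d < i1" "Suc (i0 + d) = i1" "{i0<..i0 + d} = {i0<..<i1}" using i by (auto simp: d_def)
  define s where "s = (\<Sum>j\<in>{i0<..<i1}. p j)"
  have left: "2 ^ c \<le> 4 * G i0"
    unfolding G_def t_def
    by (rule end_gain_ge[of _ _ "z (i0 - 1)" "y i0" i0 "p i0"])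
      (use pos[of i0] up[of i0] down[of i0] inner[of i0] tail[of i0] leg[of i0] i c
        in \<open>auto simp: t_def\<close>)
  have i1': "M - (M - i1) = i1" "M - (M - i1 - 1) = Suc i1" "M - Suc (M - i1) = i1 - 1" using i by auto
  have right: "2 ^ c' \<le> 4 * edge_gain t (z i1) (z (i0 + d))"
    unfolding t_def
    by (rule end_gain_ge[of _ _ "z (Suc i1)" "y i1" "M - i1" "p i1"])
      (use pos[of i1] up[of "i0 + d"] down[of "i0 + d"] inner[of i1] tail[of i1] R.leg[of "M - i1"] i c' i1' d
        in \<open>auto simp: t_def ac_simps\<close>)
  have "2 ^ c' * G (i0 + d) \<le> 4 * edge_gain t (z i1) (z (i0 + d)) * G (i0 + d)"
    using right Gpos[of "i0 + d"] d by (intro mult_right_mono) auto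
  also have "\<dots> = 4 * (G (i0 + d) * edge_gain t (z (Suc (i0 + d))) (z (i0 + d)))" using d by simp
  also have "\<dots> = 8" using swap[of "i0 + d"] d by simp
  finally have R: "2 ^ c' * G (i0 + d) \<le> 8" .
  have "2 ^ c * 4 ^ s * 2 ^ c' \<le> (4 * G i0) * 4 ^ s * 2 ^ c'" using left by (intro mult_right_mono) auto
  also have "\<dots> = 4 * 2 ^ c' * (4 ^ s * G i0)" by simp
  also have "\<dots> \<le> 4 * 2 ^ c' * (2 ^ d * G (i0 + d))"
    using chain[of d] d by (intro mult_left_mono) (auto simp: s_def)
  also have "\<dots> = 4 * 2 ^ d * (2 ^ c' * G (i0 + d))" by simp
  also have "\<dots> \<le> 4 * 2 ^ d * 8" using R by (intro mult_left_mono) auto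
  also have "\<dots> = (2::real) ^ (d + 5)" by (simp add: power_add)
  also have "2 ^ c * 4 ^ s * 2 ^ c' = (2::real) ^ (c + c' + 2 * s)"
    by (simp add: power_add power_mult)
  finally have "c + c' + 2 * s \<le> d + 5" by (simp add: power_increasing_iff)
  then show ?thesis using i by (simp add: s_def d_def)
qed

end

section \<open>Spines with pendant paths\<close>

text \<open>
  \<open>\<phi> s h\<close> is the vertex at height \<open>h\<close> on the pendant path at the spine vertex \<open>s\<close>; that path has
  length \<open>p s\<close>.
\<close>

definition spine_coords ::
    "'a set \<Rightarrow> 'a rel \<Rightarrow> 'a set \<Rightarrow> ('a \<Rightarrow> nat) \<Rightarrow> ('a \<Rightarrow> nat \<Rightarrow> 'a) \<Rightarrow> bool" where
  "spine_coords V E S p \<phi> \<longleftrightarrow>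
     (\<forall>s\<in>S. \<phi> s 0 = s) \<and>
     bij_betw (\<lambda>(s, h). \<phi> s h) (SIGMA s:S. {..p s}) V \<and>
     (\<forall>s\<in>S. \<forall>h<p s. E `` {\<phi> s (Suc h)} =
        insert (\<phi> s h) (if Suc h < p s then {\<phi> s (Suc (Suc h))} else {})) \<and>
     (\<forall>s\<in>S. E `` {s} - S = (if 0 < p s then {\<phi> s 1} else {}))"

lemma spine_coords_inj:
  assumes "spine_coords V E S p \<phi>" "s \<in> S" "s' \<in> S" "h \<le> p s" "h' \<le> p s'"
  shows "\<phi> s h = \<phi> s' h' \<longleftrightarrow> s = s' \<and> h = h'"
  using assms inj_onD[of "\<lambda>(s, h). \<phi> s h" "SIGMA s:S. {..p s}" "(s, h)" "(s', h')"]
  unfolding spine_coords_def bij_betw_def by auto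

lemma spine_coords_obtain:
  assumes "spine_coords V E S p \<phi>" "v \<in> V"
  obtains s h where "s \<in> S" "h \<le> p s" "v = \<phi> s h"
proof -
  have "v \<in> (\<lambda>(s, h). \<phi> s h) ` (SIGMA s:S. {..p s})"
    using assms unfolding spine_coords_def bij_betw_def by simp
  then show ?thesis using that by auto
qed

lemma spine_coords_mem: "spine_coords V E S p \<phi> \<Longrightarrow> s \<in> S \<Longrightarrow> h \<le> p s \<Longrightarrow> \<phi> s h \<in> V"
  unfolding spine_coords_def bij_betw_def by force

lemma spine_coords_zero: "spine_coords V E S p \<phi> \<Longrightarrow> s \<in> S \<Longrightarrow> \<phi> s 0 = s"
  unfolding spine_coords_def by blast

lemma spine_coords_nbrs:
  "spine_coords V E S p \<phi> \<Longrightarrow> s \<in> S \<Longrightarrow> h < p s \<Longrightarrow>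
    E `` {\<phi> s (Suc h)} = insert (\<phi> s h) (if Suc h < p s then {\<phi> s (Suc (Suc h))} else {})"
  unfolding spine_coords_def by blast

lemma spine_coords_root_nbrs:
  "spine_coords V E S p \<phi> \<Longrightarrow> s \<in> S \<Longrightarrow> E `` {s} - S = (if 0 < p s then {\<phi> s 1} else {})"
  unfolding spine_coords_def by blast

lemma spine_coords_card:
  assumes "spine_coords V E S p \<phi>" "finite S"
  shows "card V = (\<Sum>s\<in>S. Suc (p s))"
proof -
  have "card V = card (SIGMA s:S. {..p s})"
    using assms bij_betw_same_card unfolding spine_coords_def by metis
  then show ?thesis using assms by simp
qed

text \<open>The cycle is parametrised by all natural numbers, with period \<open>L\<close>.\<close>

definition is_cycle :: "'a rel \<Rightarrow> nat \<Rightarrow> (nat \<Rightarrow> 'a) \<Rightarrow> bool" where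
  "is_cycle E L c \<longleftrightarrow> 3 \<le> L \<and> (\<forall>i. (c i, c (Suc i)) \<in> E) \<and>
     (\<forall>i j. c i = c j \<longleftrightarrow> i mod L = j mod L)"

section \<open>Weighted graphs and light edges\<close>

locale simple_graph =
  fixes V :: "'a set" and E :: "'a rel"
  assumes fin: "finite V" and sub: "E \<subseteq> V \<times> V" and symE: "(u, v) \<in> E \<Longrightarrow> (v, u) \<in> E"
    and irr: "(u, u) \<notin> E" and conn: "u \<in> V \<Longrightarrow> v \<in> V \<Longrightarrow> (u, v) \<in> E\<^sup>*"
begin

lemma inV: "(u, v) \<in> E \<Longrightarrow> u \<in> V" "(u, v) \<in> E \<Longrightarrow> v \<in> V" using sub by auto

lemma nbr_finite: "finite (E `` {v})"
  by (rule finite_subset[OF _ fin]) (use sub in auto)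

lemma closed_imp_all:
  assumes "u \<in> R" "u \<in> V" "\<And>v w. v \<in> R \<Longrightarrow> (v, w) \<in> E \<Longrightarrow> w \<in> R"
  shows "V \<subseteq> R"
proof
  fix v assume "v \<in> V"
  then have "(u, v) \<in> E\<^sup>*" using conn assms by blast
  then show "v \<in> R" by induction (use assms in auto)
qed

lemma relpow_sym: "(u, v) \<in> E ^^ d \<Longrightarrow> (v, u) \<in> E ^^ d"
proof (induction d arbitrary: v)
  case 0
  then show ?case by simp
next
  case (Suc d)
  then obtain w where "(u, w) \<in> E ^^ d" "(w, v) \<in> E" by auto
  then show ?case using Suc.IH symE relpow_Suc_I2 by metis
qed

lemma lipschitz_relpow:
  fixes f :: "'a \<Rightarrow> int"
  assumes "\<And>u v. (u, v) \<in> E \<Longrightarrow> \<bar>f u - f v\<bar> \<le> 1" "(u, v) \<in> E ^^ d"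
  shows "\<bar>f u - f v\<bar> \<le> int d"
  using assms(2)
proof (induction d arbitrary: v)
  case 0
  then show ?case by simp
next
  case (Suc d)
  then obtain w where "(u, w) \<in> E ^^ d" "(w, v) \<in> E" by auto
  then show ?case using Suc.IH[of w] assms(1)[of w v] by auto
qed

end

locale weighted_graph = simple_graph +
  fixes x :: "'a \<Rightarrow> real" and t :: real
  assumes xpos: "v \<in> V \<Longrightarrow> 0 < x v" and t1: "1 < t" and t2: "t\<^sup>2 \<le> 2"
    and sup: "v \<in> V \<Longrightarrow> (\<Sum>w\<in>E `` {v}. x w) \<le> (t + 1 / t) * x v"
begin

definition light :: "'a \<Rightarrow> 'a \<Rightarrow> bool" where
  "light v w \<longleftrightarrow> (v, w) \<in> E \<and> t * x w \<le> x v"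

lemma sum_le: "v \<in> V \<Longrightarrow> A \<subseteq> E `` {v} \<Longrightarrow> (\<Sum>w\<in>A. x w) \<le> (t + 1 / t) * x v"
  using sum_mono2[OF nbr_finite, of A v x] sup[of v] xpos inV by (force intro: less_imp_le)

lemma t_sum_le:
  assumes "v \<in> V" "A \<subseteq> E `` {v}"
  shows "t * (\<Sum>w\<in>A. x w) \<le> (t\<^sup>2 + 1) * x v"
proof -
  have "t * (\<Sum>w\<in>A. x w) \<le> t * ((t + 1 / t) * x v)" using sum_le[OF assms] t1 by simp
  also have "\<dots> = (t\<^sup>2 + 1) * x v" using t1 by (simp add: field_simps power2_eq_square)
  finally show ?thesis .
qed

lemma nbr_le: "(v, w) \<in> E \<Longrightarrow> t * x v \<le> (t\<^sup>2 + 1) * x w"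
  using t_sum_le[of w "{v}"] inV symE by auto

lemma light_less: "light v w \<Longrightarrow> x w < x v"
proof -
  assume l: "light v w"
  then have "x w > 0" using xpos inV by (auto simp: light_def)
  then have "x w < t * x w" using t1 by simp
  then show ?thesis using l by (simp add: light_def)
qed

lemma light_asym: "light v w \<Longrightarrow> \<not> light w v"
  using light_less[of v w] light_less[of w v] by auto

text \<open>A light edge means \<open>t * x v \<ge> t\<^sup>2 * x w\<close>, so of the budget
  \<open>(t\<^sup>2 + 1) * x w\<close> at \<open>w\<close> only \<open>x w\<close> is left for the
  other neighbours.\<close>

lemma light_next:
  assumes "light v w" "(w, a) \<in> E" "a \<noteq> v"
  shows "light w a"
proof -
  have w: "w \<in> V" "(w, v) \<in> E" using assms inV symE by (auto simp: light_def)
  have "t * (x v + x a) \<le> (t\<^sup>2 + 1) * x w" using t_sum_le[of w "{v, a}"] assms w by auto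
  moreover have "t * (t * x w) \<le> t * x v" using assms t1 by (auto simp: light_def)
  ultimately have "t * x a \<le> x w" by (simp add: algebra_simps power2_eq_square)
  then show ?thesis using assms by (simp add: light_def)
qed

text \<open>By their own inequalities two further neighbours would each need
  \<open>t\<^sup>2 / (t\<^sup>2 + 1) * x w\<close> of the remaining budget \<open>x w\<close>, which
  is too much for \<open>t > 1\<close>.\<close>

lemma light_deg:
  assumes "light v w" "(w, a) \<in> E" "a \<noteq> v" "(w, b) \<in> E" "b \<noteq> v"
  shows "a = b"
proof (rule ccontr)
  assume "a \<noteq> b"
  have w: "w \<in> V" "(w, v) \<in> E" using assms inV symE by (auto simp: light_def)
  have "t * (x v + (x a + x b)) \<le> (t\<^sup>2 + 1) * x w"
    using t_sum_le[of w "{v, a, b}"] assms w \<open>a \<noteq> b\<close> by auto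
  moreover have "t * (t * x w) \<le> t * x v" using assms t1 by (auto simp: light_def)
  ultimately have 1: "t * (x a + x b) \<le> x w" by (simp add: algebra_simps power2_eq_square)
  have "t * x w \<le> (t\<^sup>2 + 1) * x a" "t * x w \<le> (t\<^sup>2 + 1) * x b" using nbr_le assms by auto
  then have "t * (t * x w + t * x w) \<le> t * ((t\<^sup>2 + 1) * x a + (t\<^sup>2 + 1) * x b)"
    using t1 by (intro mult_left_mono) auto
  also have "\<dots> = (t\<^sup>2 + 1) * (t * (x a + x b))" by (simp add: algebra_simps)
  also have "\<dots> \<le> (t\<^sup>2 + 1) * x w" using 1 by (intro mult_left_mono) auto
  finally have "(t\<^sup>2 - 1) * x w \<le> 0" by (simp add: algebra_simps power2_eq_square)
  moreover have "t\<^sup>2 > 1" using t1 by (simp add: one_less_power)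
  ultimately show False using xpos[OF w(1)] by (simp add: mult_le_0_iff)
qed

text \<open>A second light predecessor would be a further neighbour of \<open>w\<close>, so by
  \<open>light_next\<close> its edge would be light in both directions.\<close>

lemma light_parent_unique: "light a w \<Longrightarrow> light b w \<Longrightarrow> a = b"
  using light_next[of a w b] light_asym symE by (auto simp: light_def)

text \<open>Here \<open>t\<^sup>2 \<le> 2\<close> enters: three non-light neighbours use more than
  \<open>3 * x v\<close> of the budget \<open>(t\<^sup>2 + 1) * x v\<close>.\<close>

lemma three_nonlight:
  assumes "(v, a) \<in> E" "(v, b) \<in> E" "(v, c) \<in> E" "a \<noteq> b" "a \<noteq> c" "b \<noteq> c"
  shows "light v a \<or> light v b \<or> light v c"
proof (rule ccontr)
  assume "\<not> ?thesis"
  then have "x v < t * x a" "x v < t * x b" "x v < t * x c" using assms by (auto simp: light_def)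
  moreover have v: "v \<in> V" using assms inV by auto
  moreover have "t * (x a + (x b + x c)) \<le> (t\<^sup>2 + 1) * x v"
    using t_sum_le[of v "{a, b, c}"] assms v by auto
  moreover have "(t\<^sup>2 + 1) * x v \<le> 3 * x v" using t2 xpos[OF v] by (intro mult_right_mono) auto
  ultimately show False by (simp add: algebra_simps)
qed

text \<open>Exact neighbourhoods, not mere adjacency: the list is closed in the graph apart from its
  root.\<close>

fun tail_from :: "'a \<Rightarrow> 'a list \<Rightarrow> bool" where
  "tail_from v [] \<longleftrightarrow> True"
| "tail_from v (w # ws) \<longleftrightarrow> light v w \<and> E `` {w} = insert v (set (take 1 ws)) \<and> tail_from w ws"

text \<open>Weights strictly decrease along light edges, so the number of vertices of weight below
  \<open>x w\<close> is a termination measure.\<close>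

lemma ex_tail: "light v w \<Longrightarrow> \<exists>ws. tail_from v (w # ws)"
proof (induction "card {u \<in> V. x u < x w}" arbitrary: v w rule: less_induct)
  case less
  have vw: "(w, v) \<in> E" using less.prems symE by (auto simp: light_def)
  show ?case
  proof (cases "E `` {w} \<subseteq> {v}")
    case True
    then have "tail_from v [w]" using less.prems vw by auto
    then show ?thesis by blast
  next
    case False
    then obtain a where a: "(w, a) \<in> E" "a \<noteq> v" by auto
    then have l: "light w a" using light_next less.prems by blast
    have "E `` {w} = {v, a}" using a vw light_deg[OF less.prems] by blast
    have "{u \<in> V. x u < x a} \<subset> {u \<in> V. x u < x w}"
      using light_less[OF l] inV[OF a(1)] by force
    then have "card {u \<in> V. x u < x a} < card {u \<in> V. x u < x w}"
      using fin by (intro psubset_card_mono) auto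
    from less.hyps[OF this l] obtain ws where "tail_from w (a # ws)" by blast
    then have "tail_from v (w # a # ws)" using less.prems \<open>E `` {w} = {v, a}\<close> by simp
    then show ?thesis by blast
  qed
qed

lemma tail_from_nth:
  "tail_from v ws \<Longrightarrow> h < length ws \<Longrightarrow>
    light ((v # ws) ! h) (ws ! h) \<and>
    E `` {ws ! h} = insert ((v # ws) ! h) (if Suc h < length ws then {ws ! Suc h} else {})"
proof (induction ws arbitrary: v h)
  case Nil
  then show ?case by simp
next
  case (Cons w ws)
  show ?case
  proof (cases h)
    case 0
    then show ?thesis using Cons.prems by (cases ws) auto
  next
    case (Suc i)
    then show ?thesis using Cons.IH[of w i] Cons.prems by simp
  qed
qed

lemma tail_from_closed: "tail_from v ws \<Longrightarrow> u \<in> set ws \<Longrightarrow> (u, w) \<in> E \<Longrightarrow> w \<in> insert v (set ws)"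
proof -
  assume a: "tail_from v ws" "u \<in> set ws" "(u, w) \<in> E"
  then obtain h where h: "h < length ws" "u = ws ! h" by (auto simp: in_set_conv_nth)
  have "(v # ws) ! h \<in> insert v (set ws)" using h by (cases h) auto
  moreover have "w \<in> E `` {ws ! h}" using a(3) h by simp
  ultimately show ?thesis
    using conjunct2[OF tail_from_nth[OF a(1) h(1)]] nth_mem[of "Suc h" ws] by (auto split: if_splits)
qed

text \<open>The light edges leaving \<open>S\<close> grow into tails, and connectivity makes
  \<open>S\<close> and its tails exhaust \<open>V\<close>. A tail cannot return to \<open>S\<close>,
  because the returning edge would be light in both directions; two tails cannot meet, because light
  predecessors are unique.\<close>

lemma ex_spine_coords:
  assumes S: "S \<subseteq> V" "S \<noteq> {}"
    and out_light: "\<And>s w. s \<in> S \<Longrightarrow> (s, w) \<in> E \<Longrightarrow> w \<notin> S \<Longrightarrow> light s w"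
    and out_unique: "\<And>s w w'. s \<in> S \<Longrightarrow> (s, w) \<in> E \<Longrightarrow> w \<notin> S \<Longrightarrow> (s, w') \<in> E \<Longrightarrow> w' \<notin> S \<Longrightarrow> w = w'"
  shows "\<exists>p \<phi>. spine_coords V E S p \<phi>"
proof -
  have "\<exists>ws. tail_from s ws \<and> E `` {s} - S = set (take 1 ws)" if s: "s \<in> S" for s
  proof (cases "E `` {s} \<subseteq> S")
    case True
    then have "tail_from s [] \<and> E `` {s} - S = set (take 1 [])" by auto
    then show ?thesis by blast
  next
    case False
    then obtain w where w: "(s, w) \<in> E" "w \<notin> S" by auto
    obtain ws where "tail_from s (w # ws)" using ex_tail out_light[OF s w] by blast
    moreover have "E `` {s} - S = {w}" using w out_unique[OF s w] by blast
    ultimately have "tail_from s (w # ws) \<and> E `` {s} - S = set (take 1 (w # ws))" by simp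
    then show ?thesis by blast
  qed
  then have "\<forall>s\<in>S. \<exists>ws. tail_from s ws \<and> E `` {s} - S = set (take 1 ws)" by blast
  from bchoice[OF this] obtain T where
    T: "\<And>s. s \<in> S \<Longrightarrow> tail_from s (T s)" "\<And>s. s \<in> S \<Longrightarrow> E `` {s} - S = set (take 1 (T s))"
    by blast
  define p where "p s = length (T s)" for s
  define \<phi> where "\<phi> s h = (s # T s) ! h" for s h
  have \<phi>0: "\<phi> s 0 = s" for s by (simp add: \<phi>_def)
  have step: "light (\<phi> s h) (\<phi> s (Suc h))"
      "E `` {\<phi> s (Suc h)} = insert (\<phi> s h) (if Suc h < p s then {\<phi> s (Suc (Suc h))} else {})"
    if "s \<in> S" "h < p s" for s h
    using tail_from_nth[OF T(1)[OF that(1)], of h] that by (auto simp: \<phi>_def p_def)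
  have root: "E `` {s} - S = (if 0 < p s then {\<phi> s 1} else {})" if "s \<in> S" for s
    using T(2)[OF that] by (cases "T s") (auto simp: \<phi>_def p_def)
  have notS: "\<phi> s (Suc h) \<notin> S" if "s \<in> S" "h < p s" for s h
    using that(2)
  proof (induction h)
    case 0
    then show ?case using root[OF that(1)] by auto
  next
    case (Suc h)
    show ?case
    proof
      assume inS: "\<phi> s (Suc (Suc h)) \<in> S"
      have l: "light (\<phi> s (Suc h)) (\<phi> s (Suc (Suc h)))" using step(1)[OF that(1)] Suc by simp
      then have "(\<phi> s (Suc (Suc h)), \<phi> s (Suc h)) \<in> E" using symE by (simp add: light_def)
      then have "light (\<phi> s (Suc (Suc h))) (\<phi> s (Suc h))" using out_light inS Suc by simp
      then show False using l light_asym by blast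
    qed
  qed
  have inj: "s = s' \<and> h = h'" if "s \<in> S" "s' \<in> S" "h \<le> p s" "h' \<le> p s'" "\<phi> s h = \<phi> s' h'" for s s' h h'
    using that
  proof (induction h arbitrary: h')
    case 0
    then show ?case using notS[of s'] by (cases h') (auto simp: \<phi>0 Suc_le_eq)
  next
    case (Suc h)
    then obtain i where i: "h' = Suc i" using notS[of s h] by (cases h') (auto simp: \<phi>0 Suc_le_eq)
    have "\<phi> s h = \<phi> s' i"
      using light_parent_unique step(1)[of s h] step(1)[of s' i] Suc.prems i by (simp add: Suc_le_eq)
    then show ?case using Suc.IH[of i] Suc.prems i by auto
  qed
  have inV': "\<phi> s h \<in> V" if "s \<in> S" "h \<le> p s" for s h
    using that S step(1)[of s "h - 1"] inV by (cases h) (auto simp: \<phi>0 light_def)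
  have surj: "V \<subseteq> (\<lambda>(s, h). \<phi> s h) ` (SIGMA s:S. {..p s})" (is "_ \<subseteq> ?R")
  proof -
    have mem: "\<phi> s h \<in> ?R" if "s \<in> S" "h \<le> p s" for s h using that by force
    obtain s0 where "s0 \<in> S" using S by blast
    then have "s0 \<in> ?R" "s0 \<in> V" using mem[of s0 0] \<phi>0 S by auto
    then show ?thesis
    proof (rule closed_imp_all)
      fix v w assume "v \<in> ?R" and vw: "(v, w) \<in> E"
      then obtain s h where sh: "s \<in> S" "h \<le> p s" "v = \<phi> s h" by auto
      show "w \<in> ?R"
      proof (cases h)
        case 0
        then have "w \<in> E `` {s}" using vw sh \<phi>0 by simp
        then have "w \<in> S \<or> 0 < p s \<and> w = \<phi> s 1" using root[OF sh(1)] by (auto split: if_splits)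
        then show ?thesis using mem[of w 0] mem[of s 1] \<phi>0 sh by auto
      next
        case (Suc i)
        then have "w = \<phi> s i \<or> Suc i < p s \<and> w = \<phi> s (Suc (Suc i))"
          using step(2)[of s i] sh vw by (auto split: if_splits)
        then show ?thesis using mem[of s] sh Suc by auto
      qed
    qed
  qed
  have "bij_betw (\<lambda>(s, h). \<phi> s h) (SIGMA s:S. {..p s}) V"
    unfolding bij_betw_def
  proof
    show "inj_on (\<lambda>(s, h). \<phi> s h) (SIGMA s:S. {..p s})" using inj by (auto simp: inj_on_def)
    show "(\<lambda>(s, h). \<phi> s h) ` (SIGMA s:S. {..p s}) = V" using surj inV' by auto
  qed
  then have "spine_coords V E S p \<phi>"
    unfolding spine_coords_def using \<phi>0 step(2) root by blast
  then show ?thesis by blast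
qed

lemma spine_tail_ratio:
  assumes c: "spine_coords V E S p \<phi>" and s: "s \<in> S"
  shows "t * ((t\<^sup>2) ^ p s - 1) * x s \<le> ((t\<^sup>2) ^ Suc (p s) - 1) * (\<Sum>w\<in>E `` {s} - S. x w)"
proof -
  \<comment> \<open>The value 0 past the end makes the inequality at the last vertex an instance of
    the recurrence.\<close>
  define y where "y h = (if h \<le> p s then x (\<phi> s h) else 0)" for h
  have "y h + y (Suc (Suc h)) \<le> (t + 1 / t) * y (Suc h)" if h: "h < p s" for h
  proof -
    have ne: "\<phi> s h \<noteq> \<phi> s (Suc (Suc h))" if "Suc h < p s"
      using spine_coords_inj[OF c s s, of h "Suc (Suc h)"] that by simp
    have "(\<Sum>w\<in>E `` {\<phi> s (Suc h)}. x w) \<le> (t + 1 / t) * x (\<phi> s (Suc h))"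
      using sup spine_coords_mem[OF c s] h by simp
    then show ?thesis
      using ne h unfolding spine_coords_nbrs[OF c s h] by (auto simp: y_def split: if_splits)
  qed
  then have "t * ((t\<^sup>2) ^ p s - 1) * y 0 \<le> ((t\<^sup>2) ^ Suc (p s) - 1) * y 1"
    by (rule tail_ratio[OF t1]) (auto simp: y_def)
  moreover have "(\<Sum>w\<in>E `` {s} - S. x w) = y 1"
    unfolding spine_coords_root_nbrs[OF c s] by (auto simp: y_def)
  ultimately show ?thesis using spine_coords_zero[OF c s] by (simp add: y_def)
qed

end

section \<open>Cycles\<close>

lemma mod_shift_neq:
  fixes j k L :: nat
  assumes "0 < k" "k < L"
  shows "(j + k) mod L \<noteq> j mod L"
  using assms mod_eq_dvd_iff_nat[of j "j + k" L] nat_dvd_not_less[of k L] by auto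

lemma is_cycle_Suc_eq_iff:
  assumes "is_cycle E L c"
  shows "c (Suc i) = c (Suc j) \<longleftrightarrow> c i = c j"
proof -
  have L: "L > 0" using assms by (simp add: is_cycle_def)
  have "Suc i mod L = Suc j mod L \<longleftrightarrow> i mod L = j mod L"
  proof
    assume "Suc i mod L = Suc j mod L"
    then have "(Suc i + (L - 1)) mod L = (Suc j + (L - 1)) mod L" by (metis mod_add_left_eq)
    then show "i mod L = j mod L" using L by simp
  qed (metis mod_Suc_eq)
  then show ?thesis using assms by (simp add: is_cycle_def)
qed

lemma is_cycle_period: "is_cycle E L c \<Longrightarrow> c (i + L) = c i"
  by (simp add: is_cycle_def)

lemma is_cycle_mod: "is_cycle E L c \<Longrightarrow> c (i mod L) = c i"
  by (simp add: is_cycle_def)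

lemma is_cycle_neq: "is_cycle E L c \<Longrightarrow> c (Suc (Suc i)) \<noteq> c i"
  using mod_shift_neq[of 2 L i] by (simp add: is_cycle_def)

lemma is_cycle_range: "is_cycle E L c \<Longrightarrow> range c = c ` {..<L}"
proof -
  assume c: "is_cycle E L c"
  then have L: "L > 0" by (simp add: is_cycle_def)
  have "c i \<in> c ` {..<L}" for i
    using is_cycle_mod[OF c, of i] L by (metis imageI lessThan_iff mod_less_divisor)
  then show ?thesis by blast
qed

lemma is_cycle_inj: "is_cycle E L c \<Longrightarrow> inj_on c {..<L}"
  by (auto simp: is_cycle_def inj_on_def)

lemma is_cycle_pred:
  assumes "is_cycle E L c" "v \<in> range c"
  obtains i where "v = c (Suc i)"
proof -
  obtain j where "v = c j" using assms by blast
  moreover have "L > 0" using assms by (simp add: is_cycle_def)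
  then have "c (j + L) = c (Suc (j + L - 1))" by simp
  ultimately show ?thesis using that[of "j + L - 1"] is_cycle_period[OF assms(1)] by simp
qed

context weighted_graph
begin

text \<open>A light edge would propagate around the cycle with strictly decreasing weights and
  return to its start.\<close>

lemma cycle_not_light_up:
  assumes c: "is_cycle E L c"
  shows "\<not> light (c i) (c (Suc i))"
proof
  assume l: "light (c i) (c (Suc i))"
  have E: "(c j, c (Suc j)) \<in> E" for j using c by (simp add: is_cycle_def)
  have ll: "light (c (i + d)) (c (Suc (i + d)))" for d
  proof (induction d)
    case 0
    then show ?case using l by simp
  next
    case (Suc d)
    then show ?case using light_next[OF Suc.IH E] is_cycle_neq[OF c] by simp
  qed
  have "x (c (Suc (i + d))) < x (c i)" for d
  proof (induction d)
    case 0
    then show ?case using light_less[OF l] by simp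
  next
    case (Suc d)
    then show ?case using light_less[OF ll[of "Suc d"]] by simp
  qed
  from this[of "L - 1"] show False using is_cycle_period[OF c, of i] c by (simp add: is_cycle_def)
qed

lemma cycle_not_light_down:
  assumes c: "is_cycle E L c"
  shows "\<not> light (c (Suc i)) (c i)"
proof
  assume l0: "light (c (Suc i)) (c i)"
  have E: "(c (Suc j), c j) \<in> E" for j using c symE by (simp add: is_cycle_def)
  \<comment> \<open>Starting one period higher leaves room to count indices down in the natural
    numbers.\<close>
  define N where "N = i + L"
  have l: "light (c (Suc N)) (c N)" using l0 is_cycle_period[OF c, of i] is_cycle_period[OF c, of "Suc i"]
    by (simp add: N_def)
  have ll: "d \<le> N \<Longrightarrow> light (c (Suc (N - d))) (c (N - d))" for d
  proof (induction d)
    case 0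
    then show ?case using l by simp
  next
    case (Suc d)
    then obtain j where j: "N - d = Suc j" by (metis Suc_diff_Suc Suc_le_lessD)
    then have "light (c (Suc (Suc j))) (c (Suc j))" using Suc by simp
    then have "light (c (Suc j)) (c j)" using light_next[OF _ E] is_cycle_neq[OF c, of j] by metis
    moreover have "N - Suc d = j" using j by simp
    ultimately show ?case by simp
  qed
  have "d \<le> N \<Longrightarrow> x (c (N - d)) < x (c (Suc N))" for d
  proof (induction d)
    case 0
    then show ?case using light_less[OF l] by simp
  next
    case (Suc d)
    then show ?case using light_less[OF ll[of "Suc d"]] by (simp add: Suc_diff_Suc Suc_le_eq)
  qed
  moreover have "L - 1 \<le> N" "N - (L - 1) = Suc i" "L > 0" using c by (auto simp: is_cycle_def N_def)
  moreover have "c (Suc N) = c (Suc i)" using is_cycle_period[OF c, of "Suc i"] by (simp add: N_def)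
  ultimately show False by (metis less_irrefl)
qed

lemma cycle_outside_light:
  assumes c: "is_cycle E L c" and w: "(c (Suc i), w) \<in> E" "w \<noteq> c i" "w \<noteq> c (Suc (Suc i))"
  shows "light (c (Suc i)) w"
proof -
  have E: "(c j, c (Suc j)) \<in> E" for j using c by (simp add: is_cycle_def)
  show ?thesis
    using three_nonlight[of "c (Suc i)" "c i" "c (Suc (Suc i))" w] w E[of i] E[of "Suc i"] symE
      is_cycle_neq[OF c, of i] cycle_not_light_up[OF c, of "Suc i"] cycle_not_light_down[OF c, of i]
    by metis
qed

text \<open>Each end of a chord sees the other as a third neighbour besides its two cycle
  neighbours, so the chord would be light in both directions.\<close>

lemma cycle_no_chord:
  assumes c: "is_cycle E L c" and w: "(c (Suc i), w) \<in> E" "w \<in> range c"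
  shows "w = c i \<or> w = c (Suc (Suc i))"
proof (rule ccontr)
  assume neg: "\<not> ?thesis"
  then have l: "light (c (Suc i)) w" using cycle_outside_light[OF c w(1)] by blast
  obtain j where j: "w = c (Suc j)" using is_cycle_pred[OF c w(2)] .
  have "c (Suc i) \<noteq> c j" using neg j is_cycle_Suc_eq_iff[OF c, of "Suc i" j] by auto
  moreover have "c (Suc i) \<noteq> c (Suc (Suc j))" using neg j is_cycle_Suc_eq_iff[OF c, of i "Suc j"] by auto
  ultimately have "light w (c (Suc i))" using cycle_outside_light[OF c, of j "c (Suc i)"] symE[OF w(1)] j by simp
  then show False using l light_asym by blast
qed

text \<open>The cycle neighbours use more than \<open>2 * x v\<close> of the budget and leave
  \<open>(t\<^sup>2 - 1) * x v\<close>. Two outside neighbours need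
  \<open>2 * t\<^sup>2 / (t\<^sup>2 + 1) * x v\<close>, hence
  \<open>2 * t\<^sup>2 \<le> t ^ 4 - 1\<close>, which fails for
  \<open>t\<^sup>2 \<le> 2\<close>.\<close>

lemma cycle_outside_unique:
  assumes c: "is_cycle E L c" and w: "(c (Suc i), w) \<in> E" "w \<notin> range c" "(c (Suc i), w') \<in> E" "w' \<notin> range c"
  shows "w = w'"
proof (rule ccontr)
  assume "w \<noteq> w'"
  define v where "v = c (Suc i)"
  have E: "(v, c i) \<in> E" "(v, c (Suc (Suc i))) \<in> E" using c symE by (auto simp: is_cycle_def v_def)
  have v: "v \<in> V" using inV E by blast
  have "c i \<noteq> w" "c i \<noteq> w'" "c (Suc (Suc i)) \<noteq> w" "c (Suc (Suc i)) \<noteq> w'" using w by auto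
  then have "t * (x (c i) + (x (c (Suc (Suc i))) + (x w + x w'))) \<le> (t\<^sup>2 + 1) * x v"
    using t_sum_le[OF v, of "{c i, c (Suc (Suc i)), w, w'}"] E w \<open>w \<noteq> w'\<close> is_cycle_neq[OF c, of i]
    by (auto simp: v_def)
  moreover have "x v < t * x (c i)" "x v < t * x (c (Suc (Suc i)))"
    using cycle_not_light_up[OF c, of "Suc i"] cycle_not_light_down[OF c, of i] E by (auto simp: light_def v_def)
  ultimately have 1: "t * (x w + x w') \<le> (t\<^sup>2 - 1) * x v" by (simp add: algebra_simps)
  have "t * x v \<le> (t\<^sup>2 + 1) * x w" "t * x v \<le> (t\<^sup>2 + 1) * x w'" using nbr_le w by (auto simp: v_def)
  then have "t * (t * x v + t * x v) \<le> t * ((t\<^sup>2 + 1) * x w + (t\<^sup>2 + 1) * x w')"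
    using t1 by (intro mult_left_mono) auto
  also have "\<dots> = (t\<^sup>2 + 1) * (t * (x w + x w'))" by (simp add: algebra_simps)
  also have "\<dots> \<le> (t\<^sup>2 + 1) * ((t\<^sup>2 - 1) * x v)" using 1 by (intro mult_left_mono) auto
  finally have "(2 * t\<^sup>2) * x v \<le> ((t\<^sup>2 + 1) * (t\<^sup>2 - 1)) * x v" by (simp add: algebra_simps power2_eq_square)
  then have "2 * t\<^sup>2 \<le> (t\<^sup>2 + 1) * (t\<^sup>2 - 1)" using xpos[OF v] by simp
  moreover have "t\<^sup>2 * t\<^sup>2 \<le> 2 * t\<^sup>2" using t2 by (intro mult_right_mono) auto
  ultimately show False by (simp add: algebra_simps)
qed

lemma cycle_spine_coords:
  assumes c: "is_cycle E L c"
  shows "\<exists>p \<phi>. spine_coords V E (range c) p \<phi>"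
proof (rule ex_spine_coords)
  show "range c \<subseteq> V" using c inV(1) unfolding is_cycle_def by blast
  show "range c \<noteq> {}" by simp
  fix s w assume s: "s \<in> range c" and w: "(s, w) \<in> E" "w \<notin> range c"
  obtain i where i: "s = c (Suc i)" using is_cycle_pred[OF c s] .
  show "light s w" using cycle_outside_light[OF c, of i w] w i by auto
  show "w = w'" if "(s, w') \<in> E" "w' \<notin> range c" for w'
    using cycle_outside_unique[OF c, of i w w'] w i that by blast
qed

text \<open>After a full turn the edge gain has returned to its initial positive value, which
  cancels from the telescoped inequality.\<close>

lemma cycle_branch_gains:
  assumes c: "is_cycle E L c" and sc: "spine_coords V E (range c) p \<phi>"
  shows "branch_defect (t\<^sup>2) (p (c i)) < 1"
    and "(\<Prod>i<L. (branch_gain (t\<^sup>2) (p (c (Suc i))))\<^sup>2) \<le> (t\<^sup>2) ^ L"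
proof -
  define G where "G j = edge_gain t (x (c j)) (x (c (Suc j)))" for j
  have E: "(c j, c (Suc j)) \<in> E" for j using c by (simp add: is_cycle_def)
  have cV: "c j \<in> V" for j using E inV by blast
  have up: "x (c j) < t * x (c (Suc j))" for j
    using cycle_not_light_up[OF c, of j] E by (simp add: light_def not_le)
  have down: "x (c (Suc j)) < t * x (c j)" for j
    using cycle_not_light_down[OF c, of j] E symE by (simp add: light_def not_le)
  have Gpos: "G j > 0" for j unfolding G_def using up down t1 by (intro edge_gain_pos)
  have swap: "G j * edge_gain t (x (c (Suc j))) (x (c j)) = t\<^sup>2" for j
    unfolding G_def using up down t1 by (intro edge_gain_swap)
  have gain: "branch_defect (t\<^sup>2) (p (c (Suc j))) < 1"
      "(branch_gain (t\<^sup>2) (p (c (Suc j))))\<^sup>2 \<le> edge_gain t (x (c (Suc j))) (x (c j)) * G (Suc j)" for j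
  proof -
    let ?v = "c (Suc j)"
    let ?y = "\<Sum>w\<in>E `` {?v} - range c. x w"
    have "sum x ({c j, c (Suc (Suc j))} \<union> (E `` {?v} - range c)) \<le> (t + 1 / t) * x ?v"
      using cV E symE by (intro sum_le) auto
    moreover have "sum x ({c j, c (Suc (Suc j))} \<union> (E `` {?v} - range c)) = x (c j) + x (c (Suc (Suc j))) + ?y"
      using is_cycle_neq[OF c, of j] nbr_finite[of ?v] by (subst sum.union_disjoint) auto
    ultimately have le: "x (c j) + x (c (Suc (Suc j))) + ?y \<le> (t + 1 / t) * x ?v" by simp
    have tl: "t * ((t\<^sup>2) ^ p ?v - 1) * x ?v \<le> ((t\<^sup>2) ^ Suc (p ?v) - 1) * ?y"
      by (rule spine_tail_ratio[OF sc]) simp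
    show "branch_defect (t\<^sup>2) (p ?v) < 1"
      by (rule branch_gain_le_edge_gains(1)[OF t1 xpos[OF cV] down up up down le tl])
    show "(branch_gain (t\<^sup>2) (p ?v))\<^sup>2 \<le> edge_gain t (x ?v) (x (c j)) * G (Suc j)"
      unfolding G_def
      by (rule branch_gain_le_edge_gains(2)[OF t1 xpos[OF cV] down up up down le tl])
  qed
  obtain i' where "c i = c (Suc i')" using is_cycle_pred[OF c, of "c i"] by blast
  then show "branch_defect (t\<^sup>2) (p (c i)) < 1" using gain(1)[of i'] by simp
  have step: "(branch_gain (t\<^sup>2) (p (c (Suc j))))\<^sup>2 * G j \<le> t\<^sup>2 * G (Suc j)" for j
  proof -
    have "(branch_gain (t\<^sup>2) (p (c (Suc j))))\<^sup>2 * G j \<le> edge_gain t (x (c (Suc j))) (x (c j)) * G (Suc j) * G j"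
      using gain(2)[of j] Gpos[of j] by (intro mult_right_mono) auto
    also have "\<dots> = (G j * edge_gain t (x (c (Suc j))) (x (c j))) * G (Suc j)" by simp
    finally show ?thesis using swap by simp
  qed
  have chain: "(\<Prod>i<d. (branch_gain (t\<^sup>2) (p (c (Suc i))))\<^sup>2) * G 0 \<le> (t\<^sup>2) ^ d * G d" for d
  proof (induction d)
    case 0
    then show ?case by simp
  next
    case (Suc d)
    have "(\<Prod>i<Suc d. (branch_gain (t\<^sup>2) (p (c (Suc i))))\<^sup>2) * G 0 =
        (branch_gain (t\<^sup>2) (p (c (Suc d))))\<^sup>2 * ((\<Prod>i<d. (branch_gain (t\<^sup>2) (p (c (Suc i))))\<^sup>2) * G 0)"
      by simp
    also have "\<dots> \<le> (branch_gain (t\<^sup>2) (p (c (Suc d))))\<^sup>2 * ((t\<^sup>2) ^ d * G d)"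
      using Suc by (intro mult_left_mono) auto
    also have "\<dots> = (t\<^sup>2) ^ d * ((branch_gain (t\<^sup>2) (p (c (Suc d))))\<^sup>2 * G d)" by simp
    also have "\<dots> \<le> (t\<^sup>2) ^ d * (t\<^sup>2 * G (Suc d))"
      using step[of d] by (intro mult_left_mono) auto
    finally show ?case by (simp add: ac_simps)
  qed
  have "G L = G 0" using is_cycle_period[OF c, of 0] is_cycle_period[OF c, of "Suc 0"] by (simp add: G_def)
  then have "(\<Prod>i<L. (branch_gain (t\<^sup>2) (p (c (Suc i))))\<^sup>2) \<le> (t\<^sup>2) ^ L"
    using chain[of L] Gpos[of 0] by simp
  then show "(\<Prod>i<L. (branch_gain (t\<^sup>2) (p (c (Suc i))))\<^sup>2) \<le> (t\<^sup>2) ^ L" .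
qed

text \<open>All gains are at least 1, so every factor except the two chosen ones may be
  dropped.\<close>

lemma cycle_two_branch_gains:
  assumes c: "is_cycle E L c" and sc: "spine_coords V E (range c) p \<phi>" and ij: "i < j" "j < L"
  shows "(branch_gain (t\<^sup>2) (p (c i)) * branch_gain (t\<^sup>2) (p (c j)))\<^sup>2 \<le> (t\<^sup>2) ^ L"
proof -
  have q1: "t\<^sup>2 > 1" using t1 by (simp add: one_less_power)
  have ge: "1 \<le> (branch_gain (t\<^sup>2) (p (c i)))\<^sup>2" for i
    using branch_gain_ge_1[OF q1 cycle_branch_gains(1)[OF c sc]] by (simp add: one_le_power)
  \<comment> \<open>The product is indexed by predecessors; the predecessor of position 0 is
    \<open>L - 1\<close>.\<close>
  define i' where "i' = (if i = 0 then L - 1 else i - 1)"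
  have i': "i' < L" "j - 1 < L" "i' \<noteq> j - 1" using ij by (auto simp: i'_def)
  have c': "c (Suc i') = c i" "c (Suc (j - 1)) = c j"
    using ij is_cycle_period[OF c, of 0] by (auto simp: i'_def)
  have "(\<Prod>i\<in>{i', j - 1}. (branch_gain (t\<^sup>2) (p (c (Suc i))))\<^sup>2) \<le>
      (\<Prod>i<L. (branch_gain (t\<^sup>2) (p (c (Suc i))))\<^sup>2)"
    using i' ge by (intro prod_mono2) auto
  also have "\<dots> \<le> (t\<^sup>2) ^ L" by (rule cycle_branch_gains(2)[OF c sc])
  finally show ?thesis using i'(3) c' by (simp add: power_mult_distrib)
qed

end

section \<open>Diameter and order of a cycle with pendant paths\<close>

context simple_graph
begin

lemma tail_walk:
  assumes sc: "spine_coords V E S p \<phi>" "s \<in> S" "a + d \<le> p s"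
  shows "(\<phi> s a, \<phi> s (a + d)) \<in> E ^^ d"
  using assms(3)
proof (induction d)
  case 0
  then show ?case by simp
next
  case (Suc d)
  have "\<phi> s (a + d) \<in> E `` {\<phi> s (Suc (a + d))}"
    using spine_coords_nbrs[OF sc(1,2), of "a + d"] Suc by simp
  then have "(\<phi> s (a + d), \<phi> s (Suc (a + d))) \<in> E" using symE by simp
  then show ?case using Suc by auto
qed

lemma cycle_walk: "is_cycle E L c \<Longrightarrow> (c i, c (i + d)) \<in> E ^^ d"
  by (induction d) (auto simp: is_cycle_def)

text \<open>The walk between two far vertices runs down to both roots and around the cycle either
  way. If both vertices lie over the same root, \<open>D\<close> is at most the length of that one
  pendant path, and any other cycle vertex serves as the second index.\<close>

lemma cycle_diameter:
  assumes c: "is_cycle E L c" and sc: "spine_coords V E (range c) p \<phi>"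
    and uv: "u \<in> V" "v \<in> V" "\<And>d. d < D \<Longrightarrow> (u, v) \<notin> E ^^ d"
  obtains i j where "i < j" "j < L" "D \<le> p (c i) + p (c j) + min (j - i) (L - (j - i))"
proof -
  have L: "L \<ge> 3" using c by (simp add: is_cycle_def)
  have D: "D \<le> d" if "(u, v) \<in> E ^^ d" for d using uv(3)[of d] that by (meson not_le)
  have idx: "\<exists>i<L. s = c i" if "s \<in> range c" for s using that is_cycle_range[OF c] by auto
  obtain s h where s: "s \<in> range c" "h \<le> p s" "u = \<phi> s h" using spine_coords_obtain[OF sc uv(1)] .
  obtain s' h' where s': "s' \<in> range c" "h' \<le> p s'" "v = \<phi> s' h'" using spine_coords_obtain[OF sc uv(2)] .
  obtain i where i: "i < L" "s = c i" using idx[OF s(1)] by blast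
  obtain j where j: "j < L" "s' = c j" using idx[OF s'(1)] by blast
  have us: "(u, s) \<in> E ^^ h" using relpow_sym tail_walk[OF sc s(1), of 0 h] s spine_coords_zero[OF sc s(1)] by simp
  have vs: "(s', v) \<in> E ^^ h'" using tail_walk[OF sc s'(1), of 0 h'] s' spine_coords_zero[OF sc s'(1)] by simp
  have via: "D \<le> p s + p s' + d" if "(s, s') \<in> E ^^ d" for d
  proof -
    have "(u, v) \<in> E ^^ (h + d + h')" using us vs that by (auto simp: relpow_add)
    then have "D \<le> h + d + h'" by (rule D)
    then show ?thesis using s(2) s'(2) by linarith
  qed
  have go: "(c a, c b) \<in> E ^^ (b - a)" "(c a, c b) \<in> E ^^ (L - (b - a))" if "a < b" "b < L" for a b
  proof -
    show "(c a, c b) \<in> E ^^ (b - a)" using cycle_walk[OF c, of a "b - a"] that by simp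
    have "(c b, c (b + (L - (b - a)))) \<in> E ^^ (L - (b - a))" by (rule cycle_walk[OF c])
    moreover have "b + (L - (b - a)) = a + L" using that by simp
    ultimately have "(c b, c a) \<in> E ^^ (L - (b - a))" using is_cycle_period[OF c, of a] by metis
    then show "(c a, c b) \<in> E ^^ (L - (b - a))" by (rule relpow_sym)
  qed
  consider "i < j" | "j < i" | "i = j" by linarith
  then show ?thesis
  proof cases
    case 1
    then have "D \<le> p (c i) + p (c j) + min (j - i) (L - (j - i))"
      using via go[of i j] i j by (simp add: min_def)
    then show ?thesis using that 1 j by blast
  next
    case 2
    then have "(s, s') \<in> E ^^ (i - j)" "(s, s') \<in> E ^^ (L - (i - j))" using go[of j i] relpow_sym i j by auto
    then have "D \<le> p s + p s' + (i - j)" "D \<le> p s + p s' + (L - (i - j))" using via by auto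
    then have "D \<le> p (c j) + p (c i) + min (i - j) (L - (i - j))"
      unfolding i(2) j(2) by (metis add.commute min_def)
    then show ?thesis using that 2 i by blast
  next
    case 3
    then have "s = s'" using i j by simp
    have "D \<le> p s"
    proof (cases "h \<le> h'")
      case True
      then have "(u, v) \<in> E ^^ (h' - h)" using tail_walk[OF sc s(1), of h "h' - h"] s s' \<open>s = s'\<close> by simp
      then have "D \<le> h' - h" by (rule D)
      then show ?thesis using s'(2) \<open>s = s'\<close> by simp
    next
      case False
      then have "(u, v) \<in> E ^^ (h - h')" using relpow_sym[OF tail_walk[OF sc s(1), of h' "h - h'"]] s s' \<open>s = s'\<close> by simp
      then have "D \<le> h - h'" by (rule D)
      then show ?thesis using s(2) by simp
    qed
    then have D': "D \<le> p (c i)" using i by simp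
    show ?thesis
    proof (cases "i = 0")
      case True
      then show ?thesis using that[of 0 1] D' L by simp
    next
      case False
      then show ?thesis using that[of 0 i] D' i by simp
    qed
  qed
qed

lemma cycle_card:
  assumes c: "is_cycle E L c" and sc: "spine_coords V E (range c) p \<phi>"
  shows "card V = L + (\<Sum>i<L. p (c i))"
proof -
  have "card V = (\<Sum>s\<in>c ` {..<L}. Suc (p s))"
    using spine_coords_card[OF sc] is_cycle_range[OF c] by simp
  also have "\<dots> = (\<Sum>i<L. Suc (p (c i)))" using sum.reindex[OF is_cycle_inj[OF c]] by simp
  finally show ?thesis by (simp add: sum.distrib[of "\<lambda>_. 1" , simplified] sum_Suc)
qed

end

section \<open>Acyclic graphs\<close>

context simple_graph
begin

definition vpath :: "'a list \<Rightarrow> bool" where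
  "vpath ks \<longleftrightarrow> ks \<noteq> [] \<and> distinct ks \<and> set ks \<subseteq> V \<and> (\<forall>i. Suc i < length ks \<longrightarrow> (ks ! i, ks ! Suc i) \<in> E)"

lemma path_Cons: "vpath ks \<Longrightarrow> w \<notin> set ks \<Longrightarrow> (ks ! 0, w) \<in> E \<Longrightarrow> vpath (w # ks)"
  unfolding vpath_def using symE inV by (auto simp: nth_Cons split: nat.splits)

lemma path_snoc:
  assumes "vpath ks" "w \<notin> set ks" "(ks ! (length ks - 1), w) \<in> E"
  shows "vpath (ks @ [w])"
proof -
  have "((ks @ [w]) ! i, (ks @ [w]) ! Suc i) \<in> E" if "i < length ks" for i
  proof (cases "Suc i < length ks")
    case True
    then show ?thesis using assms that by (auto simp: vpath_def nth_append)
  next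
    case False
    then have "i = length ks - 1" using that by simp
    then show ?thesis using assms that by (auto simp: nth_append)
  qed
  then show ?thesis using assms inV unfolding vpath_def by auto
qed

lemma ex_longest_path:
  assumes "vpath ks" "P ks"
  obtains cs where "vpath cs" "P cs" "\<And>ds. vpath ds \<Longrightarrow> P ds \<Longrightarrow> length ds \<le> length cs"
proof -
  have "length ds \<le> card V" if "vpath ds" for ds
    using that card_mono[OF fin, of "set ds"] by (auto simp: vpath_def distinct_card)
  then have "\<exists>cs. (vpath cs \<and> P cs) \<and> (\<forall>ds. vpath ds \<and> P ds \<longrightarrow> length ds \<le> length cs)"
    using assms by (intro ex_has_greatest_nat[of "\<lambda>ds. vpath ds \<and> P ds" ks length "Suc (card V)"]) (auto simp: less_Suc_eq_le)
  then show ?thesis using that by blast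
qed

lemma path_chord_cycle:
  assumes "vpath cs" "i < j" "j < length cs" "j \<noteq> Suc i" "(cs ! i, cs ! j) \<in> E"
  shows "\<exists>L c. is_cycle E L c"
proof -
  define L where "L = Suc (j - i)"
  define c where "c k = cs ! (i + k mod L)" for k
  have L: "3 \<le> L" using assms by (auto simp: L_def)
  have bound: "i + k mod L < length cs" for k
  proof -
    have "k mod L \<le> j - i" using mod_less_divisor[of L k] by (simp add: L_def)
    then show ?thesis using assms by linarith
  qed
  have "(c k, c (Suc k)) \<in> E" for k
  proof (cases "Suc (k mod L) = L")
    case True
    then have "Suc k mod L = 0" "i + k mod L = j" using assms by (auto simp: mod_Suc L_def)
    then show ?thesis using symE assms by (simp add: c_def)
  next
    case False
    then have "Suc k mod L = Suc (k mod L)" by (simp add: mod_Suc)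
    then show ?thesis using assms(1) bound[of "Suc k"] by (simp add: c_def vpath_def)
  qed
  moreover have "c k = c k' \<longleftrightarrow> k mod L = k' mod L" for k k'
    using assms(1) bound[of k] bound[of k'] by (auto simp: c_def vpath_def nth_eq_iff_index_eq)
  ultimately show ?thesis unfolding is_cycle_def using L by blast
qed

definition induced_spine :: "'a list \<Rightarrow> ('a \<Rightarrow> nat) \<Rightarrow> ('a \<Rightarrow> nat \<Rightarrow> 'a) \<Rightarrow> bool" where
  "induced_spine cs p \<phi> \<longleftrightarrow> vpath cs \<and> spine_coords V E (set cs) p \<phi> \<and>
     (\<forall>i<length cs. \<forall>j<length cs. (cs ! i, cs ! j) \<in> E \<longrightarrow> i = Suc j \<or> j = Suc i)"

text \<open>A potential that changes by at most 1 along edges bounds walks from below. It is the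
  position on the spine, continued along pendant paths with slope -1 at \<open>a\<close>, 1 at
  \<open>b\<close> and 0 elsewhere.\<close>

lemma induced_spine_distance:
  assumes sp: "induced_spine cs p \<phi>" and ab: "a < b" "b < length cs"
    and D: "\<And>u v. u \<in> V \<Longrightarrow> v \<in> V \<Longrightarrow> \<exists>d\<le>D. (u, v) \<in> E ^^ d"
  shows "b - a + p (cs ! a) + p (cs ! b) \<le> D"
proof -
  have sc: "spine_coords V E (set cs) p \<phi>" and cs: "distinct cs"
    and ind: "\<And>i j. i < length cs \<Longrightarrow> j < length cs \<Longrightarrow> (cs ! i, cs ! j) \<in> E \<Longrightarrow> i = Suc j \<or> j = Suc i"
    using sp by (auto simp: induced_spine_def vpath_def)
  \<comment> \<open>The function \<open>f\<close> below is 1-Lipschitz and separates the two path ends by the claimed distance.\<close>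
  define \<sigma> :: "nat \<Rightarrow> int" where "\<sigma> i = (if i = a then -1 else if i = b then 1 else 0)" for i
  define dec where "dec v = (SOME (i, h). i < length cs \<and> h \<le> p (cs ! i) \<and> v = \<phi> (cs ! i) h)" for v
  have dec: "dec (\<phi> (cs ! i) h) = (i, h)" if ih: "i < length cs" "h \<le> p (cs ! i)" for i h
    unfolding dec_def
  proof (rule some_equality)
    show "case (i, h) of (i', h') \<Rightarrow> i' < length cs \<and> h' \<le> p (cs ! i') \<and> \<phi> (cs ! i) h = \<phi> (cs ! i') h'"
      using ih by simp
  next
    fix y assume y: "case y of (i', h') \<Rightarrow> i' < length cs \<and> h' \<le> p (cs ! i') \<and> \<phi> (cs ! i) h = \<phi> (cs ! i') h'"
    obtain i' h' where y': "y = (i', h')" by (cases y)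
    have "cs ! i = cs ! i' \<and> h = h'"
      using y y' spine_coords_inj[OF sc, of "cs ! i" "cs ! i'" h h'] ih by simp
    then show "y = (i, h)" using y y' cs ih by (simp add: nth_eq_iff_index_eq)
  qed
  define f :: "'a \<Rightarrow> int" where "f v = (case dec v of (i, h) \<Rightarrow> int i + \<sigma> i * int h)" for v
  have f: "f (\<phi> (cs ! i) h) = int i + \<sigma> i * int h" if "i < length cs" "h \<le> p (cs ! i)" for i h
    using dec[OF that] by (simp add: f_def)
  have \<sigma>1: "\<bar>\<sigma> i\<bar> \<le> 1" for i by (simp add: \<sigma>_def)
  have lip: "\<bar>f u - f v\<bar> \<le> 1" if uv: "(u, v) \<in> E" for u v
  proof -
    have "u \<in> V" using uv inV by blast
    then obtain s h where s: "s \<in> set cs" "h \<le> p s" "u = \<phi> s h" using spine_coords_obtain[OF sc] by metis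
    obtain i where i: "i < length cs" "s = cs ! i" using s(1) by (auto simp: in_set_conv_nth)
    show ?thesis
    proof (cases h)
      case (Suc g)
      have "v \<in> E `` {\<phi> s (Suc g)}" using uv s Suc by simp
      then have "v = \<phi> s g \<or> Suc g < p s \<and> v = \<phi> s (Suc (Suc g))"
        using spine_coords_nbrs[OF sc s(1), of g] s Suc by (auto split: if_splits)
      then show ?thesis
      proof
        assume "v = \<phi> s g"
        then have "f v = int i + \<sigma> i * int g" "f u = int i + \<sigma> i * int (Suc g)" using f i s Suc by auto
        then show ?thesis using \<sigma>1[of i] by (simp add: algebra_simps)
      next
        assume "Suc g < p s \<and> v = \<phi> s (Suc (Suc g))"
        then have "f v = int i + \<sigma> i * int (Suc (Suc g))" "f u = int i + \<sigma> i * int (Suc g)" using f i s Suc by auto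
        then show ?thesis using \<sigma>1[of i] by (simp add: algebra_simps)
      qed
    next
      case 0
      then have us: "u = s" using s spine_coords_zero[OF sc s(1)] by simp
      then have fu: "f u = int i" using f[of i 0] i spine_coords_zero[OF sc s(1)] by simp
      show ?thesis
      proof (cases "v \<in> set cs")
        case True
        then obtain j where j: "j < length cs" "v = cs ! j" by (auto simp: in_set_conv_nth)
        then have "f v = int j" using f[of j 0] spine_coords_zero[OF sc True] by simp
        moreover have "i = Suc j \<or> j = Suc i" using ind i j us uv by simp
        ultimately show ?thesis using fu by auto
      next
        case False
        then have "v \<in> E `` {s} - set cs" using uv us by simp
        then have "0 < p s \<and> v = \<phi> s 1" using spine_coords_root_nbrs[OF sc s(1)] by (auto split: if_splits)
        then have "f v = int i + \<sigma> i * int 1" using f[of i 1] i by simp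
        then show ?thesis using fu \<sigma>1[of i] by simp
      qed
    qed
  qed
  let ?u = "\<phi> (cs ! a) (p (cs ! a))" and ?v = "\<phi> (cs ! b) (p (cs ! b))"
  have "?u \<in> V" "?v \<in> V" using spine_coords_mem[OF sc] ab by auto
  then obtain d where d: "d \<le> D" "(?u, ?v) \<in> E ^^ d" using D by blast
  have "\<bar>f ?u - f ?v\<bar> \<le> int d" using lipschitz_relpow[OF lip d(2)] .
  moreover have "f ?u = int a - int (p (cs ! a))" "f ?v = int b + int (p (cs ! b))"
    using f[of a "p (cs ! a)"] f[of b "p (cs ! b)"] ab by (auto simp: \<sigma>_def)
  ultimately show ?thesis using ab d by linarith
qed

lemma induced_spine_card:
  assumes sp: "induced_spine cs p \<phi>"
  shows "card V = length cs + (\<Sum>i<length cs. p (cs ! i))"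
proof -
  have sc: "spine_coords V E (set cs) p \<phi>" and d: "distinct cs" using sp by (auto simp: induced_spine_def vpath_def)
  have b: "bij_betw ((!) cs) {..<length cs} (set cs)" using d by (simp add: bij_betw_nth)
  have "card V = (\<Sum>s\<in>set cs. Suc (p s))" using spine_coords_card[OF sc] by simp
  also have "\<dots> = (\<Sum>i<length cs. Suc (p (cs ! i)))" using sum.reindex_bij_betw[OF b, of "\<lambda>s. Suc (p s)"] by simp
  finally show ?thesis by (simp add: sum_Suc)
qed

end

section \<open>The spine of an acyclic graph\<close>

context weighted_graph
begin

text \<open>The core \<open>K\<close> consists of the vertices entered by no light edge; a vertex of
  maximal weight belongs to it. Take a longest path inside \<open>K\<close>: its ends have no core
  neighbour off the path by maximality, its inner vertices none by \<open>three_nonlight\<close>. So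
  the path together with its tails is closed under adjacency.\<close>

lemma ex_core_path:
  assumes "V \<noteq> {}"
  obtains ks where "vpath ks" "\<And>v. v \<in> V \<Longrightarrow> v \<notin> set ks \<Longrightarrow> \<exists>u. light u v"
proof -
  define K where "K = {v \<in> V. \<forall>u. \<not> light u v}"
  have "K \<noteq> {}"
  proof -
    obtain k where k: "k \<in> V" "Max (x ` V) = x k" using obtains_MAX[OF fin assms] by blast
    have "\<not> light u k" for u
    proof
      assume l: "light u k"
      then have "u \<in> V" using inV by (auto simp: light_def)
      then have "x u \<le> x k" using k fin by (metis Max_ge finite_imageI imageI)
      then show False using light_less[OF l] by simp
    qed
    then have "k \<in> K" using k by (simp add: K_def)
    then show ?thesis by blast
  qed
  then obtain k where "k \<in> K" by blast
  then have k: "vpath [k]" "set [k] \<subseteq> K" by (auto simp: vpath_def K_def)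
  obtain ks where ks: "vpath ks" "set ks \<subseteq> K"
    and longest: "\<And>ds. vpath ds \<Longrightarrow> set ds \<subseteq> K \<Longrightarrow> length ds \<le> length ks"
    using ex_longest_path[of "[k]" "\<lambda>ks. set ks \<subseteq> K", OF k] by blast
  have Knbr: "light s w \<or> w \<in> K" if kw: "s \<in> K" "(s, w) \<in> E" for s w
  proof (rule disjCI)
    assume "w \<notin> K"
    then obtain u where u: "light u w" using inV(2)[OF kw(2)] by (auto simp: K_def)
    show "light s w"
    proof (cases "u = s")
      case False
      then have "light w s" using light_next[OF u symE[OF kw(2)]] by blast
      then show ?thesis using kw by (auto simp: K_def)
    qed (use u in simp)
  qed
  have Kin: "w \<in> set ks" if s: "s \<in> set ks" "(s, w) \<in> E" "w \<in> K" for s w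
  proof (rule ccontr)
    assume w: "w \<notin> set ks"
    obtain i where i: "i < length ks" "s = ks ! i" using s by (auto simp: in_set_conv_nth)
    have "(ks ! 0, w) \<notin> E" using longest[of "w # ks"] path_Cons[OF ks(1) w] s ks by auto
    moreover have "(ks ! (length ks - 1), w) \<notin> E" using longest[of "ks @ [w]"] path_snoc[OF ks(1) w] s ks by auto
    ultimately have "i \<noteq> 0" "i \<noteq> length ks - 1" using s(2) i(2) by metis+
    then have i': "Suc (i - 1) = i" "Suc i < length ks" "i - 1 < length ks" using i by auto
    have "(ks ! (i - 1), s) \<in> E" "(s, ks ! Suc i) \<in> E"
      using ks(1) i i' by (auto simp: vpath_def dest: spec[of _ "i - 1"])
    then have E: "(s, ks ! (i - 1)) \<in> E" "(s, ks ! Suc i) \<in> E" using symE by auto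
    have ne: "ks ! (i - 1) \<noteq> ks ! Suc i" using ks(1) i' by (auto simp: vpath_def nth_eq_iff_index_eq)
    have K3: "ks ! (i - 1) \<in> set ks" "ks ! Suc i \<in> set ks" using i' by auto
    show False
      using three_nonlight[OF E s(2)] ne K3 w ks(2) s(3) by (auto simp: K_def)
  qed
  define R where "R = set ks \<union> {v. \<exists>s ws. s \<in> set ks \<and> tail_from s ws \<and> v \<in> set ws}"
  obtain k0 where k0: "k0 \<in> set ks" using ks by (cases ks) (auto simp: vpath_def)
  have "V \<subseteq> R"
  proof (rule closed_imp_all)
    show "k0 \<in> R" "k0 \<in> V" using k0 ks by (auto simp: R_def vpath_def)
    fix v w assume v: "v \<in> R" and vw: "(v, w) \<in> E"
    show "w \<in> R"
    proof (cases "v \<in> set ks")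
      case True
      then consider "light v w" | "w \<in> set ks" using Knbr Kin vw ks by blast
      then show ?thesis
      proof cases
        case 1
        then obtain ws where "tail_from v (w # ws)" using ex_tail by blast
        then show ?thesis using True unfolding R_def by (metis (mono_tags, lifting) UnI2 list.set_intros(1) mem_Collect_eq)
      qed (simp add: R_def)
    next
      case False
      then obtain s ws where s: "s \<in> set ks" "tail_from s ws" "v \<in> set ws" using v by (auto simp: R_def)
      then have "w = s \<or> w \<in> set ws" using tail_from_closed[OF s(2,3) vw] by simp
      then show ?thesis using s unfolding R_def by blast
    qed
  qed
  then have "\<exists>u. light u v" if "v \<in> V" "v \<notin> set ks" for v
  proof -
    have "v \<in> R" using that \<open>V \<subseteq> R\<close> by blast
    then have "\<exists>s ws. tail_from s ws \<and> v \<in> set ws" using that(2) unfolding R_def by blast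
    then obtain s ws where "tail_from s ws" "v \<in> set ws" by blast
    then show ?thesis using tail_from_nth by (metis in_set_conv_nth)
  qed
  then show ?thesis using that ks(1) by blast
qed

text \<open>A longest path containing the core path has no pendant path at its ends. Vertices off it
  are entered by light edges; an edge light towards an inner spine vertex is ruled out by
  \<open>light_deg\<close>, since that vertex has two spine neighbours, so spine edges to the
  outside are light outwards. The degree bound leaves one such edge per vertex.\<close>

lemma acyclic_induced_spine:
  assumes "V \<noteq> {}" and acyclic: "\<nexists>L c. is_cycle E L c"
    and deg: "\<And>v. v \<in> V \<Longrightarrow> card (E `` {v}) \<le> 3"
  obtains cs p \<phi> where "induced_spine cs p \<phi>" "p (cs ! 0) = 0" "p (cs ! (length cs - 1)) = 0"
proof -
  obtain ks where ks: "vpath ks" "\<And>v. v \<in> V \<Longrightarrow> v \<notin> set ks \<Longrightarrow> \<exists>u. light u v"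
    using ex_core_path[OF assms(1)] by blast
  obtain cs where cs: "vpath cs" and K: "set ks \<subseteq> set cs"
    and longest: "\<And>ds. vpath ds \<Longrightarrow> set ks \<subseteq> set ds \<Longrightarrow> length ds \<le> length cs"
    using ex_longest_path[of ks "\<lambda>ds. set ks \<subseteq> set ds"] ks(1) by (metis order_refl)
  have d: "distinct cs" "cs \<noteq> []" "set cs \<subseteq> V" using cs by (auto simp: vpath_def)
  have first: "w \<in> set cs" if "(cs ! 0, w) \<in> E" for w
    using longest[of "w # cs"] path_Cons[OF cs _ that] K by auto
  have final: "w \<in> set cs" if "(cs ! (length cs - 1), w) \<in> E" for w
    using longest[of "cs @ [w]"] path_snoc[OF cs _ that] K by auto
  have inner: "\<exists>a b. (s, a) \<in> E \<and> (s, b) \<in> E \<and> a \<noteq> b \<and> a \<in> set cs \<and> b \<in> set cs"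
    if s: "s \<in> set cs" "(s, w) \<in> E" "w \<notin> set cs" for s w
  proof -
    obtain i where i: "i < length cs" "s = cs ! i" using s by (auto simp: in_set_conv_nth)
    have "i \<noteq> 0" "i \<noteq> length cs - 1" using first[of w] final[of w] s i by metis+
    then have i': "Suc (i - 1) = i" "Suc i < length cs" "i - 1 < length cs" using i by auto
    have "(cs ! (i - 1), s) \<in> E" "(s, cs ! Suc i) \<in> E"
      using cs i i' by (auto simp: vpath_def dest: spec[of _ "i - 1"])
    moreover have "cs ! (i - 1) \<noteq> cs ! Suc i" using d i' by (auto simp: nth_eq_iff_index_eq)
    moreover have "cs ! (i - 1) \<in> set cs" "cs ! Suc i \<in> set cs" using i' by auto
    ultimately show ?thesis using symE by blast
  qed
  have "\<exists>p \<phi>. spine_coords V E (set cs) p \<phi>"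
  proof (rule ex_spine_coords)
    show "set cs \<subseteq> V" "set cs \<noteq> {}" using d by auto
    fix s w assume s: "s \<in> set cs" "(s, w) \<in> E" "w \<notin> set cs"
    obtain a b where ab: "(s, a) \<in> E" "(s, b) \<in> E" "a \<noteq> b" "a \<in> set cs" "b \<in> set cs" using inner[OF s] by blast
    obtain u where u: "light u w" using ks(2)[of w] s K inV by blast
    show "light s w"
    proof (cases "u = s")
      case False
      then have "light w s" using light_next[OF u symE[OF s(2)]] by blast
      then show ?thesis using light_deg[of w s a b] ab s by blast
    qed (use u in simp)
    show "w = w'" if w': "(s, w') \<in> E" "w' \<notin> set cs" for w'
    proof (rule ccontr)
      assume "w \<noteq> w'"
      have "card {a, b, w, w'} \<le> card (E `` {s})"
        using ab s w' nbr_finite by (intro card_mono) auto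
      moreover have "a \<noteq> w" "a \<noteq> w'" "b \<noteq> w" "b \<noteq> w'" using ab s w' by auto
      then have "card {a, b, w, w'} = 4" using ab \<open>w \<noteq> w'\<close> by simp
      ultimately show False using deg[of s] s d by auto
    qed
  qed
  then obtain p \<phi> where sc: "spine_coords V E (set cs) p \<phi>" by blast
  have "i = Suc j \<or> j = Suc i" if ij: "i < length cs" "j < length cs" "(cs ! i, cs ! j) \<in> E" for i j
  proof (rule ccontr)
    assume neg: "\<not> ?thesis"
    have "i \<noteq> j" using ij irr by metis
    then show False
      using neg path_chord_cycle[OF cs, of i j] path_chord_cycle[OF cs, of j i] ij symE acyclic
      by (metis linorder_neqE_nat)
  qed
  then have sp: "induced_spine cs p \<phi>" unfolding induced_spine_def using cs sc by blast
  have z: "p s = 0" if "s \<in> set cs" "E `` {s} \<subseteq> set cs" for s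
    using spine_coords_root_nbrs[OF sc that(1)] that(2) by (auto split: if_splits)
  show ?thesis
    by (rule that[OF sp]; rule z) (use d first final in \<open>auto\<close>)
qed

text \<open>At least three of the neighbours are leaves and the edge to the fourth is light, so the
  graph is a path with three extra leaves at one end: it has \<open>p v + 4\<close> vertices and
  diameter at least \<open>p v + 1\<close>.\<close>

lemma deg4_diameter:
  assumes D: "\<And>u v. u \<in> V \<Longrightarrow> v \<in> V \<Longrightarrow> \<exists>d\<le>D. (u, v) \<in> E ^^ d"
    and v: "v \<in> V" "card (E `` {v}) \<ge> 4"
  shows "card V \<le> D + 3"
proof -
  define q where "q = t\<^sup>2"
  have q: "1 < q" "q \<le> 2" using t1 t2 by (auto simp: q_def one_less_power)
  have xv: "x v > 0" using xpos v by blast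
  have ge: "t * (t * x v) \<le> (q + 1) * (t * x w)" if "(v, w) \<in> E" for w
    using nbr_le[OF that] mult_left_mono[of "t * x v" "(t\<^sup>2 + 1) * x w" t] t1 by (simp add: q_def algebra_simps)
  obtain B where B: "B \<subseteq> E `` {v}" "card B = 4" using v obtain_subset_with_card_n by metis
  \<comment> \<open>Every neighbour \<open>w\<close> satisfies
    \<open>(q + 1) * (t * x w) \<ge> q * x v\<close>. Five of them would need
    \<open>5 * q \<le> (q + 1) * (q + 1)\<close>, false for \<open>1 < q \<le> 2\<close>.\<close>
  have five: "card A \<le> 4" if A: "A \<subseteq> E `` {v}" for A
  proof (rule ccontr)
    assume n: "\<not> ?thesis"
    have "(\<Sum>w\<in>A. t * (t * x v)) \<le> (\<Sum>w\<in>A. (q + 1) * (t * x w))" using ge A by (intro sum_mono) auto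
    also have "\<dots> = (q + 1) * (t * (\<Sum>w\<in>A. x w))" by (simp add: sum_distrib_left)
    also have "\<dots> \<le> (q + 1) * ((q + 1) * x v)"
      using t_sum_le[OF v(1) A] q by (intro mult_left_mono) (auto simp: q_def)
    finally have 1: "(real (card A) * q) * x v \<le> ((q + 1) * (q + 1)) * x v" by (simp add: q_def power2_eq_square algebra_simps)
    then have "real (card A) * q \<le> (q + 1) * (q + 1)" using xv by simp
    moreover have "5 * q \<le> real (card A) * q" using n q by (intro mult_right_mono) auto
    moreover have "(q + 1) * (q + 1) = q * q + 2 * q + 1" by (simp add: algebra_simps)
    moreover have "q * q \<le> 2 * q" using q by simp
    ultimately show False using q by linarith
  qed
  have B': "B = E `` {v}" using five[of "E `` {v}"] B nbr_finite card_subset_eq[of "E `` {v}" B] card_mono[of "E `` {v}" B] by fastforce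
  have finB: "finite B" using B by (simp add: card_ge_0_finite)
  have leaf2: "E `` {w} \<subseteq> {v}" if w: "w \<in> B" "w' \<in> B" "w \<noteq> w'" "\<not> E `` {w'} \<subseteq> {v}" for w w'
  proof (rule ccontr)
    assume nl: "\<not> ?thesis"
    \<comment> \<open>A neighbour that is not a leaf must be heavier. Two of these together with two
      arbitrary neighbours exceed the budget at \<open>v\<close>, barely so at \<open>q = 2\<close>,
      where \<open>12 / 7 + 4 / 3 > 3\<close>.\<close>
    have big: "q * q * x v + q * x v \<le> (q * q + q + 1) * (t * x u)" if u: "u \<in> B" "\<not> E `` {u} \<subseteq> {v}" for u
    proof -
      obtain a where a: "(u, a) \<in> E" "a \<noteq> v" using u by auto
      have uv: "(u, v) \<in> E" using u B symE by auto
      have "t * (x v + x a) \<le> (q + 1) * x u"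
        using t_sum_le[of u "{v, a}"] a uv inV by (auto simp: q_def)
      then have "(q + 1) * (t * (x v + x a)) \<le> (q + 1) * ((q + 1) * x u)" using q by (intro mult_left_mono) auto
      moreover have "t * (t * x u) \<le> t * ((q + 1) * x a)" using nbr_le[OF a(1)] t1 by (simp add: q_def)
      ultimately have "(q + 1) * (t * x v) + q * x u \<le> (q + 1) * ((q + 1) * x u)"
        by (simp add: algebra_simps q_def power2_eq_square)
      then have "(q + 1) * (t * x v) \<le> (q * q + q + 1) * x u" by (simp add: algebra_simps)
      then have "t * ((q + 1) * (t * x v)) \<le> t * ((q * q + q + 1) * x u)" using t1 by (intro mult_left_mono) auto
      then show ?thesis by (simp add: algebra_simps q_def power2_eq_square)
    qed
    define C where "C = B - {w, w'}"
    have C: "card C = 2" "C \<subseteq> B" "B = {w, w'} \<union> C" "{w, w'} \<inter> C = {}" "finite C"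
      using w B finB by (auto simp: C_def card_Diff_subset)
    have "(\<Sum>u\<in>C. q * x v) \<le> (\<Sum>u\<in>C. (q + 1) * (t * x u))"
      using ge C B by (intro sum_mono) (auto simp: q_def power2_eq_square algebra_simps)
    then have C2: "2 * (q * x v) \<le> (q + 1) * (t * (\<Sum>u\<in>C. x u))" using C by (simp add: sum_distrib_left)
    have W2: "2 * (q * q * x v + q * x v) \<le> (q * q + q + 1) * (t * (x w + x w'))"
      using big[of w] big[of w'] w nl by (simp add: algebra_simps)
    have tot: "t * (x w + x w') + t * (\<Sum>u\<in>C. x u) \<le> (q + 1) * x v"
    proof -
      have "(\<Sum>u\<in>B. x u) = (x w + x w') + (\<Sum>u\<in>C. x u)" using C w by (simp add: sum.union_disjoint)
      then show ?thesis using t_sum_le[OF v(1) B(1)] by (simp add: q_def algebra_simps)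
    qed
    define r where "r = q * q + q + 1"
    have "(q + 1) * (2 * (q * q * x v + q * x v)) + r * (2 * (q * x v)) \<le>
        (q + 1) * (r * (t * (x w + x w'))) + r * ((q + 1) * (t * (\<Sum>u\<in>C. x u)))"
      using W2 C2 q by (intro add_mono mult_left_mono) (auto simp: r_def)
    also have "\<dots> = (q + 1) * r * (t * (x w + x w') + t * (\<Sum>u\<in>C. x u))" by (simp add: algebra_simps)
    also have "\<dots> \<le> (q + 1) * r * ((q + 1) * x v)" using tot q by (intro mult_left_mono) (auto simp: r_def)
    finally have "((q + 1) * 2 * (q * q + q) + r * 2 * q) * x v \<le> ((q + 1) * r * (q + 1)) * x v" by (simp add: algebra_simps)
    then have "(q + 1) * 2 * (q * q + q) + r * 2 * q \<le> (q + 1) * r * (q + 1)" using xv by simp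
    moreover have "(q + 1) * 2 * (q * q + q) + r * 2 * q = 4 * (q * q * q) + 6 * (q * q) + 4 * q"
      "(q + 1) * r * (q + 1) = q * (q * q * q) + 3 * (q * q * q) + 4 * (q * q) + 3 * q + 1"
      by (simp_all add: r_def algebra_simps)
    moreover have "q * (q * q * q) \<le> 2 * (q * q * q)" "q * (q * q) \<le> 2 * (q * q)"
      using q by (intro mult_right_mono; simp)+
    ultimately show False using q by (simp add: mult.assoc)
  qed
  obtain w0 where w0: "w0 \<in> B" and leaf: "\<And>w. w \<in> B - {w0} \<Longrightarrow> E `` {w} \<subseteq> {v}"
  proof (cases "\<exists>w'\<in>B. \<not> E `` {w'} \<subseteq> {v}")
    case True
    then obtain w' where w': "w' \<in> B" "\<not> E `` {w'} \<subseteq> {v}" by blast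
    show ?thesis by (rule that[OF w'(1)]) (use leaf2 w' in blast)
  next
    case False
    moreover obtain w where "w \<in> B" using B(2) by fastforce
    ultimately show ?thesis using that by blast
  qed
  define A where "A = B - {w0}"
  have A: "card A = 3" "finite A" "A \<subseteq> B" "w0 \<notin> A" "B = insert w0 A"
    using w0 B finB by (auto simp: A_def card_Diff_singleton)
  have vB: "v \<notin> B" using B' irr by blast
  have leafA: "E `` {w} = {v}" if "w \<in> A" for w
  proof -
    have "(w, v) \<in> E" using that symE B A by blast
    then show ?thesis using leaf[of w] that by (auto simp: A_def)
  qed
  \<comment> \<open>In units of \<open>x v\<close>, the three leaves use at least
    \<open>3 * q / (q + 1)\<close> of the budget \<open>q + 1\<close>; the rest is at most 1 because
    \<open>q \<le> 2\<close>.\<close>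
  have lw0: "light v w0"
  proof -
    have "(\<Sum>u\<in>A. q * x v) \<le> (\<Sum>u\<in>A. (q + 1) * (t * x u))"
      using ge A B by (intro sum_mono) (auto simp: q_def power2_eq_square algebra_simps)
    then have A3: "3 * (q * x v) \<le> (q + 1) * (t * (\<Sum>u\<in>A. x u))" using A(1) by (simp add: sum_distrib_left)
    have "t * (\<Sum>u\<in>B. x u) \<le> (q + 1) * x v" using t_sum_le[OF v(1) B(1)] by (simp add: q_def)
    then have "t * x w0 + t * (\<Sum>u\<in>A. x u) \<le> (q + 1) * x v" using A by (simp add: distrib_left)
    then have "(q + 1) * (t * x w0 + t * (\<Sum>u\<in>A. x u)) \<le> (q + 1) * ((q + 1) * x v)"
      using q by (intro mult_left_mono) auto
    then have "(q + 1) * (t * x w0) + 3 * (q * x v) \<le> (q + 1) * ((q + 1) * x v)"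
      using A3 by (simp add: distrib_left)
    moreover have "(q + 1) * ((q + 1) * x v) - 3 * (q * x v) = (q * q) * x v - 2 * (q * x v) + (q + 1) * x v"
      by (simp add: algebra_simps)
    moreover have "(q * q) * x v \<le> (2 * q) * x v" using q xv by (intro mult_right_mono) auto
    ultimately have "(q + 1) * (t * x w0) \<le> (q + 1) * x v" by simp
    then have "t * x w0 \<le> x v" using q by simp
    then show ?thesis using w0 B by (auto simp: light_def)
  qed
  \<comment> \<open>Here the spine is the star of \<open>v\<close> and its three leaves; its only
    outgoing edge leads to \<open>w0\<close>.\<close>
  define S where "S = insert v A"
  have out: "s = v \<and> w = w0" if "s \<in> S" "(s, w) \<in> E" "w \<notin> S" for s w
    using that leafA A B' by (auto simp: S_def)
  have "\<exists>p \<phi>. spine_coords V E S p \<phi>"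
  proof (rule ex_spine_coords)
    show "S \<subseteq> V" using v A B inV by (auto simp: S_def)
    show "S \<noteq> {}" by (simp add: S_def)
    fix s w assume sw: "s \<in> S" "(s, w) \<in> E" "w \<notin> S"
    show "light s w" using lw0 out[OF sw] by blast
    show "w = w'" if w': "(s, w') \<in> E" "w' \<notin> S" for w' using out[OF sw] out[OF sw(1) w'] by blast
  qed
  then obtain p \<phi> where sc: "spine_coords V E S p \<phi>" by blast
  have pA: "p s = 0" if "s \<in> A" for s
    using spine_coords_root_nbrs[OF sc, of s] leafA[OF that] that by (auto simp: S_def split: if_splits)
  have vA: "v \<notin> A" using vB A by blast
  have cardV: "card V = p v + 4"
    using spine_coords_card[OF sc] A vA pA by (simp add: S_def)
  have vS: "v \<in> S" by (simp add: S_def)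
  define f :: "'a \<Rightarrow> int" where "f u = (if u \<in> A then -1 else int (THE h. h \<le> p v \<and> u = \<phi> v h))" for u
  have \<phi>A: "\<phi> v h \<notin> A" if "h \<le> p v" for h
  proof
    assume a: "\<phi> v h \<in> A"
    define w where "w = \<phi> v h"
    have w: "w \<in> A" "w \<in> S" using a by (auto simp: w_def S_def)
    have "\<phi> v h = \<phi> w 0" using spine_coords_zero[OF sc w(2)] w_def by simp
    then have "v = w" using spine_coords_inj[OF sc vS w(2) that, of 0] by simp
    then show False using w vA by simp
  qed
  have f\<phi>: "f (\<phi> v h) = int h" if "h \<le> p v" for h
  proof -
    have "(THE h'. h' \<le> p v \<and> \<phi> v h = \<phi> v h') = h"
      using that spine_coords_inj[OF sc vS vS] by (intro the_equality) auto
    then show ?thesis using \<phi>A[OF that] by (simp add: f_def)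
  qed
  have fv: "f v = 0" using f\<phi>[of 0] spine_coords_zero[OF sc vS] by simp
  have fA: "f u = -1" if "u \<in> A" for u using that by (simp add: f_def)
  have lip: "\<bar>f u - f w\<bar> \<le> 1" if uw: "(u, w) \<in> E" for u w
  proof (cases "u \<in> A")
    case True
    then have "w = v" using leafA uw by blast
    then show ?thesis using fA[OF True] fv by simp
  next
    case False
    have "u \<in> V" using uw inV by blast
    then obtain s h where s: "s \<in> S" "h \<le> p s" "u = \<phi> s h" using spine_coords_obtain[OF sc] by metis
    have sv: "s = v"
    proof (rule ccontr)
      assume "s \<noteq> v"
      then have "s \<in> A" using s by (simp add: S_def)
      then have "u = s" using s pA spine_coords_zero[OF sc] by simp
      then show False using \<open>s \<in> A\<close> False by simp
    qed
    show ?thesis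
    proof (cases h)
      case 0
      then have "u = v" using s sv spine_coords_zero[OF sc vS] by simp
      then have "w \<in> A \<or> w = w0" using uw B' A by auto
      moreover have "f w0 = 1"
      proof -
        have "w0 \<in> E `` {v} - S" using w0 B A vB by (auto simp: S_def)
        then have "0 < p v \<and> w0 = \<phi> v 1" using spine_coords_root_nbrs[OF sc vS] by (auto split: if_splits)
        then show ?thesis using f\<phi>[of 1] by simp
      qed
      ultimately show ?thesis using fA fv \<open>u = v\<close> by auto
    next
      case (Suc g)
      have "w \<in> E `` {\<phi> v (Suc g)}" using uw s Suc sv by simp
      then have "w = \<phi> v g \<or> Suc g < p v \<and> w = \<phi> v (Suc (Suc g))"
        using spine_coords_nbrs[OF sc vS, of g] s Suc sv by (auto split: if_splits)
      then show ?thesis using f\<phi>[of g] f\<phi>[of "Suc g"] f\<phi>[of "Suc (Suc g)"] s Suc sv by auto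
    qed
  qed
  obtain a where a: "a \<in> A" using A by fastforce
  then have aV: "a \<in> V" using A B inV by blast
  obtain d where d: "d \<le> D" "(a, \<phi> v (p v)) \<in> E ^^ d" using D[OF aV spine_coords_mem[OF sc vS order_refl]] by blast
  have "\<bar>f a - f (\<phi> v (p v))\<bar> \<le> int d" by (rule lipschitz_relpow[OF lip d(2)])
  then have "p v + 1 \<le> d" using fA[OF a] f\<phi>[of "p v"] by simp
  then show ?thesis using cardV d by simp
qed

end

lemma (in weighted_graph) acyclic_diameter:
  assumes t: "t = sqrt 2" and ne: "V \<noteq> {}" and acyclic: "\<nexists>L c. is_cycle E L c"
    and D: "\<And>u v. u \<in> V \<Longrightarrow> v \<in> V \<Longrightarrow> \<exists>d\<le>D. (u, v) \<in> E ^^ d"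
  shows "2 * card V \<le> 3 * D + 6"
proof (cases "\<exists>v\<in>V. card (E `` {v}) \<ge> 4")
  case True
  then have "card V \<le> D + 3" using deg4_diameter[OF D] by blast
  then show ?thesis by simp
next
  case False
  then have "\<And>v. v \<in> V \<Longrightarrow> card (E `` {v}) \<le> 3" by force
  from acyclic_induced_spine[OF ne acyclic this] obtain cs p \<phi>
    where sp: "induced_spine cs p \<phi>" and p0: "p (cs ! 0) = 0" "p (cs ! (length cs - 1)) = 0" by blast
  define M where "M = length cs - 1"
  define P where "P j = p (cs ! j)" for j
  have cs: "vpath cs" and sc: "spine_coords V E (set cs) p \<phi>" using sp by (auto simp: induced_spine_def)
  have len: "length cs = Suc M" using cs by (auto simp: vpath_def M_def)
  have d: "distinct cs" and csV: "set cs \<subseteq> V" and adj: "\<And>i. i < M \<Longrightarrow> (cs ! i, cs ! Suc i) \<in> E"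
    using cs len by (auto simp: vpath_def)
  have mem: "cs ! j \<in> set cs" "cs ! j \<in> V" if "j \<le> M" for j using that len csV by (auto simp: less_Suc_eq_le)
  have dist: "b - a + P a + P b \<le> D" if "a < b" "b \<le> M" for a b
    using induced_spine_distance[OF sp _ _ D] that len by (simp add: P_def)
  have card: "card V = Suc M + (\<Sum>i\<le>M. P i)"
    using induced_spine_card[OF sp] len by (simp add: P_def lessThan_Suc_atMost)
  have P0: "P 0 = 0" "P M = 0" using p0 by (auto simp: P_def M_def)
  \<comment> \<open>The value 0 beyond \<open>M\<close> makes \<open>first\<close> hold also for a
    spine with a single vertex.\<close>
  define z where "z j = (if j \<le> M then x (cs ! j) else 0)" for j
  define y where "y j = (\<Sum>w\<in>E `` {cs ! j} - set cs. x w)" for j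
  have cat: "caterpillar M z y P"
  proof
    show "0 < z j" if "j \<le> M" for j using xpos mem that by (simp add: z_def)
    show "sqrt 2 * (2 ^ P j - 1) * z j \<le> (2 ^ Suc (P j) - 1) * y j" if "0 < j" "j < M" for j
      using spine_tail_ratio[OF sc mem(1), of j] that t by (simp add: z_def y_def P_def)
    show "z (j - 1) + z (Suc j) + y j \<le> (sqrt 2 + 1 / sqrt 2) * z j" if j: "0 < j" "j < M" for j
    proof -
      let ?A = "{cs ! (j - 1), cs ! Suc j} \<union> (E `` {cs ! j} - set cs)"
      have e: "(cs ! j, cs ! (j - 1)) \<in> E" using adj[of "j - 1"] j symE by simp
      have "sum x ?A \<le> (t + 1 / t) * x (cs ! j)"
        using e adj[of j] mem j by (intro sum_le) auto
      moreover have "sum x ?A = z (j - 1) + z (Suc j) + y j"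
      proof -
        have "cs ! (j - 1) \<noteq> cs ! Suc j" using d j len by (simp add: nth_eq_iff_index_eq)
        moreover have "{cs ! (j - 1), cs ! Suc j} \<inter> (E `` {cs ! j} - set cs) = {}" using mem j by auto
        ultimately show ?thesis
          using nbr_finite[of "cs ! j"] j by (subst sum.union_disjoint) (auto simp: z_def y_def)
      qed
      ultimately show ?thesis using t j by (simp add: z_def)
    qed
    have l1: "x a \<le> (sqrt 2 + 1 / sqrt 2) * x b" if "(a, b) \<in> E" for a b
      using sum_le[of b "{a}"] that symE inV t by auto
    have l0: "x a \<le> (sqrt 2 + 1 / sqrt 2) * x a" if "a \<in> V" for a
    proof -
      have "1 \<le> sqrt 2 + 1 / sqrt 2" by (simp add: add_increasing2)
      then show ?thesis using xpos[OF that] mult_right_mono[of 1 "sqrt 2 + 1 / sqrt 2" "x a"] by simp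
    qed
    show "z (M - 1) \<le> (sqrt 2 + 1 / sqrt 2) * z M"
    proof (cases M)
      case 0
      then show ?thesis using l0 mem[of 0] by (simp add: z_def)
    next
      case (Suc k)
      then show ?thesis using l1[OF adj[of k]] by (simp add: z_def)
    qed
    show "z 1 \<le> (sqrt 2 + 1 / sqrt 2) * z 0"
    proof (cases M)
      case 0
      then show ?thesis using less_imp_le[OF xpos[OF mem(2)[of 0]]] by (simp add: z_def)
    next
      case (Suc k)
      then show ?thesis using l1[OF symE[OF adj[of 0]]] by (simp add: z_def)
    qed
  qed
  define B where "B = {j. j \<le> M \<and> 0 < P j}"
  have finB: "finite B" by (simp add: B_def)
  have sumB: "(\<Sum>i\<le>M. P i) = (\<Sum>i\<in>B. P i)"
    by (rule sum.mono_neutral_right) (auto simp: B_def)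
  have MD: "M \<le> D" using dist[of 0 M] P0 by (cases "M = 0") auto
  show ?thesis
  proof (cases "B = {}")
    case True
    then show ?thesis using card sumB MD by simp
  next
    case ne: False
    define i0 i1 where "i0 = Min B" and "i1 = Max B"
    have i: "i0 \<in> B" "i1 \<in> B" "i0 \<le> i1" using finB ne by (auto simp: i0_def i1_def)
    have i': "0 < i0" "i1 < M" "1 \<le> P i0" "1 \<le> P i1" using i P0 by (auto simp: B_def intro: Suc_leI gr0I le_neq_implies_less)
    have Bsub: "B \<subseteq> {i0..i1}" using finB by (auto simp: i0_def i1_def)
    show ?thesis
    proof (cases "i0 = i1")
      case True
      then have "B = {i0}" using Bsub i by auto
      then have n: "card V = Suc M + P i0" using card sumB by simp
      have "i0 + P i0 \<le> D" "M - i0 + P i0 \<le> D" using dist[of 0 i0] dist[of i0 M] i' P0 True by auto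
      then show ?thesis using n MD True i' by linarith
    next
      case False
      then have lt: "i0 < i1" using i by simp
      define s where "s = (\<Sum>j\<in>{i0<..<i1}. P j)"
      have "(\<Sum>i\<in>B. P i) = (\<Sum>i\<in>{i0..i1}. P i)"
        by (rule sum.mono_neutral_left) (use Bsub i in \<open>auto simp: B_def\<close>)
      also have "{i0..i1} = insert i0 (insert i1 {i0<..<i1})" using lt by auto
      finally have n: "card V = Suc M + P i0 + P i1 + s" using card sumB lt by (simp add: s_def)
      define c c' where "c = min i0 (P i0)" and "c' = min (M - i1) (P i1)"
      have "c + c' + 2 * s \<le> i1 - i0 + 4"
        unfolding s_def by (rule caterpillar.branch_distance[OF cat]) (use i' lt in \<open>auto simp: c_def c'_def\<close>)
      moreover have "i1 - i0 + P i0 + P i1 \<le> D" "i1 + P i1 \<le> D" "M - i0 + P i0 \<le> D"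
        using dist[of i0 i1] dist[of 0 i1] dist[of i0 M] i' lt P0 by auto
      \<comment> \<open>For each of the four choices of the two minima the bound on
        \<open>2 * card V\<close> is 6 plus three of the lengths bounded by \<open>D\<close>; for
        \<open>c = i0\<close> and \<open>c' = M - i1\<close> it is
        \<open>6 + M + 2 * (i1 - i0 + P i0 + P i1)\<close>.\<close>
      ultimately show ?thesis using n MD i' lt unfolding c_def c'_def by linarith
    qed
  qed
qed

section \<open>Spectral radius and diameter\<close>

context simple_graph
begin

text \<open>The eigenvector maximises the quadratic form of the adjacency matrix on the unit sphere.\<close>

lemma perron_eigenvector:
  assumes ne: "V \<noteq> {}"
  obtains x :: "'a \<Rightarrow> real" and \<mu> where "\<And>v. v \<in> V \<Longrightarrow> 0 < x v"
    "\<And>v. v \<in> V \<Longrightarrow> (\<Sum>w\<in>E `` {v}. x w) = \<mu> * x v"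
proof -
  define a :: "'a \<Rightarrow> 'a \<Rightarrow> real" where "a v w = (if (v, w) \<in> E then 1 else 0)" for v w
  have a_sym: "a v w = a w v" for v w using symE by (auto simp: a_def)
  have a_ge: "a v w \<ge> 0" for v w by (simp add: a_def)
  have nb: "(\<Sum>w\<in>V. a v w * f w) = (\<Sum>w\<in>E `` {v}. f w)" for v f
  proof -
    have "(\<Sum>w\<in>V. a v w * f w) = (\<Sum>w\<in>V. if w \<in> E `` {v} then f w else 0)"
      by (intro sum.cong) (auto simp: a_def)
    also have "\<dots> = (\<Sum>w\<in>V \<inter> E `` {v}. f w)" using fin by (simp add: sum.inter_restrict)
    also have "V \<inter> E `` {v} = E `` {v}" using inV by auto
    finally show ?thesis .
  qed
  define Q where "Q f = (\<Sum>v\<in>V. \<Sum>w\<in>V. a v w * f v * f w)" for f :: "'a \<Rightarrow> real"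
  define N where "N f = (\<Sum>v\<in>V. (f v)\<^sup>2)" for f :: "'a \<Rightarrow> real"
  \<comment> \<open>Pinning the entries outside \<open>V\<close> to 0 makes the product over the
    whole type compact.\<close>
  define I :: "'a \<Rightarrow> real set" where "I v = (if v \<in> V then {0..1} else {0})" for v
  define C where "C = PiE UNIV I \<inter> {f. N f = 1}"
  have contN: "continuous_on UNIV N" unfolding N_def by (intro continuous_intros) simp
  have contQ: "continuous_on UNIV Q" unfolding Q_def by (intro continuous_intros) simp_all
  have "compact (PiE UNIV I)"
    using compactin_PiE[of "\<lambda>_. euclideanreal" UNIV I]
    by (simp add: I_def euclidean_product_topology)
  moreover have "closed {f. N f = 1}"
    using contN by (intro closed_Collect_eq continuous_on_const)
  ultimately have "compact C" unfolding C_def by (rule compact_Int_closed)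
  moreover have "C \<noteq> {}"
  proof -
    obtain v0 where v0: "v0 \<in> V" using ne by blast
    define f where "f v = (if v = v0 then 1 else 0 :: real)" for v
    have "N f = (\<Sum>v\<in>V. if v = v0 then 1 else 0)" unfolding N_def f_def by (intro sum.cong) auto
    then have "N f = 1" using v0 fin by simp
    then have "f \<in> C" using v0 by (auto simp: C_def I_def f_def PiE_iff)
    then show ?thesis by blast
  qed
  ultimately obtain x where xC: "x \<in> C" and max: "\<And>f. f \<in> C \<Longrightarrow> Q f \<le> Q x"
    using continuous_attains_sup[of C Q] contQ continuous_on_subset by (metis subset_UNIV)
  define \<mu> where "\<mu> = Q x"
  have Nx: "N x = 1" using xC by (simp add: C_def)
  have x0: "x v \<ge> 0" for v
  proof -
    have "x v \<in> I v" using xC by (auto simp: C_def PiE_iff)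
    then show ?thesis by (auto simp: I_def split: if_splits)
  qed
  have Qhom: "Q (\<lambda>v. s * f v) = s\<^sup>2 * Q f" for s f
    by (simp add: Q_def sum_distrib_left power2_eq_square ac_simps)
  have Nhom: "N (\<lambda>v. s * f v) = s\<^sup>2 * N f" for s f
    by (simp add: N_def sum_distrib_left power_mult_distrib)
  have Nge: "N f \<ge> 0" for f by (simp add: N_def sum_nonneg)
  have bound: "Q f \<le> \<mu> * N f" for f
  proof (cases "N f = 0")
    case True
    then have "\<And>v. v \<in> V \<Longrightarrow> f v = 0" using fin by (simp add: N_def sum_nonneg_eq_0_iff)
    then have "Q f = 0" by (simp add: Q_def)
    then show ?thesis using True by simp
  next
    case False
    then have Nf: "N f > 0" using Nge[of f] by simp
    define s where "s = 1 / sqrt (N f)"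
    have s: "s > 0" "s\<^sup>2 * N f = 1" using Nf by (auto simp: s_def power_divide)
    define g where "g v = (if v \<in> V then s * \<bar>f v\<bar> else 0)" for v
    have Ng: "N g = 1"
    proof -
      have "N g = N (\<lambda>v. s * \<bar>f v\<bar>)" unfolding N_def by (intro sum.cong) (auto simp: g_def)
      also have "\<dots> = s\<^sup>2 * N (\<lambda>v. \<bar>f v\<bar>)" by (rule Nhom)
      also have "N (\<lambda>v. \<bar>f v\<bar>) = N f" by (simp add: N_def)
      finally show ?thesis using s by simp
    qed
    have "g v \<le> 1" if "v \<in> V" for v
    proof -
      have "(g v)\<^sup>2 \<le> N g" unfolding N_def using that fin by (intro member_le_sum) auto
      then show ?thesis using Ng by (simp add: abs_square_le_1 abs_le_iff)
    qed
    then have "g \<in> C" using Ng s by (auto simp: C_def I_def PiE_iff g_def)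
    then have "Q g \<le> \<mu>" using max by (simp add: \<mu>_def)
    moreover have "Q g = s\<^sup>2 * Q (\<lambda>v. \<bar>f v\<bar>)"
    proof -
      have "Q g = Q (\<lambda>v. s * \<bar>f v\<bar>)" unfolding Q_def by (intro sum.cong) (auto simp: g_def)
      then show ?thesis by (simp only: Qhom)
    qed
    \<comment> \<open>Absolute values do not decrease \<open>Q\<close>, so the maximum over
      nonnegative unit vectors controls all vectors.\<close>
    moreover have "Q f \<le> Q (\<lambda>v. \<bar>f v\<bar>)"
      unfolding Q_def
    proof (intro sum_mono)
      fix v w
      have "f v * f w \<le> \<bar>f v\<bar> * \<bar>f w\<bar>" by (metis abs_ge_self abs_mult)
      then show "a v w * f v * f w \<le> a v w * \<bar>f v\<bar> * \<bar>f w\<bar>"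
        using a_ge[of v w] by (simp add: mult.assoc mult_left_mono)
    qed
    ultimately have "s\<^sup>2 * Q f \<le> \<mu>" using mult_left_mono[of "Q f" "Q (\<lambda>v. \<bar>f v\<bar>)" "s\<^sup>2"] by simp
    then have "s\<^sup>2 * Q f \<le> s\<^sup>2 * (\<mu> * N f)" using s(2) by (simp add: ac_simps)
    then show ?thesis using s by simp
  qed
  \<comment> \<open>The residual of the eigenvalue equation: moving from \<open>x\<close> in its
    direction raises \<open>Q - \<mu> * N\<close> by \<open>2 * e * N r\<close> to first order, so
    maximality forces it to vanish on \<open>V\<close>.\<close>
  define r where "r v = (\<Sum>w\<in>E `` {v}. x w) - \<mu> * x v" for v
  have expand: "Q (\<lambda>v. x v + e * r v) - \<mu> * N (\<lambda>v. x v + e * r v) =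
      2 * e * N r + e\<^sup>2 * (Q r - \<mu> * N r)" for e
  proof -
    define X where "X = (\<Sum>v\<in>V. \<Sum>w\<in>V. a v w * x v * r w)"
    have X': "X = (\<Sum>v\<in>V. \<Sum>w\<in>V. a v w * r v * x w)"
      unfolding X_def by (subst sum.swap) (simp add: a_sym ac_simps)
    also have "\<dots> = (\<Sum>v\<in>V. r v * (\<Sum>w\<in>V. a v w * x w))" by (simp add: sum_distrib_left ac_simps)
    finally have X: "X = (\<Sum>v\<in>V. r v * (\<Sum>w\<in>E `` {v}. x w))" unfolding nb .
    have "Q (\<lambda>v. x v + e * r v) = (\<Sum>v\<in>V. \<Sum>w\<in>V. a v w * x v * x w + e * (a v w * x v * r w)
        + e * (a v w * r v * x w) + e\<^sup>2 * (a v w * r v * r w))"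
      unfolding Q_def by (intro sum.cong refl) (simp add: algebra_simps power2_eq_square)
    also have "\<dots> = Q x + e * X + e * X + e\<^sup>2 * Q r"
      by (simp add: sum.distrib Q_def X_def[symmetric] X'[symmetric] sum_distrib_left[symmetric])
    finally have q: "Q (\<lambda>v. x v + e * r v) = Q x + 2 * e * X + e\<^sup>2 * Q r" by simp
    have "N (\<lambda>v. x v + e * r v) = (\<Sum>v\<in>V. (x v)\<^sup>2 + 2 * e * (r v * x v) + e\<^sup>2 * (r v)\<^sup>2)"
      unfolding N_def by (intro sum.cong refl) (simp add: algebra_simps power2_eq_square)
    also have "\<dots> = N x + 2 * e * (\<Sum>v\<in>V. r v * x v) + e\<^sup>2 * N r"
      by (simp add: sum.distrib N_def sum_distrib_left)
    finally have n: "N (\<lambda>v. x v + e * r v) = N x + 2 * e * (\<Sum>v\<in>V. r v * x v) + e\<^sup>2 * N r" .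
    have "N r = (\<Sum>v\<in>V. r v * (\<Sum>w\<in>E `` {v}. x w) - \<mu> * (r v * x v))"
      unfolding N_def by (intro sum.cong refl) (simp add: r_def algebra_simps power2_eq_square)
    then have R: "N r = X - \<mu> * (\<Sum>v\<in>V. r v * x v)" by (simp add: X sum_subtractf sum_distrib_left)
    show ?thesis unfolding q n R using Nx by (simp add: \<mu>_def algebra_simps)
  qed
  have "N r = 0"
  proof (rule ccontr)
    assume "N r \<noteq> 0"
    then have Nr: "N r > 0" using Nge[of r] by simp
    define k where "k = Q r - \<mu> * N r"
    \<comment> \<open>Small enough that \<open>e * \<bar>k\<bar> < N r\<close>.\<close>
    define e where "e = N r / (\<bar>k\<bar> + 1)"
    have e: "e > 0" "e * (\<bar>k\<bar> + 1) = N r" using Nr by (auto simp: e_def add_nonneg_pos)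
    have "2 * e * N r + e\<^sup>2 * k \<le> 0" using bound[of "\<lambda>v. x v + e * r v"] expand[of e] by (simp add: k_def)
    then have "e * (2 * N r + e * k) \<le> 0" by (simp add: algebra_simps power2_eq_square)
    then have "2 * N r + e * k \<le> 0" using e by (simp add: mult_le_0_iff)
    moreover have "e * (- \<bar>k\<bar>) \<le> e * k" using e by (intro mult_left_mono) auto
    ultimately show False using e Nr by (simp add: algebra_simps)
  qed
  then have rz: "r v = 0" if "v \<in> V" for v using that fin by (simp add: N_def sum_nonneg_eq_0_iff)
  have eig: "(\<Sum>w\<in>E `` {v}. x w) = \<mu> * x v" if "v \<in> V" for v using rz[OF that] by (simp add: r_def)
  have "0 < x v" if v: "v \<in> V" for v
  proof (rule ccontr)
    assume "\<not> 0 < x v"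
    then have xv: "x v = 0" using x0[of v] by simp
    \<comment> \<open>The neighbours of a zero of a nonnegative eigenvector are zeros too, since
      their values sum to 0; connectivity does the rest.\<close>
    have "V \<subseteq> {u \<in> V. x u = 0}"
    proof (rule closed_imp_all)
      show "v \<in> {u \<in> V. x u = 0}" "v \<in> V" using v xv by auto
      fix u w assume u: "u \<in> {u \<in> V. x u = 0}" and uw: "(u, w) \<in> E"
      then have "(\<Sum>w\<in>E `` {u}. x w) = 0" using eig by simp
      then have "x w = 0" using x0 nbr_finite uw by (subst (asm) sum_nonneg_eq_0_iff) auto
      then show "w \<in> {u \<in> V. x u = 0}" using uw inV by auto
    qed
    then have "N x = 0" unfolding N_def by (intro sum.neutral) auto
    then show False using Nx by simp
  qed
  then show ?thesis using that eig by blast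
qed

text \<open>Compare \<open>\<bar>f\<bar>\<close> with the least multiple \<open>c * x\<close> that
  dominates it, at a vertex where the two agree.\<close>

lemma supersolution_eigenvalue_le:
  fixes x f :: "'a \<Rightarrow> real"
  assumes x: "\<And>v. v \<in> V \<Longrightarrow> 0 < x v" "\<And>v. v \<in> V \<Longrightarrow> (\<Sum>w\<in>E `` {v}. x w) \<le> l * x v"
    and f: "\<And>v. v \<in> V \<Longrightarrow> (\<Sum>w\<in>E `` {v}. f w) = k * f v" and u: "u \<in> V" "f u \<noteq> 0"
  shows "k \<le> l"
proof -
  obtain v where v: "v \<in> V" and Mx: "Max ((\<lambda>v. \<bar>f v\<bar> / x v) ` V) = \<bar>f v\<bar> / x v"
    using obtains_MAX[OF fin, of "\<lambda>v. \<bar>f v\<bar> / x v"] u by blast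
  define c where "c = \<bar>f v\<bar> / x v"
  have le: "\<bar>f w\<bar> \<le> c * x w" if "w \<in> V" for w
  proof -
    have "\<bar>f w\<bar> / x w \<le> c" unfolding c_def Mx[symmetric] using that fin by (intro Max_ge) auto
    then show ?thesis using x(1)[OF that] by (simp add: field_simps)
  qed
  have "c > 0"
  proof -
    have "0 < \<bar>f u\<bar>" using u by simp
    then have "0 < c * x u" using le[OF u(1)] by linarith
    then show ?thesis using x(1)[OF u(1)] by (simp add: zero_less_mult_iff)
  qed
  have fv: "\<bar>f v\<bar> = c * x v" using x(1)[OF v] by (simp add: c_def)
  have "k * \<bar>f v\<bar> \<le> \<bar>k * f v\<bar>" by (simp add: abs_mult mult_right_mono)
  also have "\<dots> = \<bar>\<Sum>w\<in>E `` {v}. f w\<bar>" using f[OF v] by simp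
  also have "\<dots> \<le> (\<Sum>w\<in>E `` {v}. \<bar>f w\<bar>)" by (rule sum_abs)
  also have "\<dots> \<le> (\<Sum>w\<in>E `` {v}. c * x w)" using le inV by (intro sum_mono) auto
  also have "\<dots> = c * (\<Sum>w\<in>E `` {v}. x w)" by (simp add: sum_distrib_left)
  also have "\<dots> \<le> c * (l * x v)" using x(2)[OF v] \<open>c > 0\<close> by (intro mult_left_mono) auto
  also have "\<dots> = l * \<bar>f v\<bar>" by (simp add: fv)
  finally have "k * \<bar>f v\<bar> \<le> l * \<bar>f v\<bar>" .
  moreover have "\<bar>f v\<bar> > 0" using fv \<open>c > 0\<close> x(1)[OF v] by simp
  ultimately show ?thesis by simp
qed

end

text \<open>Powers of the arc relation replace extended real distances; the second part only asks
  for a pair that no shorter walk joins.\<close>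

definition has_diameter :: "'a set \<Rightarrow> 'a rel \<Rightarrow> nat \<Rightarrow> bool" where
  "has_diameter V E D \<longleftrightarrow> (\<forall>u\<in>V. \<forall>v\<in>V. \<exists>d\<le>D. (u, v) \<in> E ^^ d) \<and>
     (\<exists>u\<in>V. \<exists>v\<in>V. \<forall>d<D. (u, v) \<notin> E ^^ d)"

section \<open>Walks, distances and the diameter\<close>

context pair_wf_digraph
begin

lemma awalk_imp_relpow: "awalk u es v \<Longrightarrow> (u, v) \<in> parcs G ^^ length es"
proof (induction es arbitrary: u)
  case Nil
  then show ?case by (simp add: awalk_Nil_iff)
next
  case (Cons e es)
  then have "e \<in> parcs G" "u = fst e" "awalk (snd e) es v" by (auto simp: awalk_Cons_iff)
  then show ?case using Cons.IH[of "snd e"] relpow_Suc_I2[of u "snd e" "parcs G"] by (cases e) auto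
qed

lemma relpow_imp_awalk: "(u, v) \<in> parcs G ^^ d \<Longrightarrow> u \<in> pverts G \<Longrightarrow> \<exists>es. awalk u es v \<and> length es = d"
proof (induction d arbitrary: u)
  case 0
  then show ?case by (auto simp: awalk_Nil_iff intro: exI[of _ "[]"])
next
  case (Suc d)
  then obtain w where w: "(u, w) \<in> parcs G" "(w, v) \<in> parcs G ^^ d" by (meson relpow_Suc_E2)
  then have "w \<in> pverts G" using in_arcsD2 by auto
  then obtain es where "awalk w es v" "length es = d" using Suc.IH w by blast
  then have "awalk u ((u, w) # es) v \<and> length ((u, w) # es) = Suc d" using w by (simp add: awalk_Cons_iff)
  then show ?case by blast
qed

lemma awalk_cost_one: "awalk_cost (\<lambda>_. 1) es = real (length es)"
  by (induction es) auto

lemma graph_dist_le: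
  "(u, v) \<in> parcs G ^^ d \<Longrightarrow> u \<in> pverts G \<Longrightarrow> graph_dist G u v \<le> ereal (real d)"
  using relpow_imp_awalk[of u v d] min_cost_le_walk_cost[of u _ v "\<lambda>_. 1"] awalk_cost_one
  unfolding graph_dist_def by metis

end

context pair_graph
begin

lemma graph_dist_attained:
  assumes "u \<rightarrow>\<^sup>*\<^bsub>with_proj G\<^esub> v"
  obtains d where "(u, v) \<in> parcs G ^^ d" "graph_dist G u v = ereal (real d)"
proof -
  obtain es where "apath u es v" "\<mu> (\<lambda>_. 1) u v = awalk_cost (\<lambda>_. 1) es"
    using min_cost_awalk[OF assms, of "\<lambda>_. 1"] by auto
  then show ?thesis
    using that[of "length es"] awalk_imp_relpow[of u es v] awalk_cost_one[of es]
    by (auto simp: graph_dist_def apath_def)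
qed

lemma reachable_relpow: "u \<rightarrow>\<^sup>*\<^bsub>with_proj G\<^esub> v \<longleftrightarrow> u \<in> pverts G \<and> (\<exists>d. (u, v) \<in> parcs G ^^ d)"
  using reachable_awalk[of u v] awalk_imp_relpow[of u _ v] relpow_imp_awalk[of u v]
    reachable_in_verts(1)[of u v] by (metis with_proj_simps(1))

lemma connected_iff: "Digraph_Component.connected (with_proj G) \<longleftrightarrow>
    pverts G \<noteq> {} \<and> (\<forall>u\<in>pverts G. \<forall>v\<in>pverts G. \<exists>d. (u, v) \<in> parcs G ^^ d)"
proof -
  have "Digraph_Component.connected (with_proj G) \<longleftrightarrow> strongly_connected (with_proj G)"
    by (auto simp: Digraph_Component.connected_def strongly_connected_def reachable_mk_symmetric_eq[OF sym_arcs])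
  then show ?thesis by (auto simp: strongly_connected_def reachable_relpow)
qed

lemma graph_diameter_eq:
  assumes conn: "\<And>u v. u \<in> pverts G \<Longrightarrow> v \<in> pverts G \<Longrightarrow> u \<rightarrow>\<^sup>*\<^bsub>with_proj G\<^esub> v" and ne: "pverts G \<noteq> {}"
  shows "graph_diameter G = ereal (real D) \<longleftrightarrow> has_diameter (pverts G) (parcs G) D"
proof -
  let ?V = "pverts G" and ?E = "parcs G"
  have le_iff: "graph_dist G u v \<le> ereal (real D) \<longleftrightarrow> (\<exists>d\<le>D. (u, v) \<in> ?E ^^ d)" if uv: "u \<in> ?V" "v \<in> ?V" for u v D
  proof
    assume a: "graph_dist G u v \<le> ereal (real D)"
    obtain d where "(u, v) \<in> ?E ^^ d" "graph_dist G u v = ereal (real d)" using graph_dist_attained[OF conn[OF uv]] .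
    then show "\<exists>d\<le>D. (u, v) \<in> ?E ^^ d" using a by auto
  next
    assume "\<exists>d\<le>D. (u, v) \<in> ?E ^^ d"
    then obtain d where d: "d \<le> D" "(u, v) \<in> ?E ^^ d" by blast
    have "graph_dist G u v \<le> ereal (real d)" by (rule graph_dist_le[OF d(2) uv(1)])
    also have "\<dots> \<le> ereal (real D)" using d by simp
    finally show "graph_dist G u v \<le> ereal (real D)" .
  qed
  have diam_le: "graph_diameter G \<le> ereal (real D) \<longleftrightarrow> (\<forall>u\<in>?V. \<forall>v\<in>?V. \<exists>d\<le>D. (u, v) \<in> ?E ^^ d)" for D
    unfolding graph_diameter_def SUP_le_iff using le_iff by simp
  show ?thesis
  proof
    assume eq: "graph_diameter G = ereal (real D)"
    have 1: "\<forall>u\<in>?V. \<forall>v\<in>?V. \<exists>d\<le>D. (u, v) \<in> ?E ^^ d" using diam_le[of D] eq by simp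
    have "\<exists>u\<in>?V. \<exists>v\<in>?V. \<forall>d<D. (u, v) \<notin> ?E ^^ d"
    proof (cases D)
      case 0
      then show ?thesis using ne by auto
    next
      case (Suc D')
      show ?thesis
      proof (rule ccontr)
        assume "\<not> ?thesis"
        then have "\<forall>u\<in>?V. \<forall>v\<in>?V. \<exists>d\<le>D'. (u, v) \<in> ?E ^^ d" using Suc by (meson less_Suc_eq_le)
        then have "graph_diameter G \<le> ereal (real D')" using diam_le by blast
        then show False using eq Suc by simp
      qed
    qed
    then show "has_diameter ?V ?E D" using 1 by (simp add: has_diameter_def)
  next
    assume hd: "has_diameter ?V ?E D"
    then have "graph_diameter G \<le> ereal (real D)" using diam_le by (simp add: has_diameter_def)
    moreover have "ereal (real D) \<le> graph_diameter G"
    proof -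
      obtain u v where uv: "u \<in> ?V" "v \<in> ?V" "\<forall>d<D. (u, v) \<notin> ?E ^^ d" using hd by (auto simp: has_diameter_def)
      obtain d where d: "(u, v) \<in> ?E ^^ d" "graph_dist G u v = ereal (real d)" using graph_dist_attained[OF conn[OF uv(1,2)]] .
      then have "D \<le> d" using uv(3) not_le by blast
      then have "ereal (real D) \<le> graph_dist G u v" using d by simp
      also have "\<dots> \<le> (SUP v\<in>?V. graph_dist G u v)" using uv by (intro SUP_upper)
      also have "\<dots> \<le> graph_diameter G" unfolding graph_diameter_def using uv by (intro SUP_upper)
      finally show ?thesis .
    qed
    ultimately show "graph_diameter G = ereal (real D)" by simp
  qed
qed

end

lemma connected_graph_with_iff:
  assumes "pair_graph G"
  shows "connected_graph_with n D G \<longleftrightarrow>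
    pverts G \<noteq> {} \<and> card (pverts G) = n \<and> has_diameter (pverts G) (parcs G) D"
proof -
  interpret pair_graph G by fact
  have c: "Digraph_Component.connected (with_proj G)" if "pverts G \<noteq> {}" "has_diameter (pverts G) (parcs G) D"
    using that unfolding connected_iff has_diameter_def by blast
  have r: "u \<rightarrow>\<^sup>*\<^bsub>with_proj G\<^esub> v" if "Digraph_Component.connected (with_proj G)" "u \<in> pverts G" "v \<in> pverts G" for u v
    using that unfolding connected_iff reachable_relpow by blast
  show ?thesis
    unfolding connected_graph_with_def
    using assms c r graph_diameter_eq[of D] connected_iff by blast
qed

lemma simple_graph_connected_graph_with:
  assumes "connected_graph_with n D G"
  shows "simple_graph (pverts G) (parcs G)"
proof -
  interpret pair_graph G using assms by (simp add: connected_graph_with_def)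
  have hd: "has_diameter (pverts G) (parcs G) D"
    using assms connected_graph_with_iff[OF pair_graph_axioms] by blast
  show ?thesis
  proof
    show "finite (pverts G)" by simp
    show "parcs G \<subseteq> pverts G \<times> pverts G" using in_arcsD1 in_arcsD2 by auto
    show "(v, u) \<in> parcs G" if "(u, v) \<in> parcs G" for u v
      using that sym_arcs by (auto simp: symmetric_def dest: symD)
    show "(u, u) \<notin> parcs G" for u using no_loops[of "(u, u)"] by auto
    show "(u, v) \<in> (parcs G)\<^sup>*" if "u \<in> pverts G" "v \<in> pverts G" for u v
      using hd that relpow_imp_rtrancl by (fastforce simp: has_diameter_def)
  qed
qed

section \<open>The spectral radius through positive vectors\<close>

lemma spectrum_adjacency_matrix_iff:
  assumes "simple_graph (pverts G) (parcs G)"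
  shows "k \<in> spectrum (adjacency_matrix (vertex_list G) G) \<longleftrightarrow>
    (\<exists>f. (\<exists>u\<in>pverts G. f u \<noteq> 0) \<and> (\<forall>u\<in>pverts G. (\<Sum>w\<in>parcs G `` {u}. f w) = k * f u))"
proof -
  interpret simple_graph "pverts G" "parcs G" by fact
  have "{w \<in> pverts G. (u, w) \<in> parcs G} = parcs G `` {u}" for u using inV by auto
  then show ?thesis
    using eigenvalue_adjacency_matrix_iff[OF vertex_list(1)[OF fin], of G k] vertex_list(2)[OF fin]
    by (simp add: spectrum_def)
qed

lemma finite_spectrum_adjacency_matrix: "finite (spectrum (adjacency_matrix vs G))"
  using card_finite_spectrum(1)[of "adjacency_matrix vs G" "length vs"] by (simp add: adjacency_matrix_def)

text \<open>An eigenvalue with a positive eigenvector is the largest one, by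
  \<open>supersolution_eigenvalue_le\<close>.\<close>

lemma graph_spectral_radius_eigenvector:
  assumes "simple_graph (pverts G) (parcs G)" "pverts G \<noteq> {}"
  obtains x where "\<And>v. v \<in> pverts G \<Longrightarrow> 0 < x v"
    "\<And>v. v \<in> pverts G \<Longrightarrow> (\<Sum>w\<in>parcs G `` {v}. x w) = graph_spectral_radius G * x v"
proof -
  interpret simple_graph "pverts G" "parcs G" by fact
  obtain x :: "'a \<Rightarrow> real" and \<mu> where x: "\<And>v. v \<in> pverts G \<Longrightarrow> 0 < x v"
    "\<And>v. v \<in> pverts G \<Longrightarrow> (\<Sum>w\<in>parcs G `` {v}. x w) = \<mu> * x v"
    using perron_eigenvector[OF assms(2)] by blast
  obtain u where u: "u \<in> pverts G" using assms by blast
  then have "x u \<noteq> 0" using x(1) by force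
  then have "\<mu> \<in> spectrum (adjacency_matrix (vertex_list G) G)"
    unfolding spectrum_adjacency_matrix_iff[OF assms(1)] using u x(2) by blast
  moreover have "k \<le> \<mu>" if k: "k \<in> spectrum (adjacency_matrix (vertex_list G) G)" for k
  proof -
    obtain f v where "v \<in> pverts G" "f v \<noteq> 0" "\<And>u. u \<in> pverts G \<Longrightarrow> (\<Sum>w\<in>parcs G `` {u}. f w) = k * f u"
      using k unfolding spectrum_adjacency_matrix_iff[OF assms(1)] by blast
    then show ?thesis using supersolution_eigenvalue_le[of x \<mu> f k v] x by simp
  qed
  ultimately have "graph_spectral_radius G = \<mu>"
    unfolding graph_spectral_radius_def using finite_spectrum_adjacency_matrix by (intro Max_eqI) auto
  then show ?thesis using that x by blast
qed

lemma graph_spectral_radius_le: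
  assumes sg: "simple_graph (pverts G) (parcs G)" "pverts G \<noteq> {}"
    and x: "\<And>v. v \<in> pverts G \<Longrightarrow> 0 < x v" "\<And>v. v \<in> pverts G \<Longrightarrow> (\<Sum>w\<in>parcs G `` {v}. x w) \<le> l * x v"
  shows "graph_spectral_radius G \<le> l"
proof -
  interpret simple_graph "pverts G" "parcs G" by fact
  obtain y where y: "\<And>v. v \<in> pverts G \<Longrightarrow> 0 < y v"
    "\<And>v. v \<in> pverts G \<Longrightarrow> (\<Sum>w\<in>parcs G `` {v}. y w) = graph_spectral_radius G * y v"
    using graph_spectral_radius_eigenvector[OF sg] by blast
  obtain u where u: "u \<in> pverts G" using sg by blast
  then show ?thesis using supersolution_eigenvalue_le[OF x y(2) u] y(1)[OF u] by simp
qed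

lemma digraph_isoI:
  assumes "pair_wf_digraph G" "pair_wf_digraph H" "bij_betw f (pverts G) (pverts H)"
    and "\<And>u v. u \<in> pverts G \<Longrightarrow> v \<in> pverts G \<Longrightarrow> (u, v) \<in> parcs G \<longleftrightarrow> (f u, f v) \<in> parcs H"
  shows "digraph_iso (with_proj G) (with_proj H)"
proof -
  interpret G: pair_wf_digraph G by fact
  interpret H: pair_wf_digraph H by fact
  have inj: "inj_on f (pverts G)" and im: "f ` pverts G = pverts H" using assms(3) by (auto simp: bij_betw_def)
  define h where "h = \<lparr>iso_verts = f, iso_arcs = (\<lambda>(u, v). (f u, f v)), iso_head = snd, iso_tail = fst\<rparr>"
  have G: "u \<in> pverts G" "v \<in> pverts G" if "(u, v) \<in> parcs G" for u v
    using that G.in_arcsD1 G.in_arcsD2 by auto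
  have H: "u \<in> pverts H" "v \<in> pverts H" if "(u, v) \<in> parcs H" for u v
    using that H.in_arcsD1 H.in_arcsD2 by auto
  have "pre_digraph.digraph_isomorphism (with_proj G) h"
    unfolding pre_digraph.digraph_isomorphism_def
    using G.wf_digraph_axioms inj G by (auto simp: h_def inj_on_def)
  moreover have "(\<lambda>(u, v). (f u, f v)) ` parcs G = parcs H"
  proof
    have "(f u, f v) \<in> parcs H" if "(u, v) \<in> parcs G" for u v
      using assms(4)[OF G[OF that]] that by simp
    then show "(\<lambda>(u, v). (f u, f v)) ` parcs G \<subseteq> parcs H" by auto
    show "parcs H \<subseteq> (\<lambda>(u, v). (f u, f v)) ` parcs G"
    proof
      fix e assume e: "e \<in> parcs H"
      obtain a b where ab: "e = (a, b)" by (cases e)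
      then obtain u v where "u \<in> pverts G" "v \<in> pverts G" "a = f u" "b = f v" using H[of a b] e im by blast
      then show "e \<in> (\<lambda>(u, v). (f u, f v)) ` parcs G" using assms(4)[of u v] e ab by force
    qed
  qed
  then have "with_proj H = app_iso h (with_proj G)"
    using im by (simp add: app_iso_def h_def with_proj_def)
  ultimately show ?thesis unfolding digraph_iso_def by blast
qed

section \<open>The graph \<open>H\<close>\<close>

text \<open>In coordinates adjacency depends only on \<open>L\<close>, which is what the isomorphism
  uses. Absence of chords is a premise because it has two sources: weights for a competitor, the
  construction for \<open>H\<close>.\<close>

lemma (in simple_graph) cycle_edge_iff:
  assumes c: "is_cycle E L c" and sc: "spine_coords V E (range c) p \<phi>"
    and chord: "\<And>i w. (c (Suc i), w) \<in> E \<Longrightarrow> w \<in> range c \<Longrightarrow> w = c i \<or> w = c (Suc (Suc i))"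
    and i: "i < L" "h \<le> p (c i)" and j: "j < L" "h' \<le> p (c j)"
  shows "(\<phi> (c i) h, \<phi> (c j) h') \<in> E \<longleftrightarrow>
    i = j \<and> (h' = Suc h \<or> h = Suc h') \<or> h = 0 \<and> h' = 0 \<and> (j = Suc i mod L \<or> i = Suc j mod L)"
proof -
  have eq: "\<phi> (c i) h = \<phi> (c j) h' \<longleftrightarrow> i = j \<and> h = h'"
    if "i < L" "j < L" "h \<le> p (c i)" "h' \<le> p (c j)" for i j h h'
    using spine_coords_inj[OF sc, of "c i" "c j" h h'] inj_onD[OF is_cycle_inj[OF c], of i j] that by auto
  have tail: "(\<phi> (c i) (Suc g), \<phi> (c j) h') \<in> E \<longleftrightarrow> i = j \<and> (h' = Suc (Suc g) \<or> h' = g)"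
    if "i < L" "j < L" "Suc g \<le> p (c i)" "h' \<le> p (c j)" for i j g h'
  proof -
    have "(\<phi> (c i) (Suc g), \<phi> (c j) h') \<in> E \<longleftrightarrow> \<phi> (c j) h' \<in> E `` {\<phi> (c i) (Suc g)}" by simp
    also have "\<dots> \<longleftrightarrow> \<phi> (c j) h' = \<phi> (c i) g \<or> Suc g < p (c i) \<and> \<phi> (c j) h' = \<phi> (c i) (Suc (Suc g))"
      using spine_coords_nbrs[OF sc, of "c i" g] that by auto
    also have "\<dots> \<longleftrightarrow> i = j \<and> (h' = Suc (Suc g) \<or> h' = g)"
      using eq[of j i h' g] eq[of j i h' "Suc (Suc g)"] that by auto
    finally show ?thesis .
  qed
  have sym_iff: "(u, v) \<in> E \<longleftrightarrow> (v, u) \<in> E" for u v using symE by blast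
  consider (a) g where "h = Suc g" | (b) g where "h = 0" "h' = Suc g" | (c) "h = 0" "h' = 0"
    by (cases h; cases h') auto
  then show ?thesis
  proof cases
    case a
    then show ?thesis using tail[of i j g h'] i j by auto
  next
    case b
    then show ?thesis using tail[of j i g h] i j sym_iff[of "\<phi> (c i) h"] by auto
  next
    case c0: c
    have z: "\<phi> (c i) h = c i" "\<phi> (c j) h' = c j" using c0 spine_coords_zero[OF sc] by auto
    have idx: "c a = c b \<longleftrightarrow> a mod L = b mod L" for a b using c by (simp add: is_cycle_def)
    have E: "(c a, c (Suc a)) \<in> E" for a using c by (simp add: is_cycle_def)
    have "(c i, c j) \<in> E \<longleftrightarrow> j = Suc i mod L \<or> i = Suc j mod L"
    proof
      assume e: "(c i, c j) \<in> E"
      obtain i' where i': "c i = c (Suc i')" using is_cycle_pred[OF c, of "c i"] by blast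
      then have "c j = c i' \<or> c j = c (Suc (Suc i'))" using chord[of i' "c j"] e by auto
      then have "c (Suc j) = c i \<or> c j = c (Suc i)"
        using i' is_cycle_Suc_eq_iff[OF c] by metis
      then show "j = Suc i mod L \<or> i = Suc j mod L" using idx i j by auto
    next
      assume "j = Suc i mod L \<or> i = Suc j mod L"
      then have "c j = c (Suc i) \<or> c i = c (Suc j)" using is_cycle_mod[OF c] by auto
      then show "(c i, c j) \<in> E" using E symE by metis
    qed
    moreover have "\<not> (i = j \<and> (h' = Suc h \<or> h = Suc h'))" using c0 by simp
    ultimately show ?thesis using z c0 by simp
  qed
qed

lemma cycle_index_bij:
  assumes c: "is_cycle E L c" and sc: "spine_coords V E (range c) p \<phi>"
  shows "bij_betw (\<lambda>(i, h). \<phi> (c i) h) (SIGMA i:{..<L}. {..p (c i)}) V"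
  unfolding bij_betw_def
proof
  show "inj_on (\<lambda>(i, h). \<phi> (c i) h) (SIGMA i:{..<L}. {..p (c i)})"
  proof (rule inj_onI)
    fix a b assume a: "a \<in> (SIGMA i:{..<L}. {..p (c i)})" and b: "b \<in> (SIGMA i:{..<L}. {..p (c i)})"
      and eq: "(case a of (i, h) \<Rightarrow> \<phi> (c i) h) = (case b of (i, h) \<Rightarrow> \<phi> (c i) h)"
    obtain i h j h' where ab: "a = (i, h)" "b = (j, h')" by (cases a, cases b)
    then have "c i = c j \<and> h = h'"
      using spine_coords_inj[OF sc, of "c i" "c j" h h'] a b eq by auto
    then show "a = b" using inj_onD[OF is_cycle_inj[OF c], of i j] a b ab by auto
  qed
  show "(\<lambda>(i, h). \<phi> (c i) h) ` (SIGMA i:{..<L}. {..p (c i)}) = V" (is "?I = V")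
  proof
    show "?I \<subseteq> V" using spine_coords_mem[OF sc] by auto
    show "V \<subseteq> ?I"
    proof
      fix v assume "v \<in> V"
      then obtain s h where s: "s \<in> range c" "h \<le> p s" "v = \<phi> s h" using spine_coords_obtain[OF sc] by blast
      then obtain i where "i < L" "s = c i" using is_cycle_range[OF c] by auto
      then show "v \<in> ?I" using s by (auto intro!: image_eqI[of _ _ "(i, h)"])
    qed
  qed
qed

lemma cycle_spines_isomorphic:
  assumes G: "simple_graph V E" "is_cycle E L c" "spine_coords V E (range c) p \<phi>"
      "\<And>i w. (c (Suc i), w) \<in> E \<Longrightarrow> w \<in> range c \<Longrightarrow> w = c i \<or> w = c (Suc (Suc i))"
    and H: "simple_graph V' E'" "is_cycle E' L c'" "spine_coords V' E' (range c') p' \<phi>'"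
      "\<And>i w. (c' (Suc i), w) \<in> E' \<Longrightarrow> w \<in> range c' \<Longrightarrow> w = c' i \<or> w = c' (Suc (Suc i))"
    and p: "\<And>i. i < L \<Longrightarrow> p (c i) = p' (c' i)"
  obtains f where "bij_betw f V V'" "\<And>u v. u \<in> V \<Longrightarrow> v \<in> V \<Longrightarrow> (u, v) \<in> E \<longleftrightarrow> (f u, f v) \<in> E'"
proof -
  define I where "I = (SIGMA i:{..<L}. {..p (c i)})"
  define \<psi> where "\<psi> = (\<lambda>(i, h). \<phi> (c i) h)"
  define \<psi>' where "\<psi>' = (\<lambda>(i, h). \<phi>' (c' i) h)"
  have b: "bij_betw \<psi> I V" unfolding \<psi>_def I_def by (rule cycle_index_bij[OF G(2,3)])
  have "I = (SIGMA i:{..<L}. {..p' (c' i)})" using p by (auto simp: I_def)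
  then have b': "bij_betw \<psi>' I V'" unfolding \<psi>'_def using cycle_index_bij[OF H(2,3)] by simp
  define f where "f = \<psi>' \<circ> inv_into I \<psi>"
  have bf: "bij_betw f V V'" unfolding f_def by (rule bij_betw_trans[OF bij_betw_inv_into[OF b] b'])
  have f: "f (\<psi> a) = \<psi>' a" if "a \<in> I" for a
    using that b by (simp add: f_def bij_betw_def inv_into_f_f)
  have "(u, v) \<in> E \<longleftrightarrow> (f u, f v) \<in> E'" if uv: "u \<in> V" "v \<in> V" for u v
  proof -
    obtain a a' where a: "a \<in> I" "u = \<psi> a" "a' \<in> I" "v = \<psi> a'" using uv b by (auto simp: bij_betw_def)
    obtain i h j h' where ab: "a = (i, h)" "a' = (j, h')" by (cases a, cases a')
    then have ih: "i < L" "h \<le> p (c i)" "j < L" "h' \<le> p (c j)" using a by (auto simp: I_def)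
    have "(u, v) \<in> E \<longleftrightarrow> (\<phi> (c i) h, \<phi> (c j) h') \<in> E" using a ab by (simp add: \<psi>_def)
    also have "\<dots> \<longleftrightarrow> (\<phi>' (c' i) h, \<phi>' (c' j) h') \<in> E'"
      using simple_graph.cycle_edge_iff[OF G ih] simple_graph.cycle_edge_iff[OF H, of i h j h'] ih p by simp
    also have "\<dots> \<longleftrightarrow> (f u, f v) \<in> E'" using f a ab by (simp add: \<psi>'_def)
    finally show ?thesis .
  qed
  then show ?thesis using that bf by blast
qed

section \<open>Cycle coordinates for \<open>H\<close>\<close>

locale balanced_cycle =
  fixes m k l :: nat
  assumes m2: "2 \<le> m"
begin

definition "H = cycle_paths (m - 1) (m - 1) k l"
abbreviation "VH \<equiv> pverts H"
abbreviation "EH \<equiv> parcs H"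

lemma VH: "VH = Cyc ` {..<2 * m} \<union> PathA ` {1..k} \<union> PathB ` {1..l}"
proof -
  have e: "m - 1 + (m - 1) + 2 = 2 * m" using m2 by simp
  show ?thesis unfolding H_def cycle_paths_def e by simp
qed

lemma EH: "EH = (let R = {(Cyc i, Cyc (Suc i mod (2 * m))) | i. i < 2 * m} \<union>
     {(Cyc 0, PathA 1) | _ :: unit. 1 \<le> k} \<union>
     {(PathA i, PathA (Suc i)) | i. 1 \<le> i \<and> i < k} \<union>
     {(Cyc m, PathB 1) | _ :: unit. 1 \<le> l} \<union>
     {(PathB i, PathB (Suc i)) | i. 1 \<le> i \<and> i < l} in R \<union> R\<inverse>)"
proof -
  have e: "m - 1 + (m - 1) + 2 = 2 * m" "m - 1 + 1 = m" using m2 by auto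
  show ?thesis unfolding H_def cycle_paths_def cp_edges_def e Let_def by simp
qed

lemma EH_iff:
  "(Cyc i, Cyc j) \<in> EH \<longleftrightarrow> i < 2 * m \<and> j < 2 * m \<and> (j = Suc i mod (2 * m) \<or> i = Suc j mod (2 * m))"
  "(Cyc i, PathA j) \<in> EH \<longleftrightarrow> i = 0 \<and> j = 1 \<and> 1 \<le> k"
  "(PathA j, Cyc i) \<in> EH \<longleftrightarrow> i = 0 \<and> j = 1 \<and> 1 \<le> k"
  "(Cyc i, PathB j) \<in> EH \<longleftrightarrow> i = m \<and> j = 1 \<and> 1 \<le> l"
  "(PathB j, Cyc i) \<in> EH \<longleftrightarrow> i = m \<and> j = 1 \<and> 1 \<le> l"
  "(PathA i, PathA j) \<in> EH \<longleftrightarrow> j = Suc i \<and> 1 \<le> i \<and> i < k \<or> i = Suc j \<and> 1 \<le> j \<and> j < k"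
  "(PathB i, PathB j) \<in> EH \<longleftrightarrow> j = Suc i \<and> 1 \<le> i \<and> i < l \<or> i = Suc j \<and> 1 \<le> j \<and> j < l"
  "(PathA i, PathB j) \<notin> EH" "(PathB i, PathA j) \<notin> EH"
  using m2 by (auto simp: EH Let_def)

lemma pair_graph_H: "pair_graph H"
  unfolding H_def using m2 by (intro pair_graph_cycle_paths) simp

lemma EH_sym: "(u, v) \<in> EH \<Longrightarrow> (v, u) \<in> EH"
  by (auto simp: EH Let_def)

lemma EH_star:
  assumes "v \<in> VH"
  shows "(Cyc 0, v) \<in> EH\<^sup>*"
proof -
  have C: "i < 2 * m \<Longrightarrow> (Cyc 0, Cyc i) \<in> EH\<^sup>*" for i
  proof (induction i)
    case (Suc i)
    then have "(Cyc i, Cyc (Suc i)) \<in> EH" by (simp add: EH_iff)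
    then show ?case using Suc by (simp add: rtrancl.rtrancl_into_rtrancl)
  qed simp
  have A: "1 \<le> j \<Longrightarrow> j \<le> k \<Longrightarrow> (Cyc 0, PathA j) \<in> EH\<^sup>*" for j
  proof (induction j rule: nat_induct_at_least)
    case base
    then show ?case by (simp add: EH_iff r_into_rtrancl)
  next
    case (Suc j)
    then have "(PathA j, PathA (Suc j)) \<in> EH" by (simp add: EH_iff)
    then show ?case using Suc by (simp add: rtrancl.rtrancl_into_rtrancl)
  qed
  have B: "1 \<le> j \<Longrightarrow> j \<le> l \<Longrightarrow> (Cyc 0, PathB j) \<in> EH\<^sup>*" for j
  proof (induction j rule: nat_induct_at_least)
    case base
    then have "(Cyc m, PathB 1) \<in> EH" by (simp add: EH_iff)
    then show ?case using C[of m] m2 by (simp add: rtrancl.rtrancl_into_rtrancl)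
  next
    case (Suc j)
    then have "(PathB j, PathB (Suc j)) \<in> EH" by (simp add: EH_iff)
    then show ?case using Suc by (simp add: rtrancl.rtrancl_into_rtrancl)
  qed
  show ?thesis using assms A B C unfolding VH by auto
qed

lemma simple_graph_H: "simple_graph VH EH"
proof -
  interpret pair_graph H by (rule pair_graph_H)
  have "sym EH" using EH_sym by (auto intro: symI)
  then have s: "sym (EH\<^sup>*)" by (rule sym_rtrancl)
  show ?thesis
  proof
    show "finite VH" by simp
    show "EH \<subseteq> VH \<times> VH" using in_arcsD1 in_arcsD2 by auto
    show "(u, u) \<notin> EH" for u using no_loops[of "(u, u)"] by auto
    show "(u, v) \<in> EH\<^sup>*" if "u \<in> VH" "v \<in> VH" for u v
      using EH_star[OF that(1)] EH_star[OF that(2)] s by (meson rtrancl_trans symD)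
  qed (rule EH_sym)
qed

definition cH :: "nat \<Rightarrow> cp_vertex" where "cH i = Cyc (i mod (2 * m))"

definition pH :: "cp_vertex \<Rightarrow> nat" where
  "pH v = (if v = Cyc 0 then k else if v = Cyc m then l else 0)"

definition \<phi>H :: "cp_vertex \<Rightarrow> nat \<Rightarrow> cp_vertex" where
  "\<phi>H v h = (if h = 0 then v else if v = Cyc 0 then PathA h else PathB h)"

lemma range_cH: "range cH = Cyc ` {..<2 * m}"
proof -
  have "Cyc i \<in> range cH" if "i < 2 * m" for i using that by (auto simp: cH_def intro!: range_eqI[of _ _ i])
  then show ?thesis using m2 by (auto simp: cH_def)
qed

lemma cycle_cH: "is_cycle EH (2 * m) cH"
proof -
  have "Suc i mod (2 * m) = Suc (i mod (2 * m)) mod (2 * m)" for i by (simp add: mod_Suc_eq)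
  then have "(cH i, cH (Suc i)) \<in> EH" for i using m2 by (simp add: cH_def EH_iff)
  then show ?thesis using m2 by (auto simp: is_cycle_def cH_def)
qed

lemma cH_chord: "(cH (Suc i), w) \<in> EH \<Longrightarrow> w \<in> range cH \<Longrightarrow> w = cH i \<or> w = cH (Suc (Suc i))"
proof -
  assume e: "(cH (Suc i), w) \<in> EH" and "w \<in> range cH"
  then obtain j where j: "w = Cyc j" "j < 2 * m" unfolding range_cH by auto
  have wj: "w = cH j" using j by (simp add: cH_def)
  have "j = Suc (Suc i mod (2 * m)) mod (2 * m) \<or> Suc i mod (2 * m) = Suc j mod (2 * m)"
    using e j by (auto simp: cH_def EH_iff)
  then have "cH j = cH (Suc (Suc i)) \<or> cH (Suc i) = cH (Suc j)"
    using j by (auto simp: cH_def mod_Suc_eq)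
  then show ?thesis using wj is_cycle_Suc_eq_iff[OF cycle_cH] by auto
qed

lemma spine_coords_H: "spine_coords VH EH (range cH) pH \<phi>H"
  unfolding spine_coords_def
proof (intro conjI ballI allI impI)
  show "\<phi>H s 0 = s" for s by (simp add: \<phi>H_def)
  show "bij_betw (\<lambda>(s, h). \<phi>H s h) (SIGMA s:range cH. {..pH s}) VH"
    unfolding bij_betw_def
  proof
    show "inj_on (\<lambda>(s, h). \<phi>H s h) (SIGMA s:range cH. {..pH s})"
      unfolding range_cH by (auto simp: inj_on_def \<phi>H_def pH_def split: if_splits)
    show "(\<lambda>(s, h). \<phi>H s h) ` (SIGMA s:range cH. {..pH s}) = VH" (is "?I = _")
    proof
      show "?I \<subseteq> VH" unfolding range_cH VH using m2 by (auto simp: \<phi>H_def pH_def split: if_splits)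
      have "Cyc i \<in> ?I" if "i < 2 * m" for i
        using that unfolding range_cH by (auto simp: \<phi>H_def intro!: image_eqI[of _ _ "(Cyc i, 0)"])
      moreover have "PathA j \<in> ?I" if "j \<in> {1..k}" for j
        using that m2 unfolding range_cH by (auto simp: \<phi>H_def pH_def intro!: image_eqI[of _ _ "(Cyc 0, j)"])
      moreover have "PathB j \<in> ?I" if "j \<in> {1..l}" for j
        using that m2 unfolding range_cH by (auto simp: \<phi>H_def pH_def intro!: image_eqI[of _ _ "(Cyc m, j)"])
      ultimately show "VH \<subseteq> ?I" unfolding VH by blast
    qed
  qed
next
  fix s h assume s: "s \<in> range cH" and h: "h < pH s"
  have "w \<in> EH `` {\<phi>H s (Suc h)} \<longleftrightarrow> w \<in> insert (\<phi>H s h) (if Suc h < pH s then {\<phi>H s (Suc (Suc h))} else {})" for w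
    using s h m2 by (cases w; cases h) (auto simp: \<phi>H_def pH_def EH_iff split: if_splits)
  then show "EH `` {\<phi>H s (Suc h)} = insert (\<phi>H s h) (if Suc h < pH s then {\<phi>H s (Suc (Suc h))} else {})"
    by blast
next
  fix s assume s: "s \<in> range cH"
  then obtain i where i: "s = Cyc i" "i < 2 * m" unfolding range_cH by auto
  have "w \<in> EH `` {s} - range cH \<longleftrightarrow> w \<in> (if 0 < pH s then {\<phi>H s 1} else {})" for w
    using i m2 unfolding range_cH by (cases w) (auto simp: \<phi>H_def pH_def EH_iff split: if_splits)
  then show "EH `` {s} - range cH = (if 0 < pH s then {\<phi>H s 1} else {})" by blast
qed

end

section \<open>Diameter, order and neighbourhood sums of \<open>H\<close>\<close>

context balanced_cycle
begin

lemma has_diameter_H: "has_diameter VH EH (m + k + l)"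
proof -
  interpret H: simple_graph VH EH by (rule simple_graph_H)
  have "\<exists>d\<le>m + k + l. (u, v) \<in> EH ^^ d" if uv: "u \<in> VH" "v \<in> VH" for u v
  proof (rule ccontr)
    assume "\<not> ?thesis"
    \<comment> \<open>\<open>cycle_diameter\<close> is applied one above the claimed diameter; only
      \<open>Cyc 0\<close> and \<open>Cyc m\<close> carry pendant paths, so it cannot be
      reached.\<close>
    then have "(u, v) \<notin> EH ^^ d" if "d < Suc (m + k + l)" for d using that by (meson less_Suc_eq_le)
    from H.cycle_diameter[OF cycle_cH spine_coords_H uv this] obtain i j
      where ij: "i < j" "j < 2 * m" "Suc (m + k + l) \<le> pH (cH i) + pH (cH j) + min (j - i) (2 * m - (j - i))"
      by blast
    have "pH (cH i) + pH (cH j) \<le> k + l" using ij by (auto simp: pH_def cH_def)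
    moreover have "min (j - i) (2 * m - (j - i)) \<le> m" by auto
    ultimately show False using ij(3) by linarith
  qed
  moreover have "\<exists>u\<in>VH. \<exists>v\<in>VH. \<forall>d<m + k + l. (u, v) \<notin> EH ^^ d"
  proof -
    \<comment> \<open>The signed distance from \<open>Cyc 0\<close>, negative along the path at
      \<open>Cyc 0\<close>, changes by at most 1 along edges and separates the two path ends by
      \<open>m + k + l\<close>.\<close>
    define f where "f v = (case v of Cyc i \<Rightarrow> int (min i (2 * m - i)) | PathA j \<Rightarrow> - int j | PathB j \<Rightarrow> int (m + j))" for v
    have lip: "\<bar>f u - f v\<bar> \<le> 1" if "(u, v) \<in> EH" for u v
      using that m2 by (cases u; cases v) (auto simp: f_def EH_iff mod_Suc min_def split: if_splits)
    let ?u = "\<phi>H (Cyc 0) k" and ?v = "\<phi>H (Cyc m) l"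
    have uv: "?u \<in> VH" "?v \<in> VH"
      using spine_coords_mem[OF spine_coords_H, of "Cyc 0" k] spine_coords_mem[OF spine_coords_H, of "Cyc m" l] m2
      by (auto simp: range_cH pH_def)
    have "f ?u = - int k" "f ?v = int (m + l)" using m2 by (auto simp: f_def \<phi>H_def)
    then have "(?u, ?v) \<notin> EH ^^ d" if "d < m + k + l" for d
      using H.lipschitz_relpow[of f ?u ?v d, OF lip] that by auto
    then show ?thesis using uv by blast
  qed
  ultimately show ?thesis unfolding has_diameter_def by blast
qed

lemma VH_nonempty: "VH \<noteq> {}"
proof -
  have "Cyc 0 \<in> VH" using m2 by (simp add: VH)
  then show ?thesis by blast
qed

lemma card_VH: "card VH = 2 * m + k + l"
proof -
  have "card (Cyc ` {..<2 * m} \<union> PathA ` {1..k} \<union> PathB ` {1..l}) = 2 * m + k + l"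
    by (subst card_Un_disjoint; (subst card_Un_disjoint)?) (auto simp: card_image inj_on_def)
  then show ?thesis by (simp add: VH)
qed

lemma sum_nbrs_Cyc:
  fixes X :: "cp_vertex \<Rightarrow> real"
  assumes "i < 2 * m"
  shows "(\<Sum>w\<in>EH `` {Cyc i}. X w) =
    X (Cyc (Suc i mod (2 * m))) + X (Cyc (if i = 0 then 2 * m - 1 else i - 1)) +
    ((if i = 0 \<and> 1 \<le> k then X (PathA 1) else 0) + (if i = m \<and> 1 \<le> l then X (PathB 1) else 0))"
proof -
  let ?a = "Cyc (Suc i mod (2 * m))" and ?b = "Cyc (if i = 0 then 2 * m - 1 else i - 1)"
  let ?T = "(if i = 0 \<and> 1 \<le> k then {PathA 1} else {}) \<union> (if i = m \<and> 1 \<le> l then {PathB 1} else {})"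
  have "w \<in> EH `` {Cyc i} \<longleftrightarrow> w \<in> {?a, ?b} \<union> ?T" for w
    using assms m2 by (cases w) (auto simp: EH_iff mod_Suc split: if_splits)
  then have "EH `` {Cyc i} = {?a, ?b} \<union> ?T" by blast
  moreover have "?a \<noteq> ?b" using assms m2 by (auto simp: mod_Suc)
  ultimately show ?thesis by (auto simp: sum.union_disjoint)
qed

lemma spectral_radius_H_le_cycle:
  assumes "k = 0" "l = 0" "2 \<le> r"
  shows "graph_spectral_radius H \<le> r"
proof (rule graph_spectral_radius_le[OF simple_graph_H VH_nonempty, of "\<lambda>_. 1"])
  fix v assume "v \<in> VH"
  then have "v \<in> Cyc ` {..<2 * m}" unfolding VH using assms by auto
  then obtain i where i: "v = Cyc i" "i < 2 * m" by auto
  have "(\<Sum>w\<in>EH `` {Cyc i}. 1) = (2::real)" unfolding sum_nbrs_Cyc[OF i(2)] using assms by simp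
  then show "(\<Sum>w\<in>EH `` {v}. 1) \<le> r * 1" using assms i by simp
qed simp

end

text \<open>The equality case of the branch inequality: for coefficients \<open>\<alpha> = 1\<close>
  and \<open>\<beta> = g\<close> on both spine edges, the branch vertex has weight
  \<open>g + 1\<close> and its spine neighbours \<open>(g + t\<^sup>2) / t\<close>. The identity
  reduces to \<open>g * (1 - e) = 1 + e\<close>.\<close>

lemma corner_identity:
  fixes t :: real
  assumes t: "t > 1" and d: "branch_defect (t\<^sup>2) p < 1"
  defines "g \<equiv> branch_gain (t\<^sup>2) p"
  shows "2 * ((g + t\<^sup>2) / t) + (g + 1) * (t * ((t\<^sup>2) ^ p - 1) / ((t\<^sup>2) ^ Suc p - 1)) = (t + 1 / t) * (g + 1)"
proof -
  define q where "q = t\<^sup>2"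
  have q: "q > 1" using t by (simp add: q_def one_less_power)
  define Q where "Q = q ^ Suc p"
  have Q: "Q > 1" unfolding Q_def using q by (intro one_less_power) auto
  define e where "e = branch_defect q p"
  have g: "g * (1 - e) = 1 + e" using d by (simp add: g_def branch_gain_def e_def q_def)
  have e': "e * (q - 1) = (Q - q) / (Q - 1)"
  proof -
    have nz: "q - 1 \<noteq> 0" "Q - 1 \<noteq> 0" using q Q by auto
    show ?thesis unfolding e_def branch_defect_def Q_def[symmetric] diff_frac_eq[OF nz] using nz by simp
  qed
  have "t * (t * (q ^ p - 1) / (Q - 1)) = (Q - q) / (Q - 1)"
    by (simp add: Q_def q_def power2_eq_square algebra_simps)
  then have T: "t * (t * (q ^ p - 1) / (Q - 1)) = e * (q - 1)" using e' by simp
  have "t * (2 * ((g + q) / t) + (g + 1) * (t * (q ^ p - 1) / (Q - 1))) =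
      2 * (g + q) + (g + 1) * (t * (t * (q ^ p - 1) / (Q - 1)))"
  proof -
    have "t * (2 * (a / t) + b * c) = 2 * a + b * (t * c)" for a b c :: real
      using t by (simp add: field_simps)
    then show ?thesis .
  qed
  also have "\<dots> = 2 * (g + q) + (g + 1) * (e * (q - 1))" by (simp only: T)
  also have "\<dots> = (q + 1) * (g + 1) + (q - 1) * ((1 + e) - g * (1 - e))" by (simp add: algebra_simps)
  also have "\<dots> = (q + 1) * (g + 1)" using g by simp
  also have "\<dots> = t * ((t + 1 / t) * (g + 1))" using t by (simp add: q_def power2_eq_square field_simps)
  finally show ?thesis using t by (simp add: q_def Q_def)
qed

text \<open>The multiple of \<open>t ^ (Suc p - j) - 1 / t ^ (Suc p - j)\<close> with value 1 at the
  root.\<close>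

definition tail_profile :: "real \<Rightarrow> nat \<Rightarrow> nat \<Rightarrow> real" where
  "tail_profile t p j = t ^ j * ((t\<^sup>2) ^ (Suc p - j) - 1) / ((t\<^sup>2) ^ Suc p - 1)"

lemma tail_profile_0: "t > 1 \<Longrightarrow> tail_profile t p 0 = 1"
  using one_less_power[of "t\<^sup>2" "Suc p"] one_less_power[of t 2] by (simp add: tail_profile_def)

lemma tail_profile_end: "tail_profile t p (Suc p) = 0"
  by (simp add: tail_profile_def)

lemma tail_profile_pos:
  assumes "t > 1" "j \<le> p"
  shows "0 < tail_profile t p j"
proof -
  have q: "1 < t\<^sup>2" using assms by simp
  have "1 < (t\<^sup>2) ^ (Suc p - j)" "1 < (t\<^sup>2) ^ Suc p"
    using assms by (intro one_less_power[OF q]; simp)+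
  then show ?thesis
    unfolding tail_profile_def using assms by (intro divide_pos_pos mult_pos_pos) (auto simp del: power_Suc)
qed

lemma tail_profile_step:
  assumes t: "t > 1" and j: "j < p"
  shows "tail_profile t p j + tail_profile t p (Suc (Suc j)) = (t + 1 / t) * tail_profile t p (Suc j)"
proof -
  define A where "A = (t\<^sup>2) ^ (p - Suc j)"
  define c where "c = t\<^sup>2 * (t\<^sup>2) ^ p - 1"
  have e: "Suc p - j = Suc (Suc (p - Suc j))" "Suc p - Suc j = Suc (p - Suc j)" "Suc p - Suc (Suc j) = p - Suc j"
    using j by auto
  have "t ^ j * (t\<^sup>2 * (t\<^sup>2 * A) - 1) + t ^ Suc (Suc j) * (A - 1) = (t + 1 / t) * (t ^ Suc j * (t\<^sup>2 * A - 1))"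
    using t by (simp add: field_simps power2_eq_square)
  then have "(t ^ j * (t\<^sup>2 * (t\<^sup>2 * A) - 1) + t ^ Suc (Suc j) * (A - 1)) / c =
      (t + 1 / t) * (t ^ Suc j * (t\<^sup>2 * A - 1)) / c"
    by simp
  then show ?thesis
    unfolding tail_profile_def e power_Suc[of "t\<^sup>2"] A_def[symmetric] c_def[symmetric]
    by (simp only: add_divide_distrib times_divide_eq_right)
qed

context balanced_cycle
begin

text \<open>The test vector is an explicit eigenvector: \<open>\<xi> a = t ^ a + g / t ^ a\<close>
  at distance \<open>a\<close> from \<open>Cyc 0\<close> on the cycle, continued along the pendant
  paths by \<open>tail_profile\<close>.\<close>

lemma spectral_radius_H_le:
  assumes t: "t > 1" and d: "branch_defect (t\<^sup>2) k < 1" "branch_defect (t\<^sup>2) l < 1"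
    and gain: "branch_gain (t\<^sup>2) k * branch_gain (t\<^sup>2) l = (t\<^sup>2) ^ m"
  shows "graph_spectral_radius H \<le> t + 1 / t"
proof -
  define g g' where "g = branch_gain (t\<^sup>2) k" and "g' = branch_gain (t\<^sup>2) l"
  have q: "t\<^sup>2 > 1" using t by (simp add: one_less_power)
  have g: "g \<ge> 1" unfolding g_def by (rule branch_gain_ge_1[OF q d(1)])
  define \<xi> where "\<xi> a = (g + (t\<^sup>2) ^ a) / t ^ a" for a :: nat
  have \<xi>pos: "\<xi> a > 0" for a using g t by (simp add: \<xi>_def add_pos_pos)
  have inner: "\<xi> b + \<xi> (Suc (Suc b)) = (t + 1 / t) * \<xi> (Suc b)" for b
  proof -
    have "t ^ b \<noteq> 0" "t \<noteq> 0" using t by auto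
    then show ?thesis by (simp add: \<xi>_def field_simps power2_eq_square)
  qed
  have left: "2 * \<xi> 1 + \<xi> 0 * tail_profile t k 1 = (t + 1 / t) * \<xi> 0"
    using corner_identity[OF t d(1)] by (simp add: \<xi>_def g_def tail_profile_def)
  have right: "2 * \<xi> (m - 1) + \<xi> m * tail_profile t l 1 = (t + 1 / t) * \<xi> m"
  proof -
    \<comment> \<open>Read from \<open>Cyc m\<close>, the growing mode has coefficient
      \<open>s\<close> and the decaying one \<open>t ^ m = s * g'\<close>, by \<open>gain\<close>.
      So the corner identity for \<open>l\<close> applies, scaled by \<open>s\<close>.\<close>
    define s where "s = g / t ^ m"
    have m: "m = Suc (m - 1)" using m2 by simp
    have xm: "\<xi> m = s * (g' + 1)"
      using gain by (simp add: \<xi>_def s_def g_def g'_def field_simps)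
    have "(t\<^sup>2) ^ (m - 1) * t\<^sup>2 = g * g'" using gain m by (metis g_def g'_def power_Suc2)
    then have "(g + (t\<^sup>2) ^ (m - 1)) * t\<^sup>2 = g * (g' + t\<^sup>2)" by (simp add: algebra_simps)
    then have "(g + (t\<^sup>2) ^ (m - 1)) * t * t = g * (g' + t\<^sup>2)" by (simp add: power2_eq_square mult.assoc)
    moreover have "t ^ m = t ^ (m - 1) * t" using m by (metis power_Suc2)
    ultimately have xm1: "\<xi> (m - 1) = s * ((g' + t\<^sup>2) / t)"
    proof -
      assume e: "(g + (t\<^sup>2) ^ (m - 1)) * t * t = g * (g' + t\<^sup>2)" and tm: "t ^ m = t ^ (m - 1) * t"
      have nz: "t ^ (m - 1) \<noteq> 0" "t \<noteq> 0" using t by auto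
      have "s * ((g' + t\<^sup>2) / t) = (g * (g' + t\<^sup>2)) / (t ^ (m - 1) * t * t)" by (simp add: s_def tm)
      also have "\<dots> = \<xi> (m - 1)" unfolding e[symmetric] \<xi>_def using nz by simp
      finally show ?thesis by simp
    qed
    have "s * (2 * ((g' + t\<^sup>2) / t) + (g' + 1) * tail_profile t l 1) = s * ((t + 1 / t) * (g' + 1))"
      using corner_identity[OF t d(2)] by (simp add: g'_def tail_profile_def)
    moreover have "2 * (s * a) + s * b * c = s * (2 * a + b * c)" for a b c :: real by (simp add: algebra_simps)
    ultimately show ?thesis unfolding xm xm1 by (simp only: mult.left_commute)
  qed
  define X where "X v = (case v of Cyc i \<Rightarrow> \<xi> (min i (2 * m - i))
     | PathA j \<Rightarrow> \<xi> 0 * tail_profile t k j | PathB j \<Rightarrow> \<xi> m * tail_profile t l j)" for v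
  \<comment> \<open>Since \<open>tail_profile t 0 1 = 0\<close>, the formula also covers a missing
    pendant path.\<close>
  have tk: "(if 1 \<le> k then X (PathA 1) else 0) = \<xi> 0 * tail_profile t k 1"
    using tail_profile_end[of t k] by (cases k) (auto simp: X_def)
  have tl: "(if 1 \<le> l then X (PathB 1) else 0) = \<xi> m * tail_profile t l 1"
    using tail_profile_end[of t l] by (cases l) (auto simp: X_def)
  have Cyc: "(\<Sum>w\<in>EH `` {Cyc i}. X w) = (t + 1 / t) * X (Cyc i)" if i: "i < 2 * m" for i
  proof -
    consider "i = 0" | "0 < i" "i < m" | "i = m" | "m < i" by linarith
    then show ?thesis
    proof cases
      case 1
      have "X (Cyc 1) = \<xi> 1" "X (Cyc (2 * m - 1)) = \<xi> 1" "X (Cyc 0) = \<xi> 0"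
        using m2 by (auto simp: X_def min_def)
      then show ?thesis using sum_nbrs_Cyc[OF i, of X] left tk 1 m2 by simp
    next
      case 2
      then have "X (Cyc (Suc i mod (2 * m))) = \<xi> (Suc i)" "X (Cyc (i - 1)) = \<xi> (i - 1)" "X (Cyc i) = \<xi> i"
        by (auto simp: X_def min_def)
      then show ?thesis using sum_nbrs_Cyc[OF i, of X] inner[of "i - 1"] 2 by simp
    next
      case 3
      then have "X (Cyc (Suc i mod (2 * m))) = \<xi> (m - 1)" "X (Cyc (i - 1)) = \<xi> (m - 1)" "X (Cyc i) = \<xi> m"
        using m2 by (auto simp: X_def min_def)
      then show ?thesis using sum_nbrs_Cyc[OF i, of X] right tl 3 m2 by simp
    next
      case 4
      \<comment> \<open>The second half of the cycle mirrors the first; \<open>Suc a\<close> is the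
        distance from \<open>Cyc i\<close> to \<open>Cyc 0\<close>.\<close>
      define a where "a = 2 * m - i - 1"
      have "X (Cyc (Suc i mod (2 * m))) = \<xi> a" "X (Cyc (i - 1)) = \<xi> (Suc (Suc a))" "X (Cyc i) = \<xi> (Suc a)"
        using 4 i by (auto simp: X_def min_def a_def mod_Suc intro!: arg_cong[of _ _ \<xi>])
      then show ?thesis using sum_nbrs_Cyc[OF i, of X] inner[of a] 4 by simp
    qed
  qed
  have tail: "(\<Sum>w\<in>EH `` {\<phi>H s (Suc h)}. X w) = (t + 1 / t) * X (\<phi>H s (Suc h))"
    if s: "s \<in> range cH" "h < pH s" for s h
  proof -
    have prof: "X (\<phi>H s j) = X s * tail_profile t (pH s) j" for j
    proof (cases "j = 0")
      case True
      then show ?thesis using tail_profile_0[OF t] by (simp add: \<phi>H_def)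
    next
      case False
      then show ?thesis using s m2 by (auto simp: \<phi>H_def X_def pH_def min_def split: if_splits)
    qed
    have ne: "\<phi>H s h \<noteq> \<phi>H s (Suc (Suc h))" if "Suc h < pH s"
      using spine_coords_inj[OF spine_coords_H s(1) s(1), of h "Suc (Suc h)"] that by simp
    have "(\<Sum>w\<in>EH `` {\<phi>H s (Suc h)}. X w) = X (\<phi>H s h) + X (\<phi>H s (Suc (Suc h)))"
    proof (cases "Suc h < pH s")
      case True
      then show ?thesis using spine_coords_nbrs[OF spine_coords_H s] ne by simp
    next
      case False
      then have "Suc h = pH s" using s by simp
      then have "X (\<phi>H s (Suc (Suc h))) = 0" using prof[of "Suc (Suc h)"] tail_profile_end[of t "pH s"] by simp
      then show ?thesis using spine_coords_nbrs[OF spine_coords_H s] False by simp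
    qed
    also have "\<dots> = X s * (tail_profile t (pH s) h + tail_profile t (pH s) (Suc (Suc h)))"
      by (simp add: prof distrib_left)
    also have "\<dots> = (t + 1 / t) * X (\<phi>H s (Suc h))"
      unfolding prof tail_profile_step[OF t s(2)] by simp
    finally show ?thesis .
  qed
  show ?thesis
  proof (rule graph_spectral_radius_le[OF simple_graph_H VH_nonempty, of X])
    fix v assume v: "v \<in> VH"
    show "0 < X v"
      using v \<xi>pos tail_profile_pos[OF t] unfolding VH by (auto simp: X_def)
    obtain s h where s: "s \<in> range cH" "h \<le> pH s" "v = \<phi>H s h"
      using spine_coords_obtain[OF spine_coords_H v] .
    show "(\<Sum>w\<in>EH `` {v}. X w) \<le> (t + 1 / t) * X v"
    proof (cases h)
      case 0
      then obtain i where "v = Cyc i" "i < 2 * m" using s by (auto simp: range_cH \<phi>H_def)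
      then show ?thesis using Cyc by simp
    next
      case (Suc j)
      then show ?thesis using tail[of s j] s by simp
    qed
  qed
qed

end

section \<open>The extremal graph\<close>

lemma is_cycle_add_eq_iff: "is_cycle E L c \<Longrightarrow> c (a + i) = c (b + i) \<longleftrightarrow> c a = c b"
  by (induction i) (auto simp: is_cycle_Suc_eq_iff)

lemma is_cycle_shift:
  assumes c: "is_cycle E L c"
  shows "is_cycle E L (\<lambda>a. c (a + i))" "range (\<lambda>a. c (a + i)) = range c"
proof -
  show "is_cycle E L (\<lambda>a. c (a + i))"
    using c is_cycle_add_eq_iff[OF c] by (simp add: is_cycle_def)
  have "c a \<in> range (\<lambda>a. c (a + i))" for a
  proof -
    \<comment> \<open>Modulo \<open>L\<close>, adding \<open>i * (L - 1)\<close> undoes the shift by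
      \<open>i\<close>.\<close>
    have "(a + i * (L - 1) + i) mod L = (a + i * L) mod L" using c
      by (cases L) (auto simp: is_cycle_def algebra_simps)
    then have "c a = c (a + i * (L - 1) + i)" using c by (simp add: is_cycle_def)
    then show ?thesis by blast
  qed
  then show "range (\<lambda>a. c (a + i)) = range c" by blast
qed

lemma add_inverse_mono:
  fixes s t :: real
  assumes "1 \<le> t" "t \<le> s"
  shows "t + 1 / t \<le> s + 1 / s"
proof -
  have "1 * 1 \<le> s * t" using assms by (intro mult_mono) auto
  then have "0 \<le> (s - t) * (s * t - 1) / (s * t)" using assms by simp
  also have "\<dots> = (s + 1 / s) - (t + 1 / t)" using assms by (simp add: field_simps)
  finally show ?thesis by simp
qed

text \<open>For \<open>k = 0\<close> the graph is a plain cycle of spectral radius at most 2;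
  \<open>q = 3 / 2\<close> is small enough to admit no branch, while
  \<open>t + 1 / t \<ge> 2\<close>. Otherwise \<open>q\<close> is the balanced parameter.\<close>

lemma (in balanced_cycle) ex_extremal_parameter:
  assumes "l \<le> k" "k \<le> Suc l" "k + l + 7 \<le> m"
  obtains t where "1 < t" "t\<^sup>2 \<le> 2" "graph_spectral_radius H \<le> t + 1 / t" "forces_balance (t\<^sup>2) k l m"
proof (cases "k = 0")
  case True
  define t where "t = sqrt (3 / 2)"
  have t: "1 < t" "t\<^sup>2 = 3 / 2" by (auto simp: t_def)
  have l: "l = 0" using True assms by simp
  have "2 \<le> t + 1 / t" using add_inverse_mono[of 1 t] t by simp
  then show ?thesis
    using that[of t] t spectral_radius_H_le_cycle[OF True l] forces_balance_0 True l by simp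
next
  case False
  then have k1: "1 \<le> k" by simp
  obtain q :: real where qq: "3 / 2 < q" "q < 2" "branch_defect q k < 1" "branch_gain q k * branch_gain q l = q ^ m"
    using ex_balanced_parameter[OF k1 assms(1,3)] by blast
  interpret B: balanced_parameter q k l m using qq assms by unfold_locales
  define t where "t = sqrt q"
  have t: "1 < t" "t\<^sup>2 = q" using qq by (auto simp: t_def)
  have "graph_spectral_radius H \<le> t + 1 / t"
    using t qq B.defect_l by (intro spectral_radius_H_le) auto
  then show ?thesis using that[of t] t qq B.forces_balance by simp
qed

lemma ex_isomorphism_to_balanced_cycle:
  assumes G: "connected_graph_with (2 * m + k + l) (m + k + l) G"
    and kl: "l \<le> k" "k \<le> Suc l" "k + l + 7 \<le> m"
    and le: "graph_spectral_radius G \<le> graph_spectral_radius (balanced_cycle.H m k l)"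
  obtains f where "bij_betw f (pverts G) (pverts (balanced_cycle.H m k l))"
    "\<And>u v. u \<in> pverts G \<Longrightarrow> v \<in> pverts G \<Longrightarrow>
      (u, v) \<in> parcs G \<longleftrightarrow> (f u, f v) \<in> parcs (balanced_cycle.H m k l)"
proof -
  interpret H: balanced_cycle m k l using kl by unfold_locales simp
  define D where "D = m + k + l"
  have pg: "pair_graph G" using G by (simp add: connected_graph_with_def)
  have ne: "pverts G \<noteq> {}" and card: "card (pverts G) = 2 * m + k + l"
    and diam: "has_diameter (pverts G) (parcs G) D"
    using G connected_graph_with_iff[OF pg] by (auto simp: D_def)
  interpret G: simple_graph "pverts G" "parcs G" by (rule simple_graph_connected_graph_with[OF G])
  obtain t where t: "1 < t" "t\<^sup>2 \<le> 2" "graph_spectral_radius H.H \<le> t + 1 / t" "forces_balance (t\<^sup>2) k l m"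
    using H.ex_extremal_parameter[OF kl] .
  obtain x where x: "\<And>v. v \<in> pverts G \<Longrightarrow> 0 < x v"
    "\<And>v. v \<in> pverts G \<Longrightarrow> (\<Sum>w\<in>parcs G `` {v}. x w) = graph_spectral_radius G * x v"
    using graph_spectral_radius_eigenvector[OF G.simple_graph_axioms ne] by blast
  have sup: "(\<Sum>w\<in>parcs G `` {v}. x w) \<le> r * x v" if "v \<in> pverts G" "graph_spectral_radius G \<le> r" for v r
    using x[OF that(1)] that(2) by (simp add: mult_right_mono)
  have ts: "t \<le> sqrt 2" using t by (simp add: real_le_rsqrt)
  interpret W: weighted_graph "pverts G" "parcs G" x t
    using x sup le t by unfold_locales auto
  \<comment> \<open>The acyclic estimate is stated at \<open>sqrt 2\<close>; the same vector
    qualifies because \<open>t + 1 / t\<close> increases for \<open>t \<ge> 1\<close>.\<close>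
  interpret W2: weighted_graph "pverts G" "parcs G" x "sqrt 2"
    using x sup le t add_inverse_mono[of t "sqrt 2"] ts by unfold_locales auto
  have upper: "\<And>u v. u \<in> pverts G \<Longrightarrow> v \<in> pverts G \<Longrightarrow> \<exists>d\<le>D. (u, v) \<in> parcs G ^^ d"
    using diam by (simp add: has_diameter_def)
  obtain L c where c: "is_cycle (parcs G) L c"
  proof (rule ccontr)
    assume "\<not> thesis"
    then have "\<nexists>L c. is_cycle (parcs G) L c" using that by blast
    then have "2 * card (pverts G) \<le> 3 * D + 6" by (rule W2.acyclic_diameter[OF refl ne _ upper])
    \<comment> \<open>Here twice the order minus \<open>3 * D\<close> is
      \<open>m - k - l \<ge> 7\<close>.\<close>
    then show False using card kl by (simp add: D_def)
  qed
  obtain p \<phi> where sc: "spine_coords (pverts G) (parcs G) (range c) p \<phi>" using W.cycle_spine_coords[OF c] by blast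
  obtain u v where uv: "u \<in> pverts G" "v \<in> pverts G" "\<And>d. d < D \<Longrightarrow> (u, v) \<notin> parcs G ^^ d"
    using diam by (auto simp: has_diameter_def)
  obtain i j where ij: "i < j" "j < L" and Dle: "D \<le> p (c i) + p (c j) + min (j - i) (L - (j - i))"
    using G.cycle_diameter[OF c sc uv] .
  have n: "2 * m + k + l = L + (\<Sum>a<L. p (c a))" using G.cycle_card[OF c sc] card by simp
  have split: "(\<Sum>a<L. p (c a)) = p (c i) + p (c j) + (\<Sum>a\<in>{..<L} - {i, j}. p (c a))"
    using ij by (subst sum.subset_diff[of "{i, j}"]) auto
  have bal: "L = 2 * m \<and> (p (c i) = k \<and> p (c j) = l \<or> p (c i) = l \<and> p (c j) = k)"
  proof -
    have "m + k + l \<le> p (c i) + p (c j) + L div 2" using Dle by (auto simp: D_def min_def split: if_splits)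
    moreover have "L + p (c i) + p (c j) \<le> 2 * m + k + l" using n split by simp
    ultimately show ?thesis
      using t(4) W.cycle_branch_gains(1)[OF c sc] W.cycle_two_branch_gains[OF c sc ij]
      unfolding forces_balance_def by blast
  qed
  then have L: "L = 2 * m" and pij: "p (c i) + p (c j) = k + l" by auto
  \<comment> \<open>The branches have total length \<open>k + l\<close>, so the shorter arc must
    contribute \<open>m\<close> to the diameter.\<close>
  have ji: "j = i + m" using Dle pij ij L by (auto simp: D_def min_def split: if_splits)
  have "(\<Sum>a\<in>{..<L} - {i, j}. p (c a)) = 0" using n split L pij by simp
  then have zero: "p s = 0" if "s \<in> range c" "s \<noteq> c i" "s \<noteq> c j" for s
    using that is_cycle_range[OF c] by auto
  \<comment> \<open>The rotation puts the pendant path of length \<open>k\<close> at position 0. If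
    it starts at \<open>j\<close>, then position \<open>m\<close> is \<open>i\<close> one period
    later.\<close>
  define a0 where "a0 = (if p (c i) = k \<and> p (c j) = l then i else j)"
  define c' where "c' a = c (a + a0)" for a
  have c': "is_cycle (parcs G) L c'" "range c' = range c"
    unfolding c'_def by (rule is_cycle_shift[OF c])+
  have per: "c (a + 2 * m) = c a" for a using is_cycle_period[OF c] L by simp
  have c'0m: "p (c' 0) = k" "p (c' m) = l" "c' 0 = c i \<and> c' m = c j \<or> c' 0 = c j \<and> c' m = c i"
    using bal ji per[of i] by (auto simp: c'_def a0_def add.commute mult_2 add.left_commute)
  have p: "p (c' a) = H.pH (H.cH a)" if a: "a < L" for a
  proof -
    have eq: "c' a = c' b \<longleftrightarrow> a = b" if "b < L" for b using c'(1) a that by (simp add: is_cycle_def)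
    have m: "0 < L" "m < L" using L H.m2 by auto
    consider "a = 0" | "a = m" | "a \<noteq> 0" "a \<noteq> m" by blast
    then show ?thesis
    proof cases
      case 3
      then have "c' a \<noteq> c' 0" "c' a \<noteq> c' m" using eq m by auto
      moreover have "c' a \<in> range c" using c'(2) by blast
      ultimately have "p (c' a) = 0" using zero[of "c' a"] c'0m(3) by auto
      then show ?thesis using 3 a L by (simp add: H.pH_def H.cH_def)
    qed (use c'0m m L H.m2 in \<open>auto simp: H.pH_def H.cH_def\<close>)
  qed
  have sc': "spine_coords (pverts G) (parcs G) (range c') p \<phi>" using sc c'(2) by simp
  show ?thesis
    using cycle_spines_isomorphic[OF G.simple_graph_axioms c'(1) sc' W.cycle_no_chord[OF c'(1)]
        H.simple_graph_H _ H.spine_coords_H H.cH_chord p] H.cycle_cH L that by blast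
qed

text \<open>The Perron vector of \<open>G\<close>, transported along \<open>f\<close>, is a test
  vector for \<open>H\<close>.\<close>

lemma graph_spectral_radius_le_isomorphic:
  assumes G: "simple_graph (pverts G) (parcs G)" "pverts G \<noteq> {}"
    and H: "simple_graph (pverts H) (parcs H)"
    and f: "bij_betw f (pverts G) (pverts H)"
      "\<And>u v. u \<in> pverts G \<Longrightarrow> v \<in> pverts G \<Longrightarrow> (u, v) \<in> parcs G \<longleftrightarrow> (f u, f v) \<in> parcs H"
  shows "graph_spectral_radius H \<le> graph_spectral_radius G"
proof -
  interpret G: simple_graph "pverts G" "parcs G" by fact
  interpret H: simple_graph "pverts H" "parcs H" by fact
  obtain x where x: "\<And>v. v \<in> pverts G \<Longrightarrow> 0 < x v"
    "\<And>v. v \<in> pverts G \<Longrightarrow> (\<Sum>w\<in>parcs G `` {v}. x w) = graph_spectral_radius G * x v"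
    using graph_spectral_radius_eigenvector[OF G] by blast
  define g where "g = inv_into (pverts G) f"
  have gf: "g (f v) = v" if "v \<in> pverts G" for v using that f(1) by (simp add: g_def bij_betw_def inv_into_f_f)
  have im: "f ` pverts G = pverts H" using f(1) by (simp add: bij_betw_def)
  have neH: "pverts H \<noteq> {}" using im G(2) by blast
  show ?thesis
  proof (rule graph_spectral_radius_le[OF H neH, of "\<lambda>v. x (g v)"])
    fix v' assume "v' \<in> pverts H"
    then obtain v where v: "v \<in> pverts G" "v' = f v" using im by blast
    show "0 < x (g v')" using x(1) v gf by simp
    have "parcs H `` {f v} = f ` (parcs G `` {v})"
    proof
      show "f ` (parcs G `` {v}) \<subseteq> parcs H `` {f v}" using f(2) v(1) G.inV(2) by blast
      show "parcs H `` {f v} \<subseteq> f ` (parcs G `` {v})"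
      proof
        fix w' assume w': "w' \<in> parcs H `` {f v}"
        then have "w' \<in> pverts H" using H.inV(2) by blast
        then obtain w where "w \<in> pverts G" "w' = f w" using im by blast
        then show "w' \<in> f ` (parcs G `` {v})" using w' f(2)[OF v(1)] by blast
      qed
    qed
    moreover have "inj_on f (parcs G `` {v})"
      by (rule inj_on_subset[of f "pverts G"]) (use f(1) G.inV(2) in \<open>auto simp: bij_betw_def\<close>)
    ultimately have "(\<Sum>w\<in>parcs H `` {f v}. x (g w)) = (\<Sum>w\<in>parcs G `` {v}. x (g (f w)))"
      by (simp add: sum.reindex)
    also have "\<dots> = (\<Sum>w\<in>parcs G `` {v}. x w)" using gf G.inV(2) by (intro sum.cong) auto
    finally show "(\<Sum>w\<in>parcs H `` {v'}. x (g w)) \<le> graph_spectral_radius G * x (g v')"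
      using x(2)[OF v(1)] v gf by simp
  qed
qed

theorem theorem1p3:
  fixes n D :: nat
  assumes "n \<ge> 13"
    and "real n / 2 \<le> real D"
    and "real D \<le> (2 * real n - 7) / 3"
  shows "connected_graph_with n D (H_graph n D) \<and>
    (\<forall>G :: 'a pair_pre_digraph. connected_graph_with n D G \<longrightarrow>
       graph_spectral_radius (H_graph n D) \<le> graph_spectral_radius G \<and>
       (graph_spectral_radius G = graph_spectral_radius (H_graph n D) \<longrightarrow>
          digraph_iso (with_proj G) (with_proj (H_graph n D))))"
proof -
  define m k l where "m = n - D" and "k = D - n div 2" and "l = D - (n + 1) div 2"
  have "real n \<le> real (2 * D)" "real (3 * D + 7) \<le> real (2 * n)" using assms by auto
  then have "n \<le> 2 * D" "3 * D + 7 \<le> 2 * n" by (simp_all only: of_nat_le_iff)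
  \<comment> \<open>Half the cycle length is \<open>m\<close>; in these terms
    \<open>3 * D + 7 \<le> 2 * n\<close> is exactly \<open>k + l + 7 \<le> m\<close>.\<close>
  then have kl: "l \<le> k" "k \<le> Suc l" "k + l + 7 \<le> m" and nD: "n = 2 * m + k + l" "D = m + k + l"
    by (auto simp: m_def k_def l_def)
  interpret H: balanced_cycle m k l using kl by unfold_locales simp
  have HH: "H_graph n D = H.H" unfolding H.H_def H_graph_def by (simp only: m_def k_def l_def)
  have cH: "connected_graph_with n D H.H"
    unfolding connected_graph_with_iff[OF H.pair_graph_H]
    using H.VH_nonempty H.card_VH H.has_diameter_H nD by simp
  \<comment> \<open>This gives minimality and uniqueness at once: a competitor whose radius does not
    exceed that of \<open>H\<close> is isomorphic to \<open>H\<close>, so its radius is not smaller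
    either.\<close>
  have main: "graph_spectral_radius H.H \<le> graph_spectral_radius G \<and> digraph_iso (with_proj G) (with_proj H.H)"
    if G: "connected_graph_with n D G" and le: "graph_spectral_radius G \<le> graph_spectral_radius H.H"
    for G :: "'a pair_pre_digraph"
  proof -
    interpret G: pair_graph G using G by (simp add: connected_graph_with_def)
    interpret HG: pair_graph H.H by (rule H.pair_graph_H)
    have ne: "pverts G \<noteq> {}" using G connected_graph_with_iff[OF G.pair_graph_axioms] by blast
    obtain f where f: "bij_betw f (pverts G) (pverts H.H)"
      "\<And>u v. u \<in> pverts G \<Longrightarrow> v \<in> pverts G \<Longrightarrow> (u, v) \<in> parcs G \<longleftrightarrow> (f u, f v) \<in> parcs H.H"
      using ex_isomorphism_to_balanced_cycle[OF G[unfolded nD] kl le] by blast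
    show ?thesis
      using graph_spectral_radius_le_isomorphic[OF simple_graph_connected_graph_with[OF G] ne H.simple_graph_H f]
        digraph_isoI[OF G.pair_wf_digraph_axioms HG.pair_wf_digraph_axioms f] by blast
  qed
  show ?thesis
    unfolding HH using cH main by (metis linear order_refl)
qed

end
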